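(* Let $d\ge 3$, let $K\subset\mathbb{R}^d$ be a convex body with a $C^1$-smooth boundary and let $\delta\in(0,\mathrm{vol}_d(K))$. Assume that the center of mass of $K$ coincides with the center of mass of the surface of centers $\mathcal{S}_\delta$. Suppose that for every $\xi\in S^{d-1}$ the cutting section $K\cap H(\xi)$ is $(d+1)$-equichordal, i.e., there exists a constant $c$ such that for every line $l\subset H(\xi)$ passing through the center of mass $\mathcal{C}(K\cap H(\xi))$, with $\zeta_+(l)$ and $\zeta_-(l)$ denoting its two points of intersection with the boundary of $K$, one has $$\mathrm{dist}^{d+1}\big(\mathcal{C}(K\cap H(\xi)),\zeta_+(l)\big)+\mathrm{dist}^{d+1}\big(\mathcal{C}(K\cap H(\xi)),\zeta_-(l)\big)=c.$$ Then $K$ floats in equilibrium in every orientation at the level $\delta$.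
   Context: A convex body $K\subset\mathbb{R}^d$ is a compact convex set with non-empty interior. The set $S^{d-1}$ is the unit sphere centered at the origin. $K$ has a $C^1$-smooth boundary if near each of its points $\partial K$ can be written as the graph of a $C^1$ function. For a compact convex set $L$ with non-empty relative interior in a $j$-dimensional plane, $\mathcal{C}(L)=\frac{1}{\mathrm{vol}_j(L)}\int_L x\,dx$ denotes its center of mass. For $\xi\in S^{d-1}$, the cutting hyperplane of $K$ in the direction $\xi$ at the level $\delta$ is the hyperplane $H(\xi)=\{p\in\mathbb{R}^d: p\cdot\xi=t(\xi)\}$, where $t(\xi)\in\mathbb{R}$ is chosen so that $\mathrm{vol}_d(K\cap H^-(\xi))=\delta$, with $H^-(\xi)=\{p\in\mathbb{R}^d: p\cdot\xi\le t(\xi)\}$. The set $K\cap H(\xi)$ is called a cutting section. Let $\mathcal{C}_\delta(\xi)=\mathcal{C}(K\cap H^-(\xi))$ be the center of mass of the submerged part. $K$ floats in equilibrium in the direction $\xi$ at the level $\delta$ if the line through $\mathcal{C}(K)$ and $\mathcal{C}_\delta(\xi)$ is parallel to $\xi$. $K$ floats in equilibrium in every orientation at the level $\delta$ if this holds for every $\xi\in S^{d-1}$. The surface of centers is the set $\mathcal{S}_\delta=\{\mathcal{C}_\delta(\xi):\xi\in S^{d-1}\}$; it is the boundary of a strictly convex body. Its center of mass is its centroid with respect to the $(d-1)$-dimensional surface measure. The equichordal condition is a property of each section separately: the constant $c$ exists for each section $K\cap H(\xi)$. *)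

theory Defs
  imports "HOL-Analysis.Analysis"
begin

text \<open>
  Countable covers are sequences of sets; the empty set is given weight 0, also for \<open>s = 0\<close>.
  The factor \<^term>\<open>unit_ball_vol (real s)\<close> normalises the measure so that it is the usual
  \<open>s\<close>-dimensional surface measure on \<open>s\<close>-dimensional surfaces.
\<close>

definition hausdorff_weight :: "nat \<Rightarrow> 'a::metric_space set \<Rightarrow> ennreal" where
  "hausdorff_weight s C =
     (if C = {} then 0 else ennreal (unit_ball_vol (real s) * (diameter C / 2) ^ s))"

definition hausdorff_content :: "nat \<Rightarrow> real \<Rightarrow> 'a::metric_space set \<Rightarrow> ennreal" where
  "hausdorff_content s \<epsilon> A =
     (INF C \<in> {C :: nat \<Rightarrow> 'a set. A \<subseteq> (\<Union>i. C i) \<and> (\<forall>i. bounded (C i) \<and> diameter (C i) \<le> \<epsilon>)}.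
        \<Sum>i. hausdorff_weight s (C i))"

definition hausdorff_outer :: "nat \<Rightarrow> 'a::metric_space set \<Rightarrow> ennreal" where
  "hausdorff_outer s A = (SUP \<epsilon> \<in> {0<..}. hausdorff_content s \<epsilon> A)"

definition hausdorff_measure :: "nat \<Rightarrow> 'a::metric_space measure" where
  "hausdorff_measure s = measure_of UNIV (sets borel) (hausdorff_outer s)"

text \<open>
  The outer measure is countably additive on Borel sets, so \<^const>\<open>measure_of\<close> does not collapse
  to the null measure (see \<open>emeasure_hausdorff_measure\<close> below).
\<close>

lemma hausdorff_weight_empty [simp]: "hausdorff_weight s {} = 0"
  by (simp add: hausdorff_weight_def)

lemma hausdorff_content_empty [simp]: "0 \<le> \<epsilon> \<Longrightarrow> hausdorff_content s \<epsilon> {} = 0"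
proof -
  assume "0 \<le> \<epsilon>"
  then have "hausdorff_content s \<epsilon> ({} :: 'a set) \<le> (\<Sum>i::nat. hausdorff_weight s ({} :: 'a set))"
    unfolding hausdorff_content_def by (intro INF_lower) auto
  then show ?thesis by simp
qed

lemma hausdorff_content_mono: "A \<subseteq> B \<Longrightarrow> hausdorff_content s \<epsilon> A \<le> hausdorff_content s \<epsilon> B"
  unfolding hausdorff_content_def by (rule INF_superset_mono) auto

lemma hausdorff_content_antimono: "\<epsilon> \<le> \<epsilon>' \<Longrightarrow> hausdorff_content s \<epsilon>' A \<le> hausdorff_content s \<epsilon> A"
  unfolding hausdorff_content_def by (rule INF_superset_mono) (auto intro: order_trans)

lemma hausdorff_content_subadditive:
  fixes A :: "nat \<Rightarrow> 'a::metric_space set"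
  shows "hausdorff_content s \<epsilon> (\<Union>n. A n) \<le> (\<Sum>n. hausdorff_content s \<epsilon> (A n))"
proof (rule ennreal_le_epsilon)
  fix e :: real
  assume fin: "(\<Sum>n. hausdorff_content s \<epsilon> (A n)) < top" and e: "0 < e"
  have "\<exists>C. A n \<subseteq> (\<Union>i. C i) \<and> (\<forall>i::nat. bounded (C i) \<and> diameter (C i) \<le> \<epsilon>) \<and>
      (\<Sum>i. hausdorff_weight s (C i)) \<le> hausdorff_content s \<epsilon> (A n) + ennreal (e * (1/2)^Suc n)" for n
  proof -
    have "hausdorff_content s \<epsilon> (A n) \<noteq> top"
      using ennreal_suminf_lessD[OF fin, of n] by auto
    then have "hausdorff_content s \<epsilon> (A n) < hausdorff_content s \<epsilon> (A n) + ennreal (e * (1/2)^Suc n)"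
      using e by (cases "hausdorff_content s \<epsilon> (A n)" rule: ennreal_cases)
        (auto simp: ennreal_less_iff simp flip: ennreal_plus)
    then show ?thesis
      unfolding hausdorff_content_def[of s \<epsilon> "A n"] INF_less_iff by (auto intro: less_imp_le)
  qed
  then obtain C where C: "\<And>n. A n \<subseteq> (\<Union>i::nat. C n i)"
      "\<And>n i. bounded (C n i)" "\<And>n i. diameter (C n i) \<le> \<epsilon>"
      "\<And>n. (\<Sum>i. hausdorff_weight s (C n i)) \<le> hausdorff_content s \<epsilon> (A n) + ennreal (e * (1/2)^Suc n)"
    by metis
  define D where "D = (\<lambda>k. case prod_decode k of (n, i) \<Rightarrow> C n i)"
  have "x \<in> (\<Union>k. D k)" if x: "x \<in> A n" for x n
  proof -
    obtain i where "x \<in> C n i" using C(1)[of n] x by blast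
    then have "x \<in> D (prod_encode (n, i))" by (simp add: D_def)
    then show ?thesis by blast
  qed
  then have "(\<Union>n. A n) \<subseteq> (\<Union>k. D k)" by blast
  then have "hausdorff_content s \<epsilon> (\<Union>n. A n) \<le> (\<Sum>k. hausdorff_weight s (D k))"
    unfolding hausdorff_content_def using C by (intro INF_lower) (auto simp: D_def split: prod.splits)
  also have "\<dots> = (\<Sum>n. \<Sum>i. hausdorff_weight s (C n i))"
    using suminf_ennreal_2dimen[of "\<lambda>n. \<Sum>i. hausdorff_weight s (C n i)"
        "\<lambda>(n, i). hausdorff_weight s (C n i)"]
    by (simp add: D_def case_prod_beta)
  also have "\<dots> \<le> (\<Sum>n. hausdorff_content s \<epsilon> (A n) + ennreal (e * (1/2)^Suc n))"
    by (intro suminf_le C(4)) auto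
  also have "\<dots> = (\<Sum>n. hausdorff_content s \<epsilon> (A n)) + (\<Sum>n. ennreal (e * (1/2)^Suc n))"
    by (rule suminf_add[symmetric]) auto
  also have "(\<Sum>n. ennreal (e * (1/2)^Suc n)) = ennreal e"
  proof -
    have "(\<lambda>n. e * (1/2)^Suc n) sums (e * 1)"
      by (intro sums_mult power_half_series)
    then show ?thesis
      using e by (subst suminf_ennreal_eq[of _ "e * 1"]) auto
  qed
  finally show "hausdorff_content s \<epsilon> (\<Union>n. A n) \<le> (\<Sum>n. hausdorff_content s \<epsilon> (A n)) + ennreal e" .
qed

lemma hausdorff_content_separated:
  assumes sep: "\<And>x y. x \<in> A \<Longrightarrow> y \<in> B \<Longrightarrow> \<epsilon> < dist x y" and "0 \<le> \<epsilon>"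
  shows "hausdorff_content s \<epsilon> A + hausdorff_content s \<epsilon> B \<le> hausdorff_content s \<epsilon> (A \<union> B)"
  unfolding hausdorff_content_def[of s \<epsilon> "A \<union> B"]
proof (rule INF_greatest, clarify)
  fix C :: "nat \<Rightarrow> 'a set"
  assume cov: "A \<union> B \<subseteq> (\<Union>i. C i)" and C: "\<forall>i. bounded (C i) \<and> diameter (C i) \<le> \<epsilon>"
  define CA where "CA i = (if C i \<inter> A = {} then {} else C i)" for i
  define CB where "CB i = (if C i \<inter> B = {} then {} else C i)" for i
  have "hausdorff_content s \<epsilon> A \<le> (\<Sum>i. hausdorff_weight s (CA i))"
    unfolding hausdorff_content_def using cov C \<open>0 \<le> \<epsilon>\<close>
    by (intro INF_lower) (fastforce simp: CA_def)
  moreover have "hausdorff_content s \<epsilon> B \<le> (\<Sum>i. hausdorff_weight s (CB i))"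
    unfolding hausdorff_content_def using cov C \<open>0 \<le> \<epsilon>\<close>
    by (intro INF_lower) (fastforce simp: CB_def)
  moreover have "(\<Sum>i. hausdorff_weight s (CA i)) + (\<Sum>i. hausdorff_weight s (CB i))
      = (\<Sum>i. hausdorff_weight s (CA i) + hausdorff_weight s (CB i))"
    by (rule suminf_add) auto
  moreover have "\<dots> \<le> (\<Sum>i. hausdorff_weight s (C i))"
  proof (intro suminf_le)
    fix i
    have False if "x \<in> C i" "x \<in> A" "y \<in> C i" "y \<in> B" for x y
    proof -
      have "dist x y \<le> diameter (C i)"
        using C that by (intro diameter_bounded_bound) auto
      also have "\<dots> \<le> \<epsilon>" using C by auto
      finally show False using sep[OF that(2,4)] by simp
    qed
    then have "CA i = {} \<or> CB i = {}" unfolding CA_def CB_def by (auto split: if_splits)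
    moreover have "hausdorff_weight s (CA i) \<le> hausdorff_weight s (C i)"
      "hausdorff_weight s (CB i) \<le> hausdorff_weight s (C i)" by (auto simp: CA_def CB_def)
    ultimately show "hausdorff_weight s (CA i) + hausdorff_weight s (CB i) \<le> hausdorff_weight s (C i)"
      by auto
  qed auto
  ultimately show "hausdorff_content s \<epsilon> A + hausdorff_content s \<epsilon> B \<le> (\<Sum>i. hausdorff_weight s (C i))"
    by (metis (no_types, lifting) add_mono order_trans)
qed

lemma hausdorff_content_le_outer: "0 < \<epsilon> \<Longrightarrow> hausdorff_content s \<epsilon> A \<le> hausdorff_outer s A"
  unfolding hausdorff_outer_def by (intro SUP_upper) auto

lemma hausdorff_outer_mono: "A \<subseteq> B \<Longrightarrow> hausdorff_outer s A \<le> hausdorff_outer s B"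
  unfolding hausdorff_outer_def by (intro SUP_mono) (auto intro: hausdorff_content_mono)

lemma hausdorff_outer_empty [simp]: "hausdorff_outer s {} = 0"
  unfolding hausdorff_outer_def by (intro antisym SUP_least) auto

lemma hausdorff_outer_subadditive:
  "hausdorff_outer s (\<Union>n::nat. A n) \<le> (\<Sum>n. hausdorff_outer s (A n))"
  unfolding hausdorff_outer_def[of s "\<Union>n. A n"]
proof (rule SUP_least)
  fix \<epsilon> :: real assume "\<epsilon> \<in> {0<..}"
  then have "(\<Sum>n. hausdorff_content s \<epsilon> (A n)) \<le> (\<Sum>n. hausdorff_outer s (A n))"
    by (intro suminf_le hausdorff_content_le_outer) auto
  with hausdorff_content_subadditive
  show "hausdorff_content s \<epsilon> (\<Union>n. A n) \<le> (\<Sum>n. hausdorff_outer s (A n))"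
    by (rule order_trans)
qed

lemma hausdorff_outer_space: "outer_measure_space (Pow UNIV) (hausdorff_outer s)"
  by (auto simp: outer_measure_space_def positive_def increasing_def countably_subadditive_def
      intro: hausdorff_outer_mono hausdorff_outer_subadditive)

lemma hausdorff_outer_Un:
  fixes A B :: "'a::metric_space set"
  shows "hausdorff_outer s (A \<union> B) \<le> hausdorff_outer s A + hausdorff_outer s B"
proof -
  interpret sigma_algebra "UNIV :: 'a set" "Pow UNIV" by (rule sigma_algebra_Pow)
  have "subadditive (Pow UNIV) (hausdorff_outer s :: 'a set \<Rightarrow> ennreal)"
    using hausdorff_outer_space[where 'a='a] unfolding outer_measure_space_def
    by (intro countably_subadditive_subadditive) auto
  moreover have "A \<union> B = A \<union> (B - A)" "A \<inter> (B - A) = {}" by auto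
  ultimately have "hausdorff_outer s (A \<union> B) \<le> hausdorff_outer s A + hausdorff_outer s (B - A)"
    by (metis Pow_UNIV UNIV_I subadditiveD)
  also have "\<dots> \<le> hausdorff_outer s A + hausdorff_outer s B"
    by (intro add_left_mono hausdorff_outer_mono) auto
  finally show ?thesis .
qed

lemma hausdorff_outer_separated:
  assumes sep: "\<And>x y. x \<in> A \<Longrightarrow> y \<in> B \<Longrightarrow> r \<le> dist x y" and "0 < r"
  shows "hausdorff_outer s A + hausdorff_outer s B \<le> hausdorff_outer s (A \<union> B)"
proof -
  have "hausdorff_outer s A + hausdorff_outer s B
      = (SUP \<epsilon>\<in>{0<..}. hausdorff_content s \<epsilon> A + hausdorff_content s \<epsilon> B)"
    unfolding hausdorff_outer_def
  proof (rule SUP_add_directed_ennreal[symmetric])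
    fix i j :: real assume "i \<in> {0<..}" "j \<in> {0<..}"
    then show "\<exists>k\<in>{0<..}. hausdorff_content s i A + hausdorff_content s j B
        \<le> hausdorff_content s k A + hausdorff_content s k B"
      by (intro bexI[of _ "min i j"] add_mono hausdorff_content_antimono) auto
  qed
  also have "\<dots> \<le> hausdorff_outer s (A \<union> B)"
  proof (rule SUP_least)
    fix \<epsilon> :: real assume e: "\<epsilon> \<in> {0<..}"
    define \<eta> where "\<eta> = min \<epsilon> (r / 2)"
    have \<eta>: "0 < \<eta>" "\<eta> \<le> \<epsilon>" "\<eta> < r" using e \<open>0 < r\<close> by (auto simp: \<eta>_def)
    have "hausdorff_content s \<epsilon> A + hausdorff_content s \<epsilon> B
        \<le> hausdorff_content s \<eta> A + hausdorff_content s \<eta> B"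
      using \<eta> by (intro add_mono hausdorff_content_antimono)
    also have "\<dots> \<le> hausdorff_content s \<eta> (A \<union> B)"
      using \<eta> by (intro hausdorff_content_separated) (auto dest: sep)
    also have "\<dots> \<le> hausdorff_outer s (A \<union> B)"
      using \<eta> by (intro hausdorff_content_le_outer)
    finally show "hausdorff_content s \<epsilon> A + hausdorff_content s \<epsilon> B \<le> hausdorff_outer s (A \<union> B)" .
  qed
  finally show ?thesis .
qed

lemma hausdorff_outer_closed:
  fixes F X :: "'a::metric_space set"
  assumes F: "closed F"
  shows "hausdorff_outer s (X \<inter> F) + hausdorff_outer s (X - F) \<le> hausdorff_outer s X"
proof (cases "hausdorff_outer s X = top \<or> F = {}")
  case True
  then show ?thesis by auto
next
  case False
  then have fin: "hausdorff_outer s X < top" and ne: "F \<noteq> {}" by (auto simp: less_top)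
  let ?\<mu> = "hausdorff_outer s"
  define r where "r n = inverse (real (Suc n))" for n
  have r_pos: "0 < r n" for n by (simp add: r_def)
  have r_dec: "r (Suc n) < r n" for n by (simp add: r_def)
  have r_anti: "m \<le> n \<Longrightarrow> r n \<le> r m" for m n by (simp add: r_def)
  define A where "A n = {x \<in> X. r n \<le> infdist x F}" for n
  define R where "R n = {x \<in> X. r (Suc n) \<le> infdist x F \<and> infdist x F < r n}" for n
  have XF: "0 < infdist x F" if "x \<in> X - F" for x
    using that in_closed_iff_infdist_zero[OF F ne, of x] infdist_nonneg[of x F] by force
  have tail: "X - F \<subseteq> A n \<union> (\<Union>k. R (k + n))" for n
  proof
    fix x assume x: "x \<in> X - F"
    show "x \<in> A n \<union> (\<Union>k. R (k + n))"
    proof (cases "r n \<le> infdist x F")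
      case True then show ?thesis using x by (auto simp: A_def)
    next
      case False
      obtain m where "r m < infdist x F"
        using reals_Archimedean[OF XF[OF x]] by (auto simp: r_def)
      define p where "p = (LEAST p. r p \<le> infdist x F)"
      have p: "r p \<le> infdist x F"
        unfolding p_def by (rule LeastI[of _ m]) (use \<open>r m < infdist x F\<close> in simp)
      have np: "n < p" using False p r_anti[of p n] by (meson leI order_trans)
      have "\<not> r (p - 1) \<le> infdist x F"
        unfolding p_def by (rule not_less_Least) (use np p_def in auto)
      then have "x \<in> R (p - 1 - n + n)" using p np x by (auto simp: R_def)
      then show ?thesis by blast
    qed
  qed
  have sepR: "r (Suc m) - r (Suc (Suc m)) \<le> dist x y"
    if "x \<in> A (Suc m)" "infdist y F < r (Suc (Suc m))" for m x y
    using that infdist_triangle[of x F y] by (auto simp: A_def)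
  have chain: "(\<Sum>k<n. ?\<mu> (R (2 * k + b))) \<le> ?\<mu> (\<Union>k<n. R (2 * k + b))" for n b
  proof (induction n)
    case 0 show ?case by simp
  next
    case (Suc n)
    show ?case
    proof (cases n)
      case 0 then show ?thesis by (simp add: lessThan_Suc)
    next
      case (Suc l)
      have "?\<mu> (\<Union>k<n. R (2 * k + b)) + ?\<mu> (R (2 * n + b))
          \<le> ?\<mu> ((\<Union>k<n. R (2 * k + b)) \<union> R (2 * n + b))"
      proof (rule hausdorff_outer_separated)
        show "0 < r (Suc (2 * l + b)) - r (Suc (Suc (2 * l + b)))" using r_dec by simp
        fix x y assume x: "x \<in> (\<Union>k<n. R (2 * k + b))" and y: "y \<in> R (2 * n + b)"
        from x obtain k where k: "k < n" "x \<in> X" "r (Suc (2 * k + b)) \<le> infdist x F"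
          by (auto simp: R_def)
        moreover have "r (Suc (2 * l + b)) \<le> r (Suc (2 * k + b))"
          using k Suc by (intro r_anti) auto
        ultimately have "x \<in> A (Suc (2 * l + b))" by (auto simp: A_def)
        moreover have "infdist y F < r (Suc (Suc (2 * l + b)))"
          using y Suc by (auto simp: R_def)
        ultimately show "r (Suc (2 * l + b)) - r (Suc (Suc (2 * l + b))) \<le> dist x y"
          by (rule sepR)
      qed
      moreover have "(\<Union>k<Suc n. R (2 * k + b)) = (\<Union>k<n. R (2 * k + b)) \<union> R (2 * n + b)"
        by (auto simp: lessThan_Suc)
      ultimately show ?thesis using Suc.IH
        by (simp add: add_right_mono order_trans[OF add_right_mono])
    qed
  qed
  have half: "(\<Sum>k. ?\<mu> (R (2 * k + b))) \<le> ?\<mu> X" for b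
  proof (rule suminf_le_const[OF summableI])
    fix n
    have "?\<mu> (\<Union>k<n. R (2 * k + b)) \<le> ?\<mu> X"
      by (rule hausdorff_outer_mono) (auto simp: R_def)
    with chain show "(\<Sum>k<n. ?\<mu> (R (2 * k + b))) \<le> ?\<mu> X" by (rule order_trans)
  qed
  have "(\<Sum>k. ?\<mu> (R k)) \<le> ?\<mu> X + ?\<mu> X"
  proof (rule suminf_le_const[OF summableI])
    fix n
    have "(\<Sum>k<n. ?\<mu> (R k)) \<le> (\<Sum>k<2 * n. ?\<mu> (R k))"
      by (intro sum_mono2) auto
    also have "\<dots> = (\<Sum>k<n. ?\<mu> (R (2 * k + 0))) + (\<Sum>k<n. ?\<mu> (R (2 * k + 1)))"
      by (induction n) (auto simp: ac_simps)
    also have "\<dots> \<le> (\<Sum>k. ?\<mu> (R (2 * k + 0))) + (\<Sum>k. ?\<mu> (R (2 * k + 1)))"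
      by (intro add_mono sum_le_suminf) auto
    also have "\<dots> \<le> ?\<mu> X + ?\<mu> X"
      by (intro add_mono half)
    finally show "(\<Sum>k<n. ?\<mu> (R k)) \<le> ?\<mu> X + ?\<mu> X" .
  qed
  then have finR: "(\<Sum>k. ?\<mu> (R k)) \<noteq> top"
    using fin by (auto simp: top_unique)
  show ?thesis
  proof (rule ennreal_le_epsilon)
    fix e :: real assume e: "0 < e"
    define g where "g k = enn2real (?\<mu> (R k))" for k
    have "?\<mu> (R k) \<noteq> top" for k
      using ennreal_suminf_lessD[of "\<lambda>k. ?\<mu> (R k)" top k] finR by (auto simp: less_top)
    then have g: "?\<mu> (R k) = ennreal (g k)" for k
      by (simp add: g_def less_top)
    have g_nonneg: "0 \<le> g k" for k by (simp add: g_def)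
    have summable_g: "summable g"
      using finR by (intro summable_suminf_not_top) (auto simp: g g_nonneg)
    obtain N where N: "norm (\<Sum>k. g (k + N)) < e"
      using suminf_exist_split[OF e summable_g] by blast
    have "?\<mu> (\<Union>k. R (k + N)) \<le> (\<Sum>k. ?\<mu> (R (k + N)))"
      by (rule hausdorff_outer_subadditive)
    also have "\<dots> = ennreal (\<Sum>k. g (k + N))"
      unfolding g using summable_g by (intro suminf_ennreal2) (auto simp: g_nonneg summable_iff_shift)
    also have "\<dots> \<le> ennreal e"
      using N by (intro ennreal_leI) auto
    finally have R: "?\<mu> (\<Union>k. R (k + N)) \<le> ennreal e" .
    have "?\<mu> (X - F) \<le> ?\<mu> (A N \<union> (\<Union>k. R (k + N)))"
      by (rule hausdorff_outer_mono[OF tail])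
    also have "\<dots> \<le> ?\<mu> (A N) + ?\<mu> (\<Union>k. R (k + N))"
      by (rule hausdorff_outer_Un)
    also have "\<dots> \<le> ?\<mu> (A N) + ennreal e"
      using R by (rule add_left_mono)
    finally have "?\<mu> (X \<inter> F) + ?\<mu> (X - F) \<le> (?\<mu> (X \<inter> F) + ?\<mu> (A N)) + ennreal e"
      by (simp add: add.assoc add_left_mono)
    also have "?\<mu> (X \<inter> F) + ?\<mu> (A N) \<le> ?\<mu> ((X \<inter> F) \<union> A N)"
    proof (rule hausdorff_outer_separated[OF _ r_pos])
      fix x y assume "x \<in> X \<inter> F" "y \<in> A N"
      then show "r N \<le> dist x y"
        using infdist_le[of x F y] by (auto simp: A_def dist_commute)
    qed
    also have "?\<mu> ((X \<inter> F) \<union> A N) \<le> ?\<mu> X"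
      by (rule hausdorff_outer_mono) (auto simp: A_def)
    finally show "?\<mu> (X \<inter> F) + ?\<mu> (X - F) \<le> ?\<mu> X + ennreal e"
      by (simp add: add_right_mono)
  qed
qed

lemma measure_space_hausdorff_outer:
  "measure_space UNIV (sets borel) (hausdorff_outer s :: 'a::metric_space set \<Rightarrow> ennreal)"
proof -
  let ?f = "hausdorff_outer s :: 'a set \<Rightarrow> ennreal"
  interpret sigma_algebra "UNIV :: 'a set" "Pow UNIV" by (rule sigma_algebra_Pow)
  let ?L = "lambda_system UNIV (Pow UNIV) ?f"
  have L: "measure_space UNIV ?L ?f"
    by (rule caratheodory_lemma[OF hausdorff_outer_space])
  have "F \<in> ?L" if "closed F" for F :: "'a set"
  proof -
    have "?f (X \<inter> F) + ?f (X - F) = ?f X" for X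
    proof (rule antisym[OF hausdorff_outer_closed[OF that]])
      show "?f X \<le> ?f (X \<inter> F) + ?f (X - F)"
        using hausdorff_outer_Un[of s "X \<inter> F" "X - F"] by (simp add: Un_Diff_Int Un_commute)
    qed
    then show ?thesis unfolding lambda_system_eq by simp
  qed
  then have "sets (borel :: 'a measure) \<subseteq> ?L"
    using L unfolding borel_eq_closed measure_space_def
    by (auto dest: sigma_algebra.sigma_sets_subset[where a = "Collect closed"])
  then show ?thesis
    using L sets.sigma_algebra_axioms[of "borel :: 'a measure"]
    by (auto simp: measure_space_def positive_def countably_additive_def)
qed

lemma sets_hausdorff_measure [simp, measurable_cong]: "sets (hausdorff_measure s) = sets borel"
  unfolding hausdorff_measure_def using sets.sigma_sets_eq[of borel] by (simp add: sets_measure_of_conv)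

lemma space_hausdorff_measure [simp]: "space (hausdorff_measure s) = UNIV"
  by (simp add: hausdorff_measure_def space_measure_of_conv)

lemma emeasure_hausdorff_measure:
  "A \<in> sets borel \<Longrightarrow> emeasure (hausdorff_measure s) A = hausdorff_outer s A"
  unfolding hausdorff_measure_def
  using measure_space_hausdorff_outer[of s]
  by (intro emeasure_measure_of_sigma) (auto simp: measure_space_def)

definition orthonormal_basis_of :: "'a::euclidean_space set \<Rightarrow> 'a set" where
  "orthonormal_basis_of V =
     (SOME B. B \<subseteq> V \<and> pairwise orthogonal B \<and> (\<forall>b\<in>B. norm b = 1) \<and> span B = V)"

text \<open>
  For a unit vector \<open>\<xi>\<close>: the \<open>(DIM('a) - 1)\<close>-dimensional Lebesgue measure on the hyperplane
  \<open>{p. p \<bullet> \<xi> = t}\<close>, as a measure on \<^typ>\<open>'a::euclidean_space\<close>. It is the image of the product Lebesgue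
  measure under an isometric parametrisation, as \<^const>\<open>lborel\<close> itself is defined.
\<close>

definition hyperplane_lborel :: "'a::euclidean_space \<Rightarrow> real \<Rightarrow> 'a measure" where
  "hyperplane_lborel \<xi> t =
     (let B = orthonormal_basis_of {x. x \<bullet> \<xi> = 0}
      in distr (\<Pi>\<^sub>M b\<in>B. lborel) borel (\<lambda>f. t *\<^sub>R \<xi> + (\<Sum>b\<in>B. f b *\<^sub>R b)))"

lemma orthonormal_basis_of:
  assumes "subspace V"
  shows "orthonormal_basis_of V \<subseteq> V" "pairwise orthogonal (orthonormal_basis_of V)"
    "\<And>b. b \<in> orthonormal_basis_of V \<Longrightarrow> norm b = 1" "span (orthonormal_basis_of V) = V"
proof -
  have "\<exists>B. B \<subseteq> V \<and> pairwise orthogonal B \<and> (\<forall>b\<in>B. norm b = 1) \<and> span B = V"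
    using orthonormal_basis_subspace[OF assms] by metis
  from someI_ex[OF this]
  show "orthonormal_basis_of V \<subseteq> V" "pairwise orthogonal (orthonormal_basis_of V)"
    "\<And>b. b \<in> orthonormal_basis_of V \<Longrightarrow> norm b = 1" "span (orthonormal_basis_of V) = V"
    unfolding orthonormal_basis_of_def[symmetric] by auto
qed

definition centroid :: "'a::euclidean_space measure \<Rightarrow> 'a set \<Rightarrow> 'a" where
  "centroid M L = (1 / measure M L) *\<^sub>R (LINT x:L|M. x)"

definition convex_body :: "'a::euclidean_space set \<Rightarrow> bool" where
  "convex_body K \<longleftrightarrow> compact K \<and> convex K \<and> interior K \<noteq> {}"

text \<open>
  Near each of its points the boundary is the graph, over a part of the hyperplane orthogonal to a
  unit vector \<open>e\<close>, of a function \<open>g\<close> with continuous gradient. Here \<open>g\<close> lives on an open set \<open>W\<close> of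
  the whole space; this loses nothing, since a function on an open part of the hyperplane can be
  extended to be constant along \<open>e\<close>.
\<close>

definition C1_boundary :: "'a::euclidean_space set \<Rightarrow> bool" where
  "C1_boundary K \<longleftrightarrow>
     (\<forall>p \<in> frontier K. \<exists>e U W g g'.
        norm e = 1 \<and> open U \<and> p \<in> U \<and> open W \<and>
        (\<forall>y\<in>W. (g has_derivative (\<lambda>h. g' y \<bullet> h)) (at y)) \<and> continuous_on W g' \<and>
        frontier K \<inter> U = {y + g y *\<^sub>R e | y. y \<in> W \<and> y \<bullet> e = 0} \<inter> U)"

text \<open>
  For a convex body \<open>K\<close>, a unit vector \<open>\<xi>\<close> and \<open>0 < \<delta> < vol K\<close> the level exists and is unique.
\<close>

definition cut_level :: "'a::euclidean_space set \<Rightarrow> real \<Rightarrow> 'a \<Rightarrow> real" where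
  "cut_level K \<delta> \<xi> = (THE t. measure lborel (K \<inter> {p. p \<bullet> \<xi> \<le> t}) = \<delta>)"

definition cutting_hyperplane :: "'a::euclidean_space set \<Rightarrow> real \<Rightarrow> 'a \<Rightarrow> 'a set" where
  "cutting_hyperplane K \<delta> \<xi> = {p. p \<bullet> \<xi> = cut_level K \<delta> \<xi>}"

definition cutting_halfspace :: "'a::euclidean_space set \<Rightarrow> real \<Rightarrow> 'a \<Rightarrow> 'a set" where
  "cutting_halfspace K \<delta> \<xi> = {p. p \<bullet> \<xi> \<le> cut_level K \<delta> \<xi>}"

definition section_center :: "'a::euclidean_space set \<Rightarrow> real \<Rightarrow> 'a \<Rightarrow> 'a" where
  "section_center K \<delta> \<xi> =
     centroid (hyperplane_lborel \<xi> (cut_level K \<delta> \<xi>)) (K \<inter> cutting_hyperplane K \<delta> \<xi>)"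

definition submerged_center :: "'a::euclidean_space set \<Rightarrow> real \<Rightarrow> 'a \<Rightarrow> 'a" where
  "submerged_center K \<delta> \<xi> = centroid lborel (K \<inter> cutting_halfspace K \<delta> \<xi>)"

definition surface_of_centers :: "'a::euclidean_space set \<Rightarrow> real \<Rightarrow> 'a set" where
  "surface_of_centers K \<delta> = submerged_center K \<delta> ` sphere 0 1"

text \<open>
  If the two centers coincided the affine hull would be a point, which is not parallel to the line
  \<^term>\<open>span {\<xi>}\<close>; so floating includes that there is a line through them.
\<close>

definition floats_in_equilibrium :: "'a::euclidean_space set \<Rightarrow> real \<Rightarrow> 'a \<Rightarrow> bool" where
  "floats_in_equilibrium K \<delta> \<xi> \<longleftrightarrow>
     affine_parallel (affine hull {centroid lborel K, submerged_center K \<delta> \<xi>}) (span {\<xi>})"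

text \<open>
  The constant \<open>c\<close> may depend on \<open>\<xi>\<close>. The center lies in the interior of \<open>K\<close>, so each line \<open>l\<close> does
  meet the boundary in exactly two points.
\<close>

definition equichordal_section :: "nat \<Rightarrow> 'a::euclidean_space set \<Rightarrow> real \<Rightarrow> 'a \<Rightarrow> bool" where
  "equichordal_section k K \<delta> \<xi> \<longleftrightarrow>
     (let m = section_center K \<delta> \<xi> in
      \<exists>c. \<forall>l z\<^sub>1 z\<^sub>2.
        affine l \<and> aff_dim l = 1 \<and> l \<subseteq> cutting_hyperplane K \<delta> \<xi> \<and> m \<in> l \<and>
        z\<^sub>1 \<noteq> z\<^sub>2 \<and> l \<inter> frontier K = {z\<^sub>1, z\<^sub>2} \<longrightarrow>
        dist m z\<^sub>1 ^ k + dist m z\<^sub>2 ^ k = c)"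

end

theory Submission
  imports Defs
begin

text \<open>
  Write \<open>F(\<xi>)\<close> for the center of mass of the submerged part. Moving \<open>\<xi>\<close> by \<open>h\<close> changes \<open>\<delta> F(\<xi>)\<close> to
  first order by \<open>- \<integral> (z \<bullet> h) z dz\<close>, where \<open>z\<close> runs over the cutting section relative to its center of
  mass. In polar coordinates this integral weights the even form \<open>(\<theta> \<bullet> h) \<theta>\<close> by \<open>\<rho>(\<theta>)\<^sup>d\<^sup>+\<^sup>1\<close>, where \<open>\<rho>\<close> is
  the radial function of the section, so by the equichordal condition the weight may be replaced by a
  constant, and the derivative of \<open>F\<close> along the sphere is a negative scalar \<open>L(\<xi>)\<close> times the identity.
  For \<open>d \<ge> 3\<close> this forces \<open>L\<close> to be constant, because \<open>F \<bullet> w\<close> has derivative \<open>0\<close> along circles of latitude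
  with axis \<open>w\<close>. Hence \<open>F(\<xi>) = c + L \<xi>\<close>, the surface of centers is a sphere with center \<open>c\<close>, and \<open>c\<close> is the
  center of mass of \<open>K\<close> by assumption.
\<close>

text \<open>The exponent d+1 belongs to a quadratic moment of a (d-1)-dimensional section: polar
  density r^(d-2) times r^2 has primitive r^(d+1)/(d+1). A change of the level enters the
  first-order term only through the first moment of the section about its center of mass, which is
  0; so a Lipschitz bound on the level suffices and its derivative is never computed. The analytic
  obstacle is that the part of the body between two nearby hyperplanes is not a cylinder over the
  section. It is compared with one, and the discrepancy concentrates near the boundary of the
  section, which is a null set. The measure on the section rests on an arbitrarily chosen
  orthonormal basis; its behavior under reflections and dilations comes from uniqueness of
  translation-invariant measures. On the Hausdorff side symmetry alone locates the centroid of a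
  sphere, but \<open>centroid\<close> divides by the measure, so the measure must first be shown
  positive and finite. Strict negativity of L(\<xi>) keeps that sphere nondegenerate and the two
  centers of mass distinct.\<close>

subsection \<open>Lebesgue measure on a subspace\<close>

text \<open>Haar uniqueness: integrate \<open>indicator E y * indicator A (y + x)\<close> in both
  orders, once shifting in \<open>M\<close> and once in \<open>N\<close>; the last shift, applied to
  y - x, produces the reflected set. Being carried by \<open>V\<close> is what permits the shifts.
  The cross-multiplied form needs no finiteness of the four values, and \<open>E\<close> is kept
  free as the set on which the constant is calibrated.\<close>

lemma translation_invariant_measures_proportional:
  fixes M N :: "'a::euclidean_space measure"
  assumes V: "subspace V" and E[measurable]: "E \<in> sets borel" and A[measurable]: "A \<in> sets borel"
    and M: "sigma_finite_measure M" "sets M = sets borel" "AE x in M. x \<in> V"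
      "\<And>v. v \<in> V \<Longrightarrow> distr M borel ((+) v) = M"
    and N: "sigma_finite_measure N" "sets N = sets borel" "AE x in N. x \<in> V"
      "\<And>v. v \<in> V \<Longrightarrow> distr N borel ((+) v) = N"
  shows "emeasure N E * emeasure M A = emeasure N A * emeasure M {x. - x \<in> E}"
proof -
  interpret M: sigma_finite_measure M by fact
  interpret N: sigma_finite_measure N by fact
  interpret pair_sigma_finite M N by standard
  note [measurable_cong] = M(2) N(2)
  have spM[simp]: "space M = UNIV" and spN[simp]: "space N = UNIV"
    using M(2) N(2) by (simp_all add: sets_eq_imp_space_eq[of _ borel])
  have shiftM: "(\<integral>\<^sup>+x. f (v + x) \<partial>M) = (\<integral>\<^sup>+x. f x \<partial>M)"
    if "v \<in> V" and [measurable]: "f \<in> borel_measurable borel" for v and f :: "'a \<Rightarrow> ennreal"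
    by (subst (2) M(4)[OF that(1), symmetric]) (simp add: nn_integral_distr)
  have shiftN: "(\<integral>\<^sup>+x. f (v + x) \<partial>N) = (\<integral>\<^sup>+x. f x \<partial>N)"
    if "v \<in> V" and [measurable]: "f \<in> borel_measurable borel" for v and f :: "'a \<Rightarrow> ennreal"
    by (subst (2) N(4)[OF that(1), symmetric]) (simp add: nn_integral_distr)
  have "emeasure N E * emeasure M A = (\<integral>\<^sup>+y. indicator E y * emeasure M A \<partial>N)"
    by (subst nn_integral_multc) auto
  also have "\<dots> = (\<integral>\<^sup>+y. indicator E y * (\<integral>\<^sup>+x. indicator A (y + x) \<partial>M) \<partial>N)"
    using N(3) by (intro nn_integral_cong_AE) (auto simp: shiftM elim!: eventually_mono)
  also have "\<dots> = (\<integral>\<^sup>+y. (\<integral>\<^sup>+x. indicator E y * indicator A (y + x) \<partial>M) \<partial>N)"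
    by (intro nn_integral_cong nn_integral_cmult[symmetric]) measurable
  also have "\<dots> = (\<integral>\<^sup>+x. (\<integral>\<^sup>+y. indicator E y * indicator A (y + x) \<partial>N) \<partial>M)"
    by (rule Fubini') measurable
  also have "\<dots> = (\<integral>\<^sup>+x. (\<integral>\<^sup>+y. indicator E (y - x) * indicator A y \<partial>N) \<partial>M)"
  proof (intro nn_integral_cong_AE)
    have "(\<integral>\<^sup>+y. indicator E y * indicator A (y + x) \<partial>N) = (\<integral>\<^sup>+y. indicator E (y - x) * indicator A y \<partial>N)"
      if "x \<in> V" for x
      using shiftN[OF that, of "\<lambda>y. indicator E (y - x) * indicator A y"] by (simp add: add.commute)
    then show "AE x in M. (\<integral>\<^sup>+y. indicator E y * indicator A (y + x) \<partial>N)
        = (\<integral>\<^sup>+y. indicator E (y - x) * indicator A y \<partial>N)"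
      using M(3) by (auto elim!: eventually_mono)
  qed
  also have "\<dots> = (\<integral>\<^sup>+y. (\<integral>\<^sup>+x. indicator E (y - x) * indicator A y \<partial>M) \<partial>N)"
    by (rule Fubini'[symmetric]) measurable
  also have "\<dots> = (\<integral>\<^sup>+y. indicator A y * emeasure M {x. - x \<in> E} \<partial>N)"
  proof (intro nn_integral_cong_AE)
    have "(\<integral>\<^sup>+x. indicator E (y - x) * indicator A y \<partial>M) = indicator A y * emeasure M {x. - x \<in> E}"
      if "y \<in> V" for y
    proof -
      have "(\<integral>\<^sup>+x. indicator E (y - x) * indicator A y \<partial>M) = (\<integral>\<^sup>+x. indicator E (y - x) \<partial>M) * indicator A y"
        by (rule nn_integral_multc) measurable
      also have "(\<integral>\<^sup>+x. indicator E (y - x) \<partial>M) = (\<integral>\<^sup>+x. indicator E (- x) \<partial>M)"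
        using shiftM[OF that, of "\<lambda>x. indicator E (y - x)"] by simp
      also have "\<dots> = (\<integral>\<^sup>+x. indicator {x. - x \<in> E} x \<partial>M)"
        by (intro nn_integral_cong) (auto simp: indicator_def)
      also have "\<dots> = emeasure M {x. - x \<in> E}"
        by (rule nn_integral_indicator) measurable
      finally show ?thesis by (simp add: mult.commute)
    qed
    then show "AE y in N. (\<integral>\<^sup>+x. indicator E (y - x) * indicator A y \<partial>M)
        = indicator A y * emeasure M {x. - x \<in> E}"
      using N(3) by (auto elim!: eventually_mono)
  qed
  also have "\<dots> = emeasure N A * emeasure M {x. - x \<in> E}"
    by (subst nn_integral_multc) auto
  finally show ?thesis .
qed

text \<open>Stated for any \<open>B\<close>, so that \<open>lborel\<close> (an orthonormal basis of
  the whole space) and, up to a translation along the normal, \<open>hyperplane_lborel\<close> are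
  both instances.\<close>

definition span_lborel :: "'a::euclidean_space set \<Rightarrow> 'a measure" where
  "span_lborel B = distr (\<Pi>\<^sub>M b\<in>B. lborel) borel (\<lambda>f. \<Sum>b\<in>B. f b *\<^sub>R b)"

lemma sets_span_lborel [simp, measurable_cong]: "sets (span_lborel B) = sets borel"
  and space_span_lborel [simp]: "space (span_lborel B) = UNIV"
  by (simp_all add: span_lborel_def)

locale orthonormal_set =
  fixes B :: "'a::euclidean_space set"
  assumes orth: "pairwise orthogonal B" and norm_one: "\<And>b. b \<in> B \<Longrightarrow> norm b = 1"
begin

lemma finite_B [simp]: "finite B"
proof -
  have "0 \<notin> B" using norm_one by force
  then show ?thesis using pairwise_orthogonal_imp_finite[OF orth] by simp
qed

abbreviation comb :: "('a \<Rightarrow> real) \<Rightarrow> 'a" where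
  "comb f \<equiv> \<Sum>b\<in>B. f b *\<^sub>R b"

lemma measurable_comb [measurable]: "comb \<in> borel_measurable (\<Pi>\<^sub>M b\<in>B. lborel)"
  by measurable

lemma inner_B: "b \<in> B \<Longrightarrow> c \<in> B \<Longrightarrow> b \<bullet> c = (if b = c then 1 else 0)"
  using orth norm_one[of b] by (auto simp: pairwise_def orthogonal_def norm_eq_1)

lemma inner_comb: "b \<in> B \<Longrightarrow> comb f \<bullet> b = f b"
  by (simp add: inner_sum_left inner_B sum.delta if_distrib cong: if_cong)

lemma norm_comb: "norm (comb f) = sqrt (\<Sum>b\<in>B. (f b)\<^sup>2)"
proof -
  have "comb f \<bullet> comb f = (\<Sum>b\<in>B. comb f \<bullet> (f b *\<^sub>R b))"
    by (rule inner_sum_right)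
  also have "\<dots> = (\<Sum>b\<in>B. (f b)\<^sup>2)"
    by (intro sum.cong) (auto simp: inner_comb power2_eq_square)
  finally show ?thesis by (simp add: norm_eq_sqrt_inner)
qed

lemma comb_in_span: "comb f \<in> span B"
  by (intro span_sum span_scale span_base)

lemma comb_inner: "x \<in> span B \<Longrightarrow> comb (\<lambda>b. x \<bullet> b) = x"
  using orthonormal_basis_expand[OF orth norm_one] by simp

lemma emeasure_span_lborel_cball:
  assumes "0 < r"
  shows "emeasure (span_lborel B) (cball 0 r) = ennreal (unit_ball_vol (card B) * r ^ card B)"
proof -
  have "comb -` cball 0 r \<inter> space (\<Pi>\<^sub>M b\<in>B. lborel)
      = {f. sqrt (\<Sum>b\<in>B. (f b)\<^sup>2) \<le> r} \<inter> space (\<Pi>\<^sub>M b\<in>B. lborel)"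
    by (auto simp: norm_comb)
  then show ?thesis
    unfolding span_lborel_def using emeasure_cball_aux[OF finite_B assms] by (simp add: emeasure_distr)
qed

lemma emeasure_span_lborel_bounded:
  assumes "bounded A" shows "emeasure (span_lborel B) A < top"
proof -
  obtain r where r: "0 < r" "A \<subseteq> cball 0 r"
    using bounded_subset_ballD[OF assms, of 0] ball_subset_cball by blast
  have "emeasure (span_lborel B) A \<le> emeasure (span_lborel B) (cball 0 r)"
    by (rule emeasure_mono[OF r(2)]) simp
  also have "\<dots> < top" using r by (simp add: emeasure_span_lborel_cball)
  finally show ?thesis .
qed

lemma sigma_finite_span_lborel [intro]: "sigma_finite_measure (span_lborel B)"
proof
  show "\<exists>A. countable A \<and> A \<subseteq> sets (span_lborel B) \<and> \<Union>A = space (span_lborel B)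
      \<and> (\<forall>a\<in>A. emeasure (span_lborel B) a \<noteq> \<infinity>)"
  proof (intro exI[of _ "range (\<lambda>n::nat. cball 0 (real n))"] conjI ballI)
    show "\<Union> (range (\<lambda>n::nat. cball (0::'a) (real n))) = space (span_lborel B)"
      by (auto intro: real_arch_simple)
    fix a assume "a \<in> range (\<lambda>n::nat. cball (0::'a) (real n))"
    then show "emeasure (span_lborel B) a \<noteq> \<infinity>"
      using emeasure_span_lborel_bounded by (auto simp: less_top)
  qed auto
qed

lemma span_B_borel [measurable]: "span B \<in> sets borel"
  by (simp add: closed_subspace)

lemma AE_span_lborel_span: "AE x in span_lborel B. x \<in> span B"
  unfolding span_lborel_def by (subst AE_distr_iff) (auto simp: comb_in_span)

lemma span_lborel_translation:
  assumes v: "v \<in> span B"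
  shows "distr (span_lborel B) borel ((+) v) = span_lborel B"
proof -
  interpret P: product_sigma_finite "\<lambda>_::'a. lborel :: real measure" by standard
  \<comment> \<open>The shift must be restricted to \<open>B\<close>, since points of the product
    space are extensional functions.\<close>
  let ?T = "\<lambda>f. \<lambda>b\<in>B. v \<bullet> b + f b"
  have T[measurable]: "?T \<in> (\<Pi>\<^sub>M b\<in>B. lborel) \<rightarrow>\<^sub>M (\<Pi>\<^sub>M b\<in>B. lborel)"
    by measurable
  have "distr (\<Pi>\<^sub>M b\<in>B. lborel) (\<Pi>\<^sub>M b\<in>B. lborel) ?T = (\<Pi>\<^sub>M b\<in>B. (lborel :: real measure))"
  proof (rule P.PiM_eqI)
    fix A :: "'a \<Rightarrow> real set" assume A: "\<And>b. b \<in> B \<Longrightarrow> A b \<in> sets lborel"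
    have A': "(+) (v \<bullet> b) -` A b \<in> sets lborel" if "b \<in> B" for b
    proof -
      have [measurable]: "A b \<in> sets borel" using A[OF that] by simp
      have "(+) (v \<bullet> b) -` A b \<inter> space lborel \<in> sets lborel" by measurable
      then show ?thesis by simp
    qed
    have "?T -` PiE B A \<inter> space (\<Pi>\<^sub>M b\<in>B. lborel) = PiE B (\<lambda>b. (+) (v \<bullet> b) -` A b)"
      by (auto simp: space_PiM PiE_def Pi_def)
    then have "emeasure (distr (\<Pi>\<^sub>M b\<in>B. lborel) (\<Pi>\<^sub>M b\<in>B. lborel) ?T) (PiE B A)
        = emeasure (\<Pi>\<^sub>M b\<in>B. lborel) (PiE B (\<lambda>b. (+) (v \<bullet> b) -` A b))"
      using A by (subst emeasure_distr[OF T]) (auto intro!: sets_PiM_I_finite)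
    also have "\<dots> = (\<Prod>b\<in>B. emeasure lborel ((+) (v \<bullet> b) -` A b))"
      using A' by (subst P.emeasure_PiM) auto
    also have "\<dots> = (\<Prod>b\<in>B. emeasure lborel (A b))"
    proof (intro prod.cong refl)
      fix b assume "b \<in> B"
      then show "emeasure lborel ((+) (v \<bullet> b) -` A b) = emeasure lborel (A b)"
        using A by (subst (2) lborel_distr_plus[of "v \<bullet> b", symmetric]) (simp add: emeasure_distr)
    qed
    finally show "emeasure (distr (\<Pi>\<^sub>M b\<in>B. lborel) (\<Pi>\<^sub>M b\<in>B. lborel) ?T) (PiE B A)
        = (\<Prod>b\<in>B. emeasure lborel (A b))" .
  qed auto
  moreover have "(+) v \<circ> comb = comb \<circ> ?T"
  proof
    fix f :: "'a \<Rightarrow> real"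
    have "comb (?T f) = comb (\<lambda>b. v \<bullet> b) + comb f"
      by (simp add: scaleR_add_left sum.distrib)
    then show "((+) v \<circ> comb) f = (comb \<circ> ?T) f"
      using comb_inner[OF v] by simp
  qed
  moreover have "distr (\<Pi>\<^sub>M b\<in>B. lborel) borel (comb \<circ> ?T)
      = distr (distr (\<Pi>\<^sub>M b\<in>B. lborel) (\<Pi>\<^sub>M b\<in>B. lborel) ?T) borel comb"
    by (rule distr_distr[symmetric, OF measurable_comb T])
  ultimately show ?thesis
    unfolding span_lborel_def by (subst distr_distr) simp_all
qed

text \<open>The unit ball is the calibrating set: it is symmetric under negation, and its preimages
  under linear isometries and dilations are again balls, so \<open>k\<close> can be read off in
  every application.\<close>

lemma span_lborel_unique:
  assumes N: "sets N = sets borel" "AE x in N. x \<in> span B"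
      "\<And>v. v \<in> span B \<Longrightarrow> distr N borel ((+) v) = N"
    and ball: "emeasure N (cball 0 1) = ennreal k * ennreal (unit_ball_vol (card B))" "0 < k"
    and fin: "\<And>r. 0 < r \<Longrightarrow> emeasure N (cball 0 r) < top"
    and A[measurable]: "A \<in> sets borel"
  shows "emeasure N A = ennreal k * emeasure (span_lborel B) A"
proof -
  have "sigma_finite_measure N"
  proof
    show "\<exists>A. countable A \<and> A \<subseteq> sets N \<and> \<Union>A = space N \<and> (\<forall>a\<in>A. emeasure N a \<noteq> \<infinity>)"
    \<comment> \<open>The radii start at 1 because \<open>fin\<close> speaks only of positive
      radii.\<close>
    proof (intro exI[of _ "range (\<lambda>n::nat. cball 0 (real (Suc n)))"] conjI ballI)
      have "\<exists>n. norm x \<le> real (Suc n)" for x :: 'a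
        using real_arch_simple[of "norm x"] by (meson le_SucI of_nat_le_iff order_trans order_refl)
      then show "\<Union> (range (\<lambda>n::nat. cball (0::'a) (real (Suc n)))) = space N"
        using N(1) by (auto simp: sets_eq_imp_space_eq[of N borel])
      fix a assume "a \<in> range (\<lambda>n::nat. cball (0::'a) (real (Suc n)))"
      then show "emeasure N a \<noteq> \<infinity>"
        using fin by (auto simp: less_top)
    qed (auto simp: N)
  qed
  then have "emeasure (span_lborel B) (cball 0 1) * emeasure N A
      = emeasure (span_lborel B) A * emeasure N {x. - x \<in> cball 0 1}"
    using N by (intro translation_invariant_measures_proportional[of "span B"])
      (auto simp: span_lborel_translation AE_span_lborel_span sigma_finite_span_lborel)
  also have "{x::'a. - x \<in> cball 0 1} = cball 0 1" by auto
  finally have "ennreal (unit_ball_vol (card B)) * emeasure N A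
      = ennreal (unit_ball_vol (card B)) * (ennreal k * emeasure (span_lborel B) A)"
    by (simp add: emeasure_span_lborel_cball ball mult_ac)
  then show ?thesis
    using unit_ball_vol_pos[of "real (card B)"] by (simp add: ennreal_mult_cancel_left less_imp_neq[symmetric] del: unit_ball_vol_pos)
qed

text \<open>Moving a translation by \<open>v\<close> through \<open>U\<close> turns it into the
  translation by \<open>U v\<close>, so the image measure is again translation-invariant, and
  \<open>U\<close> fixes balls. Involutions cover both later uses: negation and reflection in a
  hyperplane.\<close>

lemma span_lborel_isometry:
  assumes U: "linear U" "\<And>x. norm (U x) = norm x" "\<And>x. U (U x) = x" "\<And>x. x \<in> span B \<Longrightarrow> U x \<in> span B"
  shows "distr (span_lborel B) borel U = span_lborel B"
proof (rule measure_eqI)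
  have [measurable]: "U \<in> borel_measurable borel"
    using U(1) by (simp add: borel_measurable_continuous_onI linear_continuous_on linear_linear)
  have ball: "U -` cball 0 r = cball 0 r" for r
    using U(2) by auto
  fix A assume "A \<in> sets (distr (span_lborel B) borel U)"
  then have [measurable]: "A \<in> sets borel" by simp
  have "emeasure (distr (span_lborel B) borel U) A = ennreal 1 * emeasure (span_lborel B) A"
  proof (rule span_lborel_unique)
    show "AE x in distr (span_lborel B) borel U. x \<in> span B"
      using AE_span_lborel_span U(4) by (subst AE_distr_iff) (auto elim!: eventually_mono)
    fix v assume v: "v \<in> span B"
    have "distr (distr (span_lborel B) borel U) borel ((+) v) = distr (span_lborel B) borel ((+) v \<circ> U)"
      by (rule distr_distr) measurable
    also have "(+) v \<circ> U = U \<circ> (+) (U v)"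
      using U(1,3) by (auto simp: linear_add)
    also have "distr (span_lborel B) borel (U \<circ> (+) (U v)) = distr (distr (span_lborel B) borel ((+) (U v))) borel U"
      by (rule distr_distr[symmetric]) measurable
    also have "\<dots> = distr (span_lborel B) borel U"
      using U(4)[OF v] by (simp add: span_lborel_translation)
    finally show "distr (distr (span_lborel B) borel U) borel ((+) v) = distr (span_lborel B) borel U" .
  qed (auto simp: emeasure_distr ball emeasure_span_lborel_cball)
  then show "emeasure (distr (span_lborel B) borel U) A = emeasure (span_lborel B) A" by simp
qed simp

text \<open>The image of the measure under the dilation is translation-invariant; the unit ball
  pulls back to radius 1/r, which gives the constant.\<close>

lemma emeasure_span_lborel_scaled:
  assumes r: "0 < r" and [measurable]: "A \<in> sets borel"
  shows "emeasure (span_lborel B) ((\<lambda>x. r *\<^sub>R x) -` A) = ennreal ((1 / r) ^ card B) * emeasure (span_lborel B) A"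
proof -
  let ?N = "distr (span_lborel B) borel (\<lambda>x. r *\<^sub>R x)"
  have ball: "(\<lambda>x. r *\<^sub>R x) -` cball 0 s = cball (0::'a) (s / r)" for s
    using r by (auto simp: field_simps)
  have "emeasure ?N A = ennreal ((1 / r) ^ card B) * emeasure (span_lborel B) A"
  proof (rule span_lborel_unique)
    show "AE x in ?N. x \<in> span B"
      using AE_span_lborel_span by (subst AE_distr_iff) (auto elim!: eventually_mono intro: span_scale)
    fix v assume v: "v \<in> span B"
    have "distr ?N borel ((+) v) = distr (span_lborel B) borel ((+) v \<circ> (\<lambda>x. r *\<^sub>R x))"
      by (rule distr_distr) measurable
    also have "(+) v \<circ> (\<lambda>x. r *\<^sub>R x) = (\<lambda>x. r *\<^sub>R x) \<circ> (+) (v /\<^sub>R r)"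
      using r by (auto simp: scaleR_add_right)
    also have "distr (span_lborel B) borel ((\<lambda>x. r *\<^sub>R x) \<circ> (+) (v /\<^sub>R r))
        = distr (distr (span_lborel B) borel ((+) (v /\<^sub>R r))) borel (\<lambda>x. r *\<^sub>R x)"
      by (rule distr_distr[symmetric]) measurable
    also have "\<dots> = ?N"
      using v by (simp add: span_lborel_translation span_scale)
    finally show "distr ?N borel ((+) v) = ?N" .
  qed (use r in \<open>auto simp: emeasure_distr ball emeasure_span_lborel_cball power_one_over divide_simps mult_ac
        simp flip: ennreal_mult\<close>)
  then show ?thesis by (simp add: emeasure_distr)
qed

lemma nn_integral_span_lborel_scaled:
  assumes r: "0 < r" and [measurable]: "f \<in> borel_measurable borel"
  shows "(\<integral>\<^sup>+x. f (r *\<^sub>R x) \<partial>span_lborel B) = ennreal ((1 / r) ^ card B) * (\<integral>\<^sup>+x. f x \<partial>span_lborel B)"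
proof -
  have "distr (span_lborel B) borel (\<lambda>x. r *\<^sub>R x) = density (span_lborel B) (\<lambda>_. ennreal ((1 / r) ^ card B))"
    by (rule measure_eqI)
      (auto simp: emeasure_distr emeasure_density_const emeasure_span_lborel_scaled[OF r])
  then have "(\<integral>\<^sup>+x. f x \<partial>distr (span_lborel B) borel (\<lambda>x. r *\<^sub>R x))
      = (\<integral>\<^sup>+x. f x \<partial>density (span_lborel B) (\<lambda>_. ennreal ((1 / r) ^ card B)))" by simp
  then show ?thesis
    by (simp add: nn_integral_distr nn_integral_density nn_integral_cmult)
qed

end

section \<open>Fubini along the normal direction of a hyperplane\<close>

lemma lborel_eq_span_lborel:
  fixes B :: "'a::euclidean_space set"
  assumes "orthonormal_set B" "span B = UNIV"
  shows "span_lborel B = lborel"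
proof (rule measure_eqI)
  interpret orthonormal_set B by fact
  have "0 \<notin> B" using norm_one by force
  then have card: "card B = DIM('a)"
    using pairwise_orthogonal_independent[OF orth] assms(2)
    by (metis dim_eq_card_independent dim_UNIV dim_span)
  fix A assume "A \<in> sets (span_lborel B)"
  then have "emeasure lborel A = ennreal 1 * emeasure (span_lborel B) A"
    by (intro span_lborel_unique)
      (auto simp: assms(2) lborel_distr_plus emeasure_cball card)
  then show "emeasure (span_lborel B) A = emeasure lborel A" by simp
qed simp

lemma lborel_eq_distr_hyperplane:
  fixes B :: "'a::euclidean_space set"
  assumes "orthonormal_set (insert \<xi> B)" "span (insert \<xi> B) = UNIV" "\<xi> \<notin> B"
  shows "lborel = distr (span_lborel B \<Otimes>\<^sub>M lborel) borel (\<lambda>(y, s). s *\<^sub>R \<xi> + y)"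
proof (rule measure_eqI)
  interpret I: orthonormal_set "insert \<xi> B" by fact
  interpret orthonormal_set B
    using assms(1) by (auto simp: orthonormal_set_def pairwise_def)
  interpret P: product_sigma_finite "\<lambda>_::'a. lborel :: real measure" by standard
  interpret M: sigma_finite_measure "span_lborel B" by (rule sigma_finite_span_lborel)
  fix A :: "'a set" assume "A \<in> sets lborel"
  then have [measurable]: "A \<in> sets borel" by simp
  have "emeasure lborel A = emeasure (span_lborel (insert \<xi> B)) A"
    using lborel_eq_span_lborel[OF assms(1,2)] by simp
  also have "\<dots> = (\<integral>\<^sup>+x. indicator A x \<partial>span_lborel (insert \<xi> B))" by simp
  also have "\<dots> = (\<integral>\<^sup>+f. indicator A (I.comb f) \<partial>(\<Pi>\<^sub>M b\<in>insert \<xi> B. lborel))"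
    unfolding span_lborel_def by (rule nn_integral_distr) measurable
  also have "\<dots> = (\<integral>\<^sup>+f. (\<integral>\<^sup>+s. indicator A (I.comb (f(\<xi> := s))) \<partial>lborel) \<partial>(\<Pi>\<^sub>M b\<in>B. lborel))"
    using assms(3) by (intro P.product_nn_integral_insert) auto
  also have "\<dots> = (\<integral>\<^sup>+f. (\<integral>\<^sup>+s. indicator A (s *\<^sub>R \<xi> + comb f) \<partial>lborel) \<partial>(\<Pi>\<^sub>M b\<in>B. lborel))"
  proof -
    have "I.comb (f(\<xi> := s)) = s *\<^sub>R \<xi> + comb f" for f s
    proof -
      have "(\<Sum>b\<in>B. (f(\<xi> := s)) b *\<^sub>R b) = comb f"
        using assms(3) by (intro sum.cong) auto
      then show ?thesis using assms(3) by simp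
    qed
    then show ?thesis by simp
  qed
  also have "\<dots> = (\<integral>\<^sup>+y. (\<integral>\<^sup>+s. indicator A (s *\<^sub>R \<xi> + y) \<partial>lborel) \<partial>span_lborel B)"
    unfolding span_lborel_def by (rule nn_integral_distr[symmetric]) measurable
  also have "\<dots> = (\<integral>\<^sup>+p. indicator A (case p of (y, s) \<Rightarrow> s *\<^sub>R \<xi> + y) \<partial>(span_lborel B \<Otimes>\<^sub>M lborel))"
    by (subst lborel.nn_integral_fst[symmetric]) auto
  also have "\<dots> = (\<integral>\<^sup>+x. indicator A x \<partial>distr (span_lborel B \<Otimes>\<^sub>M lborel) borel (\<lambda>(y, s). s *\<^sub>R \<xi> + y))"
    by (rule nn_integral_distr[symmetric]) measurable
  also have "\<dots> = emeasure (distr (span_lborel B \<Otimes>\<^sub>M lborel) borel (\<lambda>(y, s). s *\<^sub>R \<xi> + y)) A" by simp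
  finally show "emeasure lborel A = emeasure (distr (span_lborel B \<Otimes>\<^sub>M lborel) borel (\<lambda>(y, s). s *\<^sub>R \<xi> + y)) A" .
qed simp

subsection \<open>Hyperplane sections of a convex body\<close>

locale hyperplane = orthonormal_set B for B :: "'a::euclidean_space set" +
  fixes \<xi> :: 'a
  assumes norm_xi: "norm \<xi> = 1" and span_B: "span B = {x. x \<bullet> \<xi> = 0}"
begin

abbreviation M :: "'a measure" where "M \<equiv> span_lborel B"

lemma xi_xi [simp]: "\<xi> \<bullet> \<xi> = 1"
  using norm_xi by (simp add: norm_eq_1)

lemma inner_B_xi: "b \<in> B \<Longrightarrow> b \<bullet> \<xi> = 0"
  using span_B span_base by blast

lemma xi_notin_B: "\<xi> \<notin> B"
  using inner_B_xi[of \<xi>] by auto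

lemma orthonormal_insert: "orthonormal_set (insert \<xi> B)"
  using orth norm_one norm_xi inner_B_xi
  by unfold_locales (auto simp: pairwise_insert orthogonal_def inner_commute)

lemma span_insert_xi: "span (insert \<xi> B) = UNIV"
proof -
  have "x - (x \<bullet> \<xi>) *\<^sub>R \<xi> \<in> span B" for x by (simp add: span_B inner_simps)
  then show ?thesis unfolding span_insert by blast
qed

lemma card_B: "Suc (card B) = DIM('a)"
proof -
  interpret I: orthonormal_set "insert \<xi> B" by (rule orthonormal_insert)
  have "0 \<notin> insert \<xi> B" using I.norm_one by force
  then have "card (insert \<xi> B) = DIM('a)"
    using pairwise_orthogonal_independent[OF I.orth] span_insert_xi
    by (metis dim_eq_card_independent dim_UNIV dim_span)
  then show ?thesis using xi_notin_B by simp
qed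

lemma AE_orthogonal_xi: "AE z in M. z \<bullet> \<xi> = 0"
  using AE_span_lborel_span by (simp add: span_B)

sublocale M: sigma_finite_measure M by (rule sigma_finite_span_lborel)
sublocale P: pair_sigma_finite M "lborel :: real measure" by standard

lemma lborel_eq_distr_pair: "lborel = distr (M \<Otimes>\<^sub>M lborel) borel (\<lambda>(z, r). m + (r *\<^sub>R \<xi> + z))"
proof -
  have "lborel = distr (distr (M \<Otimes>\<^sub>M lborel) borel (\<lambda>(z, r). r *\<^sub>R \<xi> + z)) borel ((+) m)"
    using lborel_eq_distr_hyperplane[OF orthonormal_insert span_insert_xi xi_notin_B]
      lborel_distr_plus[of m] by simp
  also have "\<dots> = distr (M \<Otimes>\<^sub>M lborel) borel ((+) m \<circ> (\<lambda>(z, r). r *\<^sub>R \<xi> + z))"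
    by (rule distr_distr) measurable
  finally show ?thesis by (simp only: comp_def case_prod_beta')
qed

lemma nn_integral_lborel_pair:
  assumes [measurable]: "f \<in> borel_measurable borel"
  shows "(\<integral>\<^sup>+x. f x \<partial>lborel) = (\<integral>\<^sup>+z. (\<integral>\<^sup>+r. f (m + (r *\<^sub>R \<xi> + z)) \<partial>lborel) \<partial>M)"
proof -
  have "(\<integral>\<^sup>+x. f x \<partial>lborel) = (\<integral>\<^sup>+p. f (case p of (z, r) \<Rightarrow> m + (r *\<^sub>R \<xi> + z)) \<partial>(M \<Otimes>\<^sub>M lborel))"
    by (subst lborel_eq_distr_pair[of m]) (auto simp: nn_integral_distr)
  also have "\<dots> = (\<integral>\<^sup>+z. (\<integral>\<^sup>+r. f (m + (r *\<^sub>R \<xi> + z)) \<partial>lborel) \<partial>M)"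
    by (subst lborel.nn_integral_fst[symmetric]) auto
  finally show ?thesis .
qed

lemma integral_lborel_pair:
  fixes f :: "'a \<Rightarrow> 'b::{banach, second_countable_topology}"
  assumes f: "integrable lborel f"
  shows "(\<integral>x. f x \<partial>lborel) = (\<integral>z. (\<integral>r. f (m + (r *\<^sub>R \<xi> + z)) \<partial>lborel) \<partial>M)"
proof -
  have [measurable]: "f \<in> borel_measurable borel" using borel_measurable_integrable[OF f] by simp
  have "integrable (M \<Otimes>\<^sub>M lborel) (\<lambda>p. f (case p of (z, r) \<Rightarrow> m + (r *\<^sub>R \<xi> + z)))"
    using f by (subst (asm) lborel_eq_distr_pair[of m]) (subst (asm) integrable_distr_eq, auto)
  then have "(\<integral>p. f (case p of (z, r) \<Rightarrow> m + (r *\<^sub>R \<xi> + z)) \<partial>(M \<Otimes>\<^sub>M lborel))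
      = (\<integral>z. (\<integral>r. f (m + (r *\<^sub>R \<xi> + z)) \<partial>lborel) \<partial>M)"
    using P.integral_fst'[of "\<lambda>p. f (case p of (z, r) \<Rightarrow> m + (r *\<^sub>R \<xi> + z))"] by simp
  moreover have "(\<integral>x. f x \<partial>lborel) = (\<integral>p. f (case p of (z, r) \<Rightarrow> m + (r *\<^sub>R \<xi> + z)) \<partial>(M \<Otimes>\<^sub>M lborel))"
    by (subst lborel_eq_distr_pair[of m]) (auto simp: integral_distr)
  ultimately show ?thesis by simp
qed

lemma integrable_M_bounded:
  fixes f :: "'a \<Rightarrow> 'b::{banach, second_countable_topology}"
  assumes [measurable]: "f \<in> borel_measurable borel" and "\<And>z. r < norm z \<Longrightarrow> f z = 0"
    and "\<And>z. norm (f z) \<le> C"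
  shows "integrable M f"
proof (rule integrableI_bounded_set[of "cball 0 r" _ _ C])
  show "emeasure M (cball 0 r) < \<infinity>" using emeasure_span_lborel_bounded[of "cball 0 r"] by simp
qed (use assms in \<open>auto simp: not_le\<close>)

end

lemma hyperplane_orthonormal_basis_of:
  assumes "norm \<xi> = 1"
  shows "hyperplane (orthonormal_basis_of {x. x \<bullet> \<xi> = 0}) \<xi>"
proof -
  have "subspace {x. x \<bullet> \<xi> = 0}"
    by (auto simp: subspace_def inner_simps)
  from orthonormal_basis_of[OF this] show ?thesis
    using assms by unfold_locales auto
qed

section \<open>Area and center of mass of a section of a convex body\<close>

locale body_section = hyperplane B \<xi> for B :: "'a::euclidean_space set" and \<xi> +
  fixes K :: "'a set" and p\<^sub>0 :: 'a
  assumes compact_K: "compact K" and convex_K: "convex K" and p0_interior: "p\<^sub>0 \<in> interior K"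
begin

text \<open>The level is read off the interior point \<open>p\<^sub>0\<close>, which encodes that
  the hyperplane cuts the interior of the body.\<close>

definition t :: real where "t = p\<^sub>0 \<bullet> \<xi>"

definition m :: 'a where
  "m = centroid (distr M borel ((+) (t *\<^sub>R \<xi>))) (K \<inter> {p. p \<bullet> \<xi> = t})"

lemma K_borel [measurable]: "K \<in> sets borel"
  using compact_K by (simp add: borel_compact)

text \<open>Two points of the hyperplane differ by a vector of \<open>span B\<close>, and
  \<open>M\<close> is invariant under it. This frees the base point: \<open>p\<^sub>0\<close> for
  positivity arguments, \<open>m\<close> for moments.\<close>

lemma distr_level:
  assumes "p \<bullet> \<xi> = t"
  shows "distr M borel ((+) (t *\<^sub>R \<xi>)) = distr M borel ((+) p)"
proof -
  have "p - t *\<^sub>R \<xi> \<in> span B" using assms by (simp add: span_B inner_simps)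
  then have "distr M borel ((+) (t *\<^sub>R \<xi>)) = distr (distr M borel ((+) (p - t *\<^sub>R \<xi>))) borel ((+) (t *\<^sub>R \<xi>))"
    by (simp add: span_lborel_translation)
  also have "\<dots> = distr M borel ((+) (t *\<^sub>R \<xi>) \<circ> (+) (p - t *\<^sub>R \<xi>))"
    by (rule distr_distr) measurable
  also have "(+) (t *\<^sub>R \<xi>) \<circ> (+) (p - t *\<^sub>R \<xi>) = (+) p" by auto
  finally show ?thesis .
qed

definition radius :: real where "radius = (SOME R. 0 < R \<and> K \<subseteq> cball 0 R)"

lemma radius: "0 < radius" "K \<subseteq> cball 0 radius"
proof -
  have "\<exists>R. 0 < R \<and> K \<subseteq> cball 0 R"
    using bounded_subset_ballD[OF compact_imp_bounded[OF compact_K], of 0] ball_subset_cball by blast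
  from someI_ex[OF this] show "0 < radius" "K \<subseteq> cball 0 radius" unfolding radius_def by auto
qed

lemma norm_K: "p \<in> K \<Longrightarrow> norm p \<le> radius"
  using radius(2) by auto

lemma integrable_section:
  fixes f :: "'a \<Rightarrow> 'b::{banach, second_countable_topology}"
  assumes [measurable]: "f \<in> borel_measurable borel" and C: "\<And>z. p + z \<in> K \<Longrightarrow> norm (f z) \<le> C"
  shows "integrable M (\<lambda>z. indicator K (p + z) *\<^sub>R f z)"
\<comment> \<open>If no z satisfies the premise on \<open>C\<close>, then \<open>C\<close> may be
  negative, hence the maximum with 0.\<close>
proof (rule integrable_M_bounded[of _ "norm p + radius" "max C 0"])
  show "indicator K (p + z) *\<^sub>R f z = 0" if "norm p + radius < norm z" for z
  proof -
    have "norm z \<le> norm (p + z) + norm p" using norm_triangle_ineq4[of "p + z" p] by simp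
    then have "p + z \<notin> K" using that norm_K[of "p + z"] by auto
    then show ?thesis by simp
  qed
  show "norm (indicator K (p + z) *\<^sub>R f z) \<le> max C 0" for z
    using C[of z] by (auto simp: indicator_def)
qed measurable

lemma integrable_indicator_section: "integrable M (\<lambda>z. indicator K (p + z) :: real)"
  using integrable_section[of "\<lambda>_. 1 :: real" p 1] by simp

lemma norm_diff_K: "p + z \<in> K \<Longrightarrow> norm z \<le> norm p + radius"
  using norm_triangle_ineq4[of "p + z" p] norm_K[of "p + z"] by simp

lemma integrable_section_id: "integrable M (\<lambda>z. indicator K (p + z) *\<^sub>R z)"
  using norm_diff_K by (intro integrable_section[of _ _ "norm p + radius"]) auto

lemma integrable_section_moment:
  "integrable M (\<lambda>z. indicator K (p + z) *\<^sub>R ((z \<bullet> h) *\<^sub>R z))"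
proof (rule integrable_section[where C = "(norm p + radius) * norm h * (norm p + radius)"])
  fix z assume "p + z \<in> K"
  then have z: "norm z \<le> norm p + radius" by (rule norm_diff_K)
  have "norm ((z \<bullet> h) *\<^sub>R z) = \<bar>z \<bullet> h\<bar> * norm z" by simp
  also have "\<dots> \<le> (norm z * norm h) * norm z" by (intro mult_right_mono Cauchy_Schwarz_ineq2) auto
  also have "\<dots> \<le> (norm p + radius) * norm h * (norm p + radius)"
    using z radius(1) by (intro mult_mono) auto
  finally show "norm ((z \<bullet> h) *\<^sub>R z) \<le> (norm p + radius) * norm h * (norm p + radius)" .
qed auto

definition area :: real where "area = (\<integral>z. indicator K (p\<^sub>0 + z) \<partial>M)"

lemma
  assumes p: "p \<bullet> \<xi> = t"
  shows area_eq: "area = (\<integral>z. indicator K (p + z) \<partial>M)"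
    and m_eq: "m = (1 / area) *\<^sub>R (\<integral>z. indicator K (p + z) *\<^sub>R (p + z) \<partial>M)"
proof -
  let ?N = "distr M borel ((+) (t *\<^sub>R \<xi>))"
  let ?H = "{p. p \<bullet> \<xi> = t}"
  have [measurable]: "?H \<in> sets borel" by (simp add: inner_commute closed_hyperplane)
  have ind: "AE z in M. (indicator (K \<inter> ?H) (p + z) :: real) = indicator K (p + z)" if "p \<bullet> \<xi> = t" for p
    using AE_orthogonal_xi that by (auto elim!: eventually_mono simp: indicator_def inner_simps)
  have area: "measure ?N (K \<inter> ?H) = (\<integral>z. indicator K (p + z) \<partial>M)" if p: "p \<bullet> \<xi> = t" for p
  proof -
    have "measure ?N (K \<inter> ?H) = (\<integral>x. indicator (K \<inter> ?H) x \<partial>distr M borel ((+) p))"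
      by (simp add: distr_level[OF p])
    also have "\<dots> = (\<integral>z. indicator (K \<inter> ?H) (p + z) \<partial>M)"
      by (rule integral_distr) measurable
    also have "\<dots> = (\<integral>z. indicator K (p + z) \<partial>M)"
      using ind[OF p] by (intro integral_cong_AE) auto
    finally show ?thesis .
  qed
  have *: "p\<^sub>0 \<bullet> \<xi> = t" by (simp add: t_def)
  show area': "area = (\<integral>z. indicator K (p + z) \<partial>M)"
    unfolding area_def using area[OF p] area[OF *] by simp
  have "set_lebesgue_integral ?N (K \<inter> ?H) (\<lambda>x. x) = (\<integral>x. indicator (K \<inter> ?H) x *\<^sub>R x \<partial>distr M borel ((+) p))"
    by (simp add: distr_level[OF p] set_lebesgue_integral_def)
  also have "\<dots> = (\<integral>z. indicator (K \<inter> ?H) (p + z) *\<^sub>R (p + z) \<partial>M)"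
    by (rule integral_distr) measurable
  also have "\<dots> = (\<integral>z. indicator K (p + z) *\<^sub>R (p + z) \<partial>M)"
    using ind[OF p] by (intro integral_cong_AE) auto
  finally show "m = (1 / area) *\<^sub>R (\<integral>z. indicator K (p + z) *\<^sub>R (p + z) \<partial>M)"
    unfolding m_def centroid_def using area[OF p] area' by simp
qed

lemma emeasure_M_cball_pos: "0 < r \<Longrightarrow> 0 < emeasure M (cball 0 r)"
  by (simp add: emeasure_span_lborel_cball)

text \<open>A ball around \<open>p\<^sub>0\<close> inside the body cuts the hyperplane in a ball of
  positive measure.\<close>

lemma area_pos: "0 < area"
proof -
  obtain r where r: "0 < r" "cball p\<^sub>0 r \<subseteq> interior K"
    using p0_interior open_contains_cball[of "interior K"] by auto
  have "AE z in M. indicator K (p\<^sub>0 + z) = (0::real)" if "area = 0"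
    using integral_nonneg_eq_0_iff_AE[OF integrable_indicator_section[of p\<^sub>0]] that by (simp add: area_def)
  then have "AE z in M. z \<notin> cball 0 r" if "area = 0"
    using that r(2) interior_subset[of K]
    by (auto elim!: eventually_mono simp: indicator_def subset_iff dist_norm)
  then have "emeasure M (cball 0 r) = 0" if "area = 0"
    using that by (subst (asm) AE_iff_measurable[of "cball 0 r"]) auto
  moreover have "0 \<le> area" unfolding area_def by (rule Bochner_Integration.integral_nonneg) auto
  ultimately show ?thesis using emeasure_M_cball_pos[OF r(1)] by (cases "area = 0") auto
qed

lemma section_centroid:
  assumes p: "p \<bullet> \<xi> = t"
  shows "m = p + (1 / area) *\<^sub>R (\<integral>z. indicator K (p + z) *\<^sub>R z \<partial>M)"
proof -
  have "(\<integral>z. indicator K (p + z) *\<^sub>R (p + z) \<partial>M)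
      = (\<integral>z. indicator K (p + z) *\<^sub>R p + indicator K (p + z) *\<^sub>R z \<partial>M)"
    by (simp add: scaleR_add_right)
  also have "\<dots> = area *\<^sub>R p + (\<integral>z. indicator K (p + z) *\<^sub>R z \<partial>M)"
    using integrable_indicator_section[of p] integrable_section_id[of p]
    by (subst Bochner_Integration.integral_add) (auto simp: area_eq[OF p])
  finally show ?thesis
    using area_pos by (simp add: m_eq[OF p] scaleR_add_right)
qed

lemma m_level: "m \<bullet> \<xi> = t"
proof -
  have "(\<integral>z. indicator K (p\<^sub>0 + z) *\<^sub>R z \<partial>M) \<bullet> \<xi> = (\<integral>z. (indicator K (p\<^sub>0 + z) *\<^sub>R z) \<bullet> \<xi> \<partial>M)"
    by (rule integral_inner_left[symmetric]) (rule integrable_section_id)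
  also have "\<dots> = (\<integral>z. 0 \<partial>M)"
    using AE_orthogonal_xi by (intro integral_cong_AE) (auto elim!: eventually_mono)
  finally show ?thesis
    using section_centroid[of p\<^sub>0] by (simp add: inner_simps t_def)
qed

lemma integral_section_id_m: "(\<integral>z. indicator K (m + z) *\<^sub>R z \<partial>M) = 0"
  using section_centroid[OF m_level] area_pos by simp

text \<open>Otherwise a linear functional \<open>a\<close> attains its maximum over the body at
  \<open>m\<close>. Then \<open>a \<bullet> (m - x)\<close> is nonnegative on the section and
  integrates to 0 there, because \<open>m\<close> is the centroid; so it vanishes almost everywhere,
  although it is positive on a ball around \<open>p\<^sub>0\<close>.\<close>

lemma m_interior: "m \<in> interior K"
proof (rule ccontr)
  assume "m \<notin> interior K"
  then have "interior K \<inter> {m} = {}" by auto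
  then obtain a b where a: "a \<noteq> 0" "\<forall>x\<in>interior K. a \<bullet> x \<le> b" "\<forall>x\<in>{m}. b \<le> a \<bullet> x"
    using separating_hyperplane_sets[of "interior K" "{m}"] p0_interior convex_interior[OF convex_K] by blast
  have "interior K \<subseteq> interior {x. a \<bullet> x \<le> b}"
    using a(2) by (intro interior_maximal) auto
  then have strict: "a \<bullet> x < b" if "x \<in> interior K" for x
    using that a(1) by (auto simp: interior_halfspace_le)
  have "K \<subseteq> closure (interior K)"
    using convex_closure_interior[OF convex_K] p0_interior closure_subset by blast
  also have "\<dots> \<subseteq> {x. a \<bullet> x \<le> b}"
    using a(2) by (intro closure_minimal) (auto simp: closed_halfspace_le)
  finally have le: "a \<bullet> x \<le> a \<bullet> m" if "x \<in> K" for x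
    using that a(3) by force
  let ?g = "\<lambda>z. indicator K (p\<^sub>0 + z) * (a \<bullet> m - a \<bullet> (p\<^sub>0 + z))"
  have eq: "?g z = (a \<bullet> (m - p\<^sub>0)) * indicator K (p\<^sub>0 + z) - a \<bullet> (indicator K (p\<^sub>0 + z) *\<^sub>R z)" for z
    by (simp add: algebra_simps inner_simps)
  have int: "integrable M ?g"
    unfolding eq using integrable_indicator_section[of p\<^sub>0] integrable_section_id[of p\<^sub>0]
    by (intro Bochner_Integration.integrable_diff integrable_mult_right integrable_inner_right)
  have "(\<integral>z. ?g z \<partial>M) = (a \<bullet> (m - p\<^sub>0)) * area - a \<bullet> (\<integral>z. indicator K (p\<^sub>0 + z) *\<^sub>R z \<partial>M)"
    unfolding eq area_def using integrable_indicator_section[of p\<^sub>0] integrable_section_id[of p\<^sub>0]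
    by (subst Bochner_Integration.integral_diff) (auto simp del: inner_scaleR_right)
  also have "(\<integral>z. indicator K (p\<^sub>0 + z) *\<^sub>R z \<partial>M) = area *\<^sub>R (m - p\<^sub>0)"
    using section_centroid[of p\<^sub>0] area_pos by (simp add: t_def)
  finally have "(\<integral>z. ?g z \<partial>M) = 0" by simp
  moreover have "AE z in M. 0 \<le> ?g z" using le by (auto simp: indicator_def)
  ultimately have AE: "AE z in M. ?g z = 0"
    using integral_nonneg_eq_0_iff_AE[OF int] by simp
  obtain r where r: "0 < r" "cball p\<^sub>0 r \<subseteq> interior K"
    using p0_interior open_contains_cball[of "interior K"] by auto
  have "?g z \<noteq> 0" if "z \<in> cball 0 r" for z
  proof -
    have "p\<^sub>0 + z \<in> interior K" using that r(2) by (auto simp: dist_norm subset_iff)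
    then show ?thesis using strict[of "p\<^sub>0 + z"] a(3) interior_subset[of K] by auto
  qed
  with AE have "AE z in M. z \<notin> cball 0 r" by (auto elim!: eventually_mono)
  then have "emeasure M (cball 0 r) = 0"
    by (subst (asm) AE_iff_measurable[of "cball 0 r"]) auto
  then show False using emeasure_M_cball_pos[OF r(1)] by simp
qed

text \<open>Contracting towards the interior point \<open>m\<close> by a factor s < 1 carries the
  section into the interior and multiplies its measure by a power of s. Letting s tend to 1, the
  section is no larger than its interior part.\<close>

lemma emeasure_section_frontier: "emeasure M {z. m + z \<in> frontier K} = 0"
proof -
  let ?L = "{z. m + z \<in> K}" and ?I = "{z. m + z \<in> interior K}"
  have L[measurable]: "?L \<in> sets borel" and I[measurable]: "?I \<in> sets borel"
    using measurable_sets_borel[of "\<lambda>z. m + z" borel K] measurable_sets_borel[of "\<lambda>z. m + z" borel "interior K"]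
    by (auto simp: vimage_def)
  have "bounded ?L"
    using norm_diff_K by (intro boundedI[of _ "norm m + radius"]) auto
  then have fin: "emeasure M ?L < top" by (rule emeasure_span_lborel_bounded)
  have IL: "?I \<subseteq> ?L" using interior_subset by auto
  have scaled: "emeasure M ?L \<le> ennreal ((1 / s) ^ card B) * emeasure M ?I" if s: "0 < s" "s < 1" for s
  proof -
    have "?L \<subseteq> (\<lambda>x. s *\<^sub>R x) -` ?I"
    proof
      fix z assume "z \<in> ?L"
      then have "(m + z) - (1 - s) *\<^sub>R ((m + z) - m) \<in> interior K"
        using s m_interior by (intro mem_interior_convex_shrink[OF convex_K]) auto
      then show "z \<in> (\<lambda>x. s *\<^sub>R x) -` ?I" by (simp add: algebra_simps)
    qed
    moreover have "(\<lambda>x. s *\<^sub>R x) -` ?I \<in> sets borel"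
      using measurable_sets_borel[of "\<lambda>x. s *\<^sub>R x" borel ?I] I by simp
    ultimately have "emeasure M ?L \<le> emeasure M ((\<lambda>x. s *\<^sub>R x) -` ?I)"
      by (intro emeasure_mono) auto
    also have "\<dots> = ennreal ((1 / s) ^ card B) * emeasure M ?I"
      by (rule emeasure_span_lborel_scaled[OF s(1) I])
    finally show ?thesis .
  qed
  have "measure M ?L \<le> (1 / 1) ^ card B * measure M ?I"
  proof (rule tendsto_lowerbound)
    show "((\<lambda>s. (1 / s) ^ card B * measure M ?I) \<longlongrightarrow> (1 / 1) ^ card B * measure M ?I) (at_left 1)"
      by (intro tendsto_intros) auto
    show "\<forall>\<^sub>F s in at_left 1. measure M ?L \<le> (1 / s) ^ card B * measure M ?I"
    proof (rule eventually_at_leftI[of 0])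
      fix s :: real assume "s \<in> {0<..<1}"
      then have s: "0 < s" "s < 1" by auto
      have finI: "emeasure M ?I < top" using emeasure_mono[OF IL, of M] fin by (simp add: le_less_trans)
      have "ennreal (measure M ?L) \<le> ennreal ((1 / s) ^ card B) * ennreal (measure M ?I)"
        using scaled[OF s] fin finI by (simp add: emeasure_eq_ennreal_measure)
      then show "measure M ?L \<le> (1 / s) ^ card B * measure M ?I"
        using s by (simp flip: ennreal_mult)
    qed simp
  qed simp_all
  moreover have "emeasure M ?L - emeasure M ?I = emeasure M (?L - ?I)"
    using IL fin emeasure_mono[OF IL, of M] by (intro emeasure_Diff[symmetric]) auto
  moreover have "emeasure M ?I < top"
    using emeasure_mono[OF IL, of M] fin by (simp add: le_less_trans)
  ultimately have "emeasure M (?L - ?I) = 0"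
    using fin by (simp add: emeasure_eq_ennreal_measure diff_eq_0_ennreal)
  moreover have "{z. m + z \<in> frontier K} = ?L - ?I"
    using compact_K by (auto simp: frontier_def compact_imp_closed)
  ultimately show ?thesis by simp
qed

end

subsection \<open>Inertia of an equichordal section\<close>

lemma nn_integral_power_Icc:
  assumes "0 \<le> (a::real)"
  shows "(\<integral>\<^sup>+s. indicator {0..a} s * ennreal (s ^ n) \<partial>lborel) = ennreal (a ^ Suc n / real (Suc n))"
proof -
  have "(\<integral>\<^sup>+s. ennreal (s ^ n) * indicator {0..a} s \<partial>lborel)
      = ennreal (a ^ Suc n / real (Suc n) - 0 ^ Suc n / real (Suc n))"
  proof (rule nn_integral_FTC_Icc[where F = "\<lambda>s. s ^ Suc n / real (Suc n)"])
    fix s :: real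
    show "((\<lambda>s. s ^ Suc n / real (Suc n)) has_real_derivative s ^ n) (at s)"
      using DERIV_cdivide[OF DERIV_pow[of "Suc n" s UNIV], of "real (Suc n)"]
      by (simp del: of_nat_Suc power_Suc)
  qed (use assms in auto)
  then show ?thesis by (simp add: mult.commute)
qed

lemma nn_integral_inverse_power_atLeast:
  assumes "0 < (a::real)" "0 < n"
  shows "(\<integral>\<^sup>+s. indicator {a..} s * ennreal ((1 / s) ^ Suc n) \<partial>lborel) = ennreal ((1 / a) ^ n / real n)"
proof -
  have "(\<integral>\<^sup>+s. ennreal ((1 / s) ^ Suc n) * indicator {a..} s \<partial>lborel) = ennreal (0 - (- ((1 / a) ^ n / real n)))"
  proof (rule nn_integral_FTC_atLeast[where F = "\<lambda>s. - ((1 / s) ^ n / real n)"])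
    show "(\<lambda>s::real. (1 / s) ^ Suc n) \<in> borel_measurable borel" by measurable
    fix s :: real assume s: "a \<le> s"
    then show "0 \<le> (1 / s) ^ Suc n" using assms by simp
    have "0 < s" using s assms by simp
    obtain k where k: "n = Suc k" using assms(2) by (cases n) auto
    have "((\<lambda>s. - ((1 / s) ^ n / real n)) has_real_derivative
        - (real n * (1 / s) ^ (n - Suc 0) * (- (1 / s\<^sup>2)) / real n)) (at s)"
      using \<open>0 < s\<close> by (auto intro!: derivative_eq_intros simp: power2_eq_square)
    also have "- (real n * (1 / s) ^ (n - Suc 0) * (- (1 / s\<^sup>2)) / real n) = (1 / s) ^ Suc n"
      using assms(2) by (simp add: k power2_eq_square power_divide del: of_nat_Suc)
    finally show "DERIV (\<lambda>s. - ((1 / s) ^ n / real n)) s :> (1 / s) ^ Suc n" .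
  next
    have "((\<lambda>s::real. - ((1 / s) ^ n / real n)) \<longlongrightarrow> - (0 ^ n / real n)) at_top"
      by (intro tendsto_intros tendsto_divide_0[OF tendsto_const] filterlim_at_top_imp_at_infinity filterlim_ident) (use assms in auto)
    then show "((\<lambda>s::real. - ((1 / s) ^ n / real n)) \<longlongrightarrow> 0) at_top"
      using assms(2) by (simp add: zero_power)
  qed
  then show ?thesis by (simp add: mult.commute)
qed

context body_section
begin

text \<open>The parameters that land in the body form a compact interval around 0, and contraction
  towards \<open>m\<close> puts everything strictly between its ends into the interior. The
  direction is not normalized, since the later integration runs over all y of a ball and not over
  unit vectors.\<close>

lemma chord:
  assumes y: "y \<in> span B" "y \<noteq> 0"
  shows "\<exists>\<alpha>>0. \<exists>\<beta>>0. (\<forall>s. m + s *\<^sub>R y \<in> K \<longleftrightarrow> s \<in> {-\<beta>..\<alpha>}) \<and>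
    (\<forall>s. m + s *\<^sub>R y \<in> frontier K \<longleftrightarrow> s = \<alpha> \<or> s = - \<beta>)"
proof -
  let ?\<gamma> = "\<lambda>s. m + s *\<^sub>R y"
  define T where "T = {s. ?\<gamma> s \<in> K}"
  have T_mem: "s \<in> T \<longleftrightarrow> ?\<gamma> s \<in> K" for s by (simp add: T_def)
  have cont: "continuous_on UNIV ?\<gamma>" by (intro continuous_intros)
  have closed: "closed K" using compact_K by (rule compact_imp_closed)
  have "closed T" using continuous_closed_vimage[OF closed, of ?\<gamma>] cont
    by (simp add: T_def vimage_def continuous_on_eq_continuous_at)
  moreover have "bounded T"
  proof (rule boundedI)
    fix s assume "s \<in> T"
    then have "norm (s *\<^sub>R y) \<le> norm m + radius" using norm_diff_K[of m "s *\<^sub>R y"] by (simp add: T_def)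
    then show "norm s \<le> (norm m + radius) / norm y" using y(2) by (simp add: field_simps)
  qed
  ultimately have "compact T" by (simp add: compact_eq_bounded_closed)
  moreover have "convex T"
  proof (rule convexI)
    fix a b u v :: real assume "a \<in> T" "b \<in> T" "0 \<le> u" "0 \<le> v" "u + v = 1"
    then have "u *\<^sub>R ?\<gamma> a + v *\<^sub>R ?\<gamma> b \<in> K" using convex_K by (simp add: T_def convexD)
    moreover have "u *\<^sub>R ?\<gamma> a + v *\<^sub>R ?\<gamma> b = (u + v) *\<^sub>R m + (u * a + v * b) *\<^sub>R y"
      by (simp add: algebra_simps)
    ultimately show "u *\<^sub>R a + v *\<^sub>R b \<in> T" using \<open>u + v = 1\<close> by (simp add: T_def)
  qed
  ultimately obtain l h where lh: "T = {l..h}"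
    using connected_compact_interval_1[of T] convex_connected by blast
  have nbhd: "\<exists>e>0. s + e \<in> T \<and> s - e \<in> T" if "?\<gamma> s \<in> interior K" for s
  proof -
    have "open (?\<gamma> -` interior K)" using cont by (intro open_vimage) auto
    then obtain e where e: "0 < e" "ball s e \<subseteq> ?\<gamma> -` interior K"
      using \<open>?\<gamma> s \<in> interior K\<close> openE[of "?\<gamma> -` interior K" s] by blast
    have "s + e / 2 \<in> ball s e" "s - e / 2 \<in> ball s e" using e(1) by (auto simp: dist_norm)
    then have "s + e / 2 \<in> T" "s - e / 2 \<in> T"
      using e(2) interior_subset[of K] unfolding T_def by blast+
    then show ?thesis using e(1) by (intro exI[of _ "e / 2"]) auto
  qed
  obtain e where "0 < e" "0 + e \<in> T" "0 - e \<in> T" using nbhd[of 0] m_interior by auto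
  then have pos: "0 < h" "l < 0" by (auto simp: lh)
  have int: "?\<gamma> s \<in> interior K" if s: "l < s" "s < h" for s
  proof (cases "s = 0")
    case True then show ?thesis using m_interior by simp
  next
    case False
    \<comment> \<open>The end of the chord on the side of s, so that s / k lies strictly between 0
      and 1.\<close>
    define k where "k = (if 0 < s then h else l)"
    have k: "k \<in> T" "0 < s / k" "s / k < 1" using s pos False by (auto simp: k_def lh field_simps)
    have "?\<gamma> k - (1 - s / k) *\<^sub>R (?\<gamma> k - m) \<in> interior K"
      using k m_interior by (intro mem_interior_convex_shrink[OF convex_K]) (auto simp: T_def)
    also have "?\<gamma> k - (1 - s / k) *\<^sub>R (?\<gamma> k - m) = ?\<gamma> s"
      using k by (auto simp: algebra_simps)
    finally show ?thesis .
  qed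
  have "0 < h \<and> 0 < - l \<and> (\<forall>s. ?\<gamma> s \<in> K \<longleftrightarrow> s \<in> {- (- l)..h}) \<and> (\<forall>s. ?\<gamma> s \<in> frontier K \<longleftrightarrow> s = h \<or> s = - (- l))"
  proof (intro conjI allI)
    show "0 < h" "0 < - l" using pos by auto
    show "?\<gamma> s \<in> K \<longleftrightarrow> s \<in> {- (- l)..h}" for s using T_mem[of s] lh by auto
    show "?\<gamma> s \<in> frontier K \<longleftrightarrow> s = h \<or> s = - (- l)" for s
    proof
      assume fr: "?\<gamma> s \<in> frontier K"
      then have "s \<in> T" "?\<gamma> s \<notin> interior K" using closed by (auto simp: T_def frontier_def)
      moreover from this have "\<not> (l < s \<and> s < h)" using int[of s] by blast
      ultimately show "s = h \<or> s = - (- l)" by (auto simp: lh)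
    next
      assume s: "s = h \<or> s = - (- l)"
      then have "?\<gamma> s \<notin> interior K" using nbhd[of s] by (auto simp: lh)
      moreover have "?\<gamma> s \<in> K" using s pos lh T_mem[of s] by auto
      ultimately show "?\<gamma> s \<in> frontier K" using closed by (simp add: frontier_def)
    qed
  qed
  then show ?thesis by blast
qed

end

text \<open>The section has dimension \<open>card B\<close>, so the exponent
  \<open>card B + 2\<close> is d+1. A nonempty \<open>B\<close> guarantees that there is a chord at
  all, from which c > 0 follows.\<close>

locale equichordal_body_section = body_section +
  fixes c :: real
  assumes n_pos: "B \<noteq> {}"
    and equichordal: "\<And>l z\<^sub>1 z\<^sub>2. affine l \<Longrightarrow> aff_dim l = 1 \<Longrightarrow> l \<subseteq> {p. p \<bullet> \<xi> = t} \<Longrightarrow> m \<in> l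
      \<Longrightarrow> z\<^sub>1 \<noteq> z\<^sub>2 \<Longrightarrow> l \<inter> frontier K = {z\<^sub>1, z\<^sub>2} \<Longrightarrow> dist m z\<^sub>1 ^ (card B + 2) + dist m z\<^sub>2 ^ (card B + 2) = c"
begin

definition p :: nat where "p = card B + 2"

lemma p_pos: "0 < p" by (simp add: p_def)

text \<open>The ends \<alpha> and \<beta> are measured in units of y, the condition in units of
  length; hence the power of \<open>norm y\<close>.\<close>

lemma chord_power:
  assumes y: "y \<in> span B" "y \<noteq> 0" and "0 < \<alpha>" "0 < \<beta>"
    and fr: "\<And>s. m + s *\<^sub>R y \<in> frontier K \<longleftrightarrow> s = \<alpha> \<or> s = - \<beta>"
  shows "\<alpha> ^ p + \<beta> ^ p = c / norm y ^ p"
proof -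
  let ?l = "affine hull {m, m + y}"
  have l: "?l = {m + s *\<^sub>R y | s. True}"
  proof -
    have *: "u *\<^sub>R m + v *\<^sub>R (m + y) = (u + v) *\<^sub>R m + v *\<^sub>R y" for u v
      by (simp add: algebra_simps)
    show ?thesis
    proof (intro set_eqI iffI)
      fix x assume "x \<in> ?l"
      then obtain u v where "x = u *\<^sub>R m + v *\<^sub>R (m + y)" "u + v = 1" by (auto simp: affine_hull_2)
      then have "x = m + v *\<^sub>R y" by (simp only: *) simp
      then show "x \<in> {m + s *\<^sub>R y | s. True}" by blast
    next
      fix x assume "x \<in> {m + s *\<^sub>R y | s. True}"
      then obtain s where "x = m + s *\<^sub>R y" by blast
      then have "x = (1 - s) *\<^sub>R m + s *\<^sub>R (m + y)" by (simp only: *) simp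
      moreover have "(1 - s) + s = 1" by simp
      ultimately show "x \<in> ?l" unfolding affine_hull_2 by blast
    qed
  qed
  have "dist m (m + \<alpha> *\<^sub>R y) ^ p + dist m (m + (- \<beta>) *\<^sub>R y) ^ p = c"
    unfolding p_def
  proof (rule equichordal[of ?l])
    show "affine ?l" by (rule affine_affine_hull)
    show "aff_dim ?l = 1" using y(2) by (simp add: aff_dim_affine_hull aff_dim_2)
    show "?l \<subseteq> {p. p \<bullet> \<xi> = t}" using y(1) unfolding l by (auto simp: inner_simps m_level span_B)
    show "m \<in> ?l" by (simp add: hull_inc)
    show "m + \<alpha> *\<^sub>R y \<noteq> m + (- \<beta>) *\<^sub>R y"
      using assms(2-4) by (simp only: add_left_cancel scaleR_cancel_right) auto
    show "?l \<inter> frontier K = {m + \<alpha> *\<^sub>R y, m + (- \<beta>) *\<^sub>R y}"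
      unfolding l using fr[of \<alpha>] fr[of "- \<beta>"] by (auto simp: fr intro: exI[of _ "- \<beta>"])
  qed
  then have "(\<alpha> * norm y) ^ p + (\<beta> * norm y) ^ p = c"
    using assms(3,4) by (simp add: dist_norm)
  then have "(\<alpha> ^ p + \<beta> ^ p) * norm y ^ p = c"
    by (simp only: power_mult_distrib distrib_right)
  then show ?thesis using y(2) by (simp add: eq_divide_eq)
qed

text \<open>The weight \<open>s ^ (p - 1)\<close> has primitive \<open>s ^ p / p\<close>, so the two
  half-chords together produce exactly the equichordal sum.\<close>

lemma nn_integral_chord:
  assumes y: "y \<in> span B" "y \<noteq> 0"
  shows "(\<integral>\<^sup>+s. indicator {0..} s * ennreal (s ^ (p - 1)) * (indicator K (m + s *\<^sub>R y) + indicator K (m - s *\<^sub>R y)) \<partial>lborel)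
    = ennreal (c / (real p * norm y ^ p))"
proof -
  obtain \<alpha> \<beta> where ab: "0 < \<alpha>" "0 < \<beta>" "\<forall>s. m + s *\<^sub>R y \<in> K \<longleftrightarrow> s \<in> {-\<beta>..\<alpha>}"
    and fr: "\<forall>s. m + s *\<^sub>R y \<in> frontier K \<longleftrightarrow> s = \<alpha> \<or> s = - \<beta>"
    using chord[OF y] by blast
  have "indicator {0..} s * ennreal (s ^ (p - 1)) * (indicator K (m + s *\<^sub>R y) + indicator K (m - s *\<^sub>R y))
      = indicator {0..\<alpha>} s * ennreal (s ^ (p - 1)) + indicator {0..\<beta>} s * ennreal (s ^ (p - 1))" for s
  proof -
    have "m + s *\<^sub>R y \<in> K \<longleftrightarrow> - \<beta> \<le> s \<and> s \<le> \<alpha>" "m - s *\<^sub>R y \<in> K \<longleftrightarrow> - \<alpha> \<le> s \<and> s \<le> \<beta>"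
      using ab(3)[rule_format, of s] ab(3)[rule_format, of "- s"] by auto
    then show ?thesis using ab(1,2) by (auto simp: indicator_def mult_2_right)
  qed
  then have "(\<integral>\<^sup>+s. indicator {0..} s * ennreal (s ^ (p - 1)) * (indicator K (m + s *\<^sub>R y) + indicator K (m - s *\<^sub>R y)) \<partial>lborel)
      = (\<integral>\<^sup>+s. indicator {0..\<alpha>} s * ennreal (s ^ (p - 1)) + indicator {0..\<beta>} s * ennreal (s ^ (p - 1)) \<partial>lborel)"
    by simp
  also have "\<dots> = ennreal (\<alpha> ^ Suc (p - 1) / real (Suc (p - 1))) + ennreal (\<beta> ^ Suc (p - 1) / real (Suc (p - 1)))"
    unfolding nn_integral_power_Icc[OF less_imp_le[OF ab(1)], symmetric]
      nn_integral_power_Icc[OF less_imp_le[OF ab(2)], symmetric] diff_Suc_1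
    by (rule nn_integral_add) measurable
  also have "\<dots> = ennreal (\<alpha> ^ p / real p) + ennreal (\<beta> ^ p / real p)" using p_pos by simp
  also have "\<dots> = ennreal ((\<alpha> ^ p + \<beta> ^ p) / real p)"
    using ab by (simp add: add_divide_distrib flip: ennreal_plus)
  also have "\<dots> = ennreal (c / (real p * norm y ^ p))"
    by (subst chord_power[OF y ab(1,2) fr[rule_format]]) (simp_all add: mult.commute)
  finally show ?thesis .
qed

text \<open>Needed because \<open>ennreal\<close> would truncate a negative constant to 0, and
  because it makes the factor in the inertia strictly positive.\<close>

lemma c_pos: "0 < c"
proof -
  obtain y where "y \<in> B" using n_pos by blast
  then have y: "y \<in> span B" "y \<noteq> 0" using norm_one[of y] by (auto intro: span_base)
  obtain \<alpha> \<beta> where ab: "0 < \<alpha>" "0 < \<beta>" "\<forall>s. m + s *\<^sub>R y \<in> K \<longleftrightarrow> s \<in> {-\<beta>..\<alpha>}"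
    and fr: "\<forall>s. m + s *\<^sub>R y \<in> frontier K \<longleftrightarrow> s = \<alpha> \<or> s = - \<beta>"
    using chord[OF y] by blast
  have "0 < \<alpha> ^ p + \<beta> ^ p" using ab by (intro add_pos_pos) auto
  then have "0 < c / norm y ^ p" unfolding chord_power[OF y ab(1,2) fr[rule_format]] .
  moreover have "0 < norm y ^ p" using y(2) by simp
  ultimately show ?thesis by (simp only: zero_less_divide_iff) auto
qed

text \<open>
  Polar integration without spheres: \<open>1 / p\<close> is written as \<open>\<integral> \<bar>x\<bar>\<^sup>p s\<^sup>-\<^sup>p\<^sup>-\<^sup>1 ds\<close> over \<open>s \<ge> \<bar>x\<bar>\<close>, and after
  exchanging the integrals \<open>x\<close> is replaced by \<open>s y\<close> with \<open>y\<close> in the unit ball.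
\<close>

lemma second_moment_eq_ball:
  "(\<integral>\<^sup>+z. indicator K (m + z) * ennreal ((z \<bullet> u)\<^sup>2) \<partial>M)
    = ennreal (c / 2) * (\<integral>\<^sup>+z. indicator (cball 0 1) z * ennreal ((z \<bullet> u)\<^sup>2) \<partial>M)"
proof -
  \<comment> \<open>The condition controls only the sum over opposite ends of a chord, so the
    section is symmetrized about \<open>m\<close>; as \<open>q\<close> is even, this merely doubles
    the moment.\<close>
  define F where "F z = (indicator K (m + z) + indicator K (m - z) :: ennreal)" for z
  define q where "q z = ennreal ((z \<bullet> u)\<^sup>2)" for z
  have [measurable]: "F \<in> borel_measurable borel" "q \<in> borel_measurable borel"
    unfolding F_def q_def by measurable
  have "(\<integral>\<^sup>+z. F z * q z \<partial>M) = (\<integral>\<^sup>+z. indicator K (m + z) * q z \<partial>M) + (\<integral>\<^sup>+z. indicator K (m - z) * q z \<partial>M)"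
    unfolding F_def distrib_right by (intro nn_integral_add) measurable
  also have "(\<integral>\<^sup>+z. indicator K (m - z) * q z \<partial>M) = (\<integral>\<^sup>+z. indicator K (m - z) * q z \<partial>distr M borel uminus)"
    by (subst span_lborel_isometry) (auto intro: linear_uminus span_neg)
  also have "\<dots> = (\<integral>\<^sup>+z. indicator K (m + z) * q z \<partial>M)"
    by (subst nn_integral_distr) (auto simp: q_def)
  finally have sym: "(\<integral>\<^sup>+z. F z * q z \<partial>M) = 2 * (\<integral>\<^sup>+z. indicator K (m + z) * q z \<partial>M)"
    by (simp add: mult_2)
  have q_scale: "q (s *\<^sub>R y) = ennreal (s\<^sup>2) * q y" for s y
    by (simp add: q_def power_mult_distrib ennreal_mult)
  define G where "G x s = F x * q x * (ennreal (norm x ^ p) * (indicator {norm x..} s * ennreal ((1 / s) ^ Suc p)))" for x s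
  define w where "w y = indicator (cball 0 1) y * q y * ennreal (norm y ^ p)" for y
  have [measurable]: "cball (0::'a) 1 \<in> sets borel" by simp
  have [measurable]: "w \<in> borel_measurable borel" unfolding w_def by measurable
  have G_meas[measurable]: "(\<lambda>(x, s). G x s) \<in> borel_measurable (borel \<Otimes>\<^sub>M borel)"
    unfolding G_def indicator_def atLeast_iff by measurable
  have W: "(\<integral>\<^sup>+s. G x s \<partial>lborel) = F x * q x * ennreal (1 / real p)" for x
  proof (cases "x = 0")
    \<comment> \<open>At the origin the integral of the weight over s is 0 and not 1 / p; the factor
      \<open>q x\<close> vanishes there.\<close>
    case True then show ?thesis by (simp add: G_def q_def)
  next
    case False
    have "(\<integral>\<^sup>+s. G x s \<partial>lborel) = F x * q x * (ennreal (norm x ^ p) * (\<integral>\<^sup>+s. indicator {norm x..} s * ennreal ((1 / s) ^ Suc p) \<partial>lborel))"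
      unfolding G_def by (simp add: nn_integral_cmult)
    also have "(\<integral>\<^sup>+s. indicator {norm x..} s * ennreal ((1 / s) ^ Suc p) \<partial>lborel) = ennreal ((1 / norm x) ^ p / real p)"
      using False p_pos by (intro nn_integral_inverse_power_atLeast) auto
    also have "ennreal (norm x ^ p) * ennreal ((1 / norm x) ^ p / real p) = ennreal (1 / real p)"
      using False by (simp add: power_one_over field_simps flip: ennreal_mult)
    finally show ?thesis .
  qed
  have "ennreal (1 / real p) * (\<integral>\<^sup>+z. F z * q z \<partial>M) = (\<integral>\<^sup>+x. (\<integral>\<^sup>+s. G x s \<partial>lborel) \<partial>M)"
    unfolding W by (simp add: nn_integral_multc mult.commute)
  also have "\<dots> = (\<integral>\<^sup>+s. (\<integral>\<^sup>+x. G x s \<partial>M) \<partial>lborel)"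
    by (rule P.Fubini'[symmetric]) measurable
  also have "\<dots> = (\<integral>\<^sup>+s. (\<integral>\<^sup>+y. indicator {0..} s * ennreal (s ^ (p - 1)) * F (s *\<^sub>R y)
      * w y \<partial>M) \<partial>lborel)"
  proof (rule nn_integral_cong_AE)
    have "(\<integral>\<^sup>+x. G x s \<partial>M) = (\<integral>\<^sup>+y. indicator {0..} s * ennreal (s ^ (p - 1)) * F (s *\<^sub>R y)
      * w y \<partial>M)" if "s \<noteq> 0" for s
    proof (cases "0 < s")
      case True
      have "(\<integral>\<^sup>+x. G x s \<partial>M) = ennreal (s ^ card B) * (ennreal ((1 / s) ^ card B) * (\<integral>\<^sup>+x. G x s \<partial>M))"
        using True by (simp add: power_one_over flip: mult.assoc ennreal_mult)
      also have "\<dots> = ennreal (s ^ card B) * (\<integral>\<^sup>+y. G (s *\<^sub>R y) s \<partial>M)"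
        using True by (subst nn_integral_span_lborel_scaled) auto
      also have "\<dots> = (\<integral>\<^sup>+y. ennreal (s ^ card B) * G (s *\<^sub>R y) s \<partial>M)"
        by (rule nn_integral_cmult[symmetric]) measurable
      also have "\<dots> = (\<integral>\<^sup>+y. indicator {0..} s * ennreal (s ^ (p - 1)) * F (s *\<^sub>R y)
          * w y \<partial>M)"
      proof (rule nn_integral_cong)
        fix y :: 'a
        have ind: "(indicator {norm (s *\<^sub>R y)..} s :: ennreal) = indicator (cball 0 1) y"
          using True by (auto simp: indicator_def mult_le_cancel_left1)
        \<comment> \<open>Powers of s after x = s y: \<open>card B\<close> from the dilation, 2 from
          the quadratic form, p from \<open>norm x ^ p\<close> and -(p + 1) from the weight. The
          total \<open>card B + 1\<close> is p - 1, the weight that \<open>nn_integral_chord\<close>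
          integrates.\<close>
        have pw: "ennreal (s ^ card B) * (ennreal (s\<^sup>2) * (ennreal (norm (s *\<^sub>R y) ^ p) * ennreal ((1 / s) ^ Suc p)))
            = ennreal (s ^ (p - 1)) * ennreal (norm y ^ p)"
        proof -
          have "s ^ card B * s\<^sup>2 = s * s ^ (p - 1)" "s ^ p * (1 / s) ^ p = 1"
            using True by (simp_all add: p_def power2_eq_square mult_ac flip: power_mult_distrib)
          moreover have "s ^ card B * (s\<^sup>2 * (norm (s *\<^sub>R y) ^ p * (1 / s) ^ Suc p))
              = (s ^ card B * s\<^sup>2) * (s ^ p * (1 / s) ^ p) * (1 / s) * norm y ^ p"
            using True by (simp only: norm_scaleR abs_of_pos power_mult_distrib power_Suc mult_ac)
          ultimately have "s ^ card B * (s\<^sup>2 * (norm (s *\<^sub>R y) ^ p * (1 / s) ^ Suc p)) = s ^ (p - 1) * norm y ^ p"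
            using True by simp
          then show ?thesis using True by (simp flip: ennreal_mult)
        qed
        have "ennreal (s ^ card B) * G (s *\<^sub>R y) s = F (s *\<^sub>R y) * q y * indicator (cball 0 1) y
            * (ennreal (s ^ card B) * (ennreal (s\<^sup>2) * (ennreal (norm (s *\<^sub>R y) ^ p) * ennreal ((1 / s) ^ Suc p))))"
          unfolding G_def q_scale ind by (simp only: mult_ac)
        also have "\<dots> = F (s *\<^sub>R y) * q y * indicator (cball 0 1) y * (ennreal (s ^ (p - 1)) * ennreal (norm y ^ p))"
          unfolding pw ..
        finally show "ennreal (s ^ card B) * G (s *\<^sub>R y) s = indicator {0..} s * ennreal (s ^ (p - 1)) * F (s *\<^sub>R y)
          * w y"
          using True by (simp add: w_def mult_ac)
      qed
      finally show ?thesis .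
    next
      case False
      then have "G x s = 0" for x
        using that norm_ge_zero[of x] by (simp add: G_def indicator_def del: norm_ge_zero)
      then show ?thesis using False that by (simp add: indicator_def)
    qed
    moreover have "AE s in lborel. s \<noteq> (0::real)" by (rule AE_lborel_singleton)
    ultimately show "AE s in lborel. (\<integral>\<^sup>+x. G x s \<partial>M) = (\<integral>\<^sup>+y. indicator {0..} s * ennreal (s ^ (p - 1)) * F (s *\<^sub>R y)
      * w y \<partial>M)"
      by (auto elim!: eventually_mono)
  qed
  also have "\<dots> = (\<integral>\<^sup>+y. (\<integral>\<^sup>+s. indicator {0..} s * ennreal (s ^ (p - 1)) * F (s *\<^sub>R y)
      * w y \<partial>lborel) \<partial>M)"
    by (rule P.Fubini') measurable
  also have "\<dots> = (\<integral>\<^sup>+y. ennreal (c / real p) * (indicator (cball 0 1) y * q y) \<partial>M)"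
  proof (rule nn_integral_cong_AE)
    have "(\<integral>\<^sup>+s. indicator {0..} s * ennreal (s ^ (p - 1)) * F (s *\<^sub>R y)
      * w y \<partial>lborel) = ennreal (c / real p) * (indicator (cball 0 1) y * q y)"
      if y: "y \<in> span B" for y
    proof (cases "y = 0")
      case True then show ?thesis by (simp add: q_def w_def)
    next
      case False
      have "(\<integral>\<^sup>+s. indicator {0..} s * ennreal (s ^ (p - 1)) * F (s *\<^sub>R y)
          * w y \<partial>lborel)
        = (\<integral>\<^sup>+s. indicator {0..} s * ennreal (s ^ (p - 1)) * F (s *\<^sub>R y) \<partial>lborel)
          * w y"
        by (rule nn_integral_multc) measurable
      also have "(\<integral>\<^sup>+s. indicator {0..} s * ennreal (s ^ (p - 1)) * F (s *\<^sub>R y) \<partial>lborel) = ennreal (c / (real p * norm y ^ p))"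
        unfolding F_def by (rule nn_integral_chord[OF y False])
      also have "\<dots> * w y
          = (ennreal (c / (real p * norm y ^ p)) * ennreal (norm y ^ p)) * (indicator (cball 0 1) y * q y)"
        by (simp only: w_def mult_ac)
      \<comment> \<open>The factor \<open>norm y ^ p\<close> inside \<open>w\<close> cancels the
        unit of length of the chord, so the dependence on the direction disappears.\<close>
      also have "ennreal (c / (real p * norm y ^ p)) * ennreal (norm y ^ p) = ennreal (c / real p)"
        using False c_pos by (simp add: field_simps flip: ennreal_mult)
      finally show ?thesis .
    qed
    then show "AE y in M. (\<integral>\<^sup>+s. indicator {0..} s * ennreal (s ^ (p - 1)) * F (s *\<^sub>R y)
      * w y \<partial>lborel) = ennreal (c / real p) * (indicator (cball 0 1) y * q y)"
      using AE_span_lborel_span by (auto elim!: eventually_mono)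
  qed
  also have "\<dots> = ennreal (c / real p) * (\<integral>\<^sup>+y. indicator (cball 0 1) y * q y \<partial>M)"
    by (rule nn_integral_cmult) measurable
  finally have "ennreal (1 / real p) * (2 * (\<integral>\<^sup>+z. indicator K (m + z) * q z \<partial>M))
      = ennreal (c / real p) * (\<integral>\<^sup>+y. indicator (cball 0 1) y * q y \<partial>M)"
    unfolding sym .
  then have "ennreal (real p / 2) * (ennreal (1 / real p) * (2 * (\<integral>\<^sup>+z. indicator K (m + z) * q z \<partial>M)))
      = ennreal (real p / 2) * (ennreal (c / real p) * (\<integral>\<^sup>+y. indicator (cball 0 1) y * q y \<partial>M))" by simp
  moreover have "ennreal (real p / 2) * (ennreal (1 / real p) * (2 * a)) = a" for a
  proof -
    have "ennreal (real p / 2) * (ennreal (1 / real p) * (ennreal 2 * a)) = ennreal (real p / 2 * (1 / real p) * 2) * a"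
      by (subst ennreal_mult, simp, simp)+ (simp only: mult_ac)
    then show ?thesis using p_pos by simp
  qed
  moreover have "ennreal (real p / 2) * (ennreal (c / real p) * a) = ennreal (c / 2) * a" for a
  proof -
    have "ennreal (real p / 2) * (ennreal (c / real p) * a) = ennreal (real p / 2 * (c / real p)) * a"
      using c_pos by (subst ennreal_mult, simp, simp) (simp only: mult_ac)
    then show ?thesis using p_pos by simp
  qed
  ultimately show ?thesis by (simp add: q_def)
qed

text \<open>The reflection \<open>U\<close> in the hyperplane orthogonal to u - v exchanges the two
  vectors and preserves both the ball and the measure; it respects \<open>span B\<close> because e
  lies in it.\<close>

lemma second_moment_ball_unit:
  assumes u: "u \<in> span B" "norm u = 1" and v: "v \<in> span B" "norm v = 1"
  shows "(\<integral>\<^sup>+z. indicator (cball 0 1) z * ennreal ((z \<bullet> u)\<^sup>2) \<partial>M)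
    = (\<integral>\<^sup>+z. indicator (cball 0 1) z * ennreal ((z \<bullet> v)\<^sup>2) \<partial>M)"
proof (cases "u = v")
  case False
  define e where "e = (u - v) /\<^sub>R norm (u - v)"
  define U where "U x = x - (2 * (x \<bullet> e)) *\<^sub>R e" for x
  have uv: "u \<bullet> u = 1" "v \<bullet> v = 1" using u v by (simp_all add: norm_eq_1)
  have "norm e = 1" using False by (simp add: e_def)
  then have ee: "e \<bullet> e = 1" by (simp add: norm_eq_1)
  have lin: "linear U" unfolding U_def by (intro linearI) (auto simp: inner_simps algebra_simps)
  have UU: "U (U x) = x" for x by (simp add: U_def inner_simps ee algebra_simps)
  have adj: "U x \<bullet> y = x \<bullet> U y" for x y by (simp add: U_def inner_simps inner_commute)
  have nrm: "norm (U x) = norm x" for x by (simp add: norm_eq_sqrt_inner adj UU)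
  have e_span: "e \<in> span B" unfolding e_def using u v by (intro span_scale span_diff)
  have "U v = u"
  proof -
    have n2: "(norm (u - v))\<^sup>2 = 2 - 2 * (u \<bullet> v)"
      by (simp add: power2_norm_eq_inner inner_simps uv inner_commute)
    have "norm (u - v) \<noteq> 0" using False by simp
    have "(2 * (v \<bullet> e)) *\<^sub>R e = ((2 * (v \<bullet> u - v \<bullet> v)) / (norm (u - v))\<^sup>2) *\<^sub>R (u - v)"
    proof -
      have "v \<bullet> e = (v \<bullet> u - v \<bullet> v) / norm (u - v)"
        by (simp add: e_def inner_diff_right divide_inverse mult.commute)
      then have "(2 * (v \<bullet> e)) *\<^sub>R e = (2 * ((v \<bullet> u - v \<bullet> v) / norm (u - v)) * inverse (norm (u - v))) *\<^sub>R (u - v)"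
        by (simp only: e_def scaleR_scaleR)
      then show ?thesis by (simp only: power2_eq_square divide_inverse inverse_mult_distrib mult_ac)
    qed
    also have "(2 * (v \<bullet> u - v \<bullet> v)) = - (norm (u - v))\<^sup>2"
      by (simp add: n2 uv inner_commute)
    also have "(- (norm (u - v))\<^sup>2 / (norm (u - v))\<^sup>2) *\<^sub>R (u - v) = v - u"
      using False by simp
    finally show ?thesis by (simp add: U_def)
  qed
  have [measurable]: "cball (0::'a) 1 \<in> sets borel" by simp
  have [measurable]: "U \<in> borel_measurable borel"
    unfolding U_def by measurable
  have "(\<integral>\<^sup>+z. indicator (cball 0 1) z * ennreal ((z \<bullet> u)\<^sup>2) \<partial>M)
      = (\<integral>\<^sup>+z. indicator (cball 0 1) (U z) * ennreal ((U z \<bullet> v)\<^sup>2) \<partial>M)"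
    by (simp add: adj \<open>U v = u\<close> indicator_def nrm)
  also have "\<dots> = (\<integral>\<^sup>+z. indicator (cball 0 1) z * ennreal ((z \<bullet> v)\<^sup>2) \<partial>distr M borel U)"
    by (rule nn_integral_distr[symmetric]) measurable
  also have "distr M borel U = M"
    using e_span by (intro span_lborel_isometry lin nrm UU) (auto simp: U_def intro: span_diff span_scale)
  finally show ?thesis .
qed simp

lemma second_moment_ball:
  obtains \<kappa> where "0 < \<kappa>" "\<And>u. u \<in> span B \<Longrightarrow>
    (\<integral>\<^sup>+z. indicator (cball 0 1) z * ennreal ((z \<bullet> u)\<^sup>2) \<partial>M) = ennreal (\<kappa> * (u \<bullet> u))"
proof -
  have [measurable]: "cball (0::'a) 1 \<in> sets borel" by simp
  define J where "J u = (\<integral>\<^sup>+z. indicator (cball 0 1) z * ennreal ((z \<bullet> u)\<^sup>2) \<partial>M)" for u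
  obtain b where b: "b \<in> B" using n_pos by blast
  have J_eq: "J u = J b" if "u \<in> span B" "norm u = 1" for u
    unfolding J_def using that b by (intro second_moment_ball_unit) (auto intro: span_base norm_one)
  have "J b \<le> (\<integral>\<^sup>+z. indicator (cball 0 1) z \<partial>M)"
    unfolding J_def
  proof (intro nn_integral_mono)
    fix z :: 'a
    have "(z \<bullet> b)\<^sup>2 \<le> 1" if "norm z \<le> 1"
    proof -
      have "\<bar>z \<bullet> b\<bar> \<le> norm z * norm b" by (rule Cauchy_Schwarz_ineq2)
      also have "\<dots> \<le> 1" using that norm_one[OF b] by simp
      finally show ?thesis by (simp add: abs_square_le_1)
    qed
    then show "indicator (cball 0 1) z * ennreal ((z \<bullet> b)\<^sup>2) \<le> indicator (cball 0 1) z"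
      by (auto simp: indicator_def)
  qed
  also have "\<dots> < top" using emeasure_span_lborel_bounded[of "cball 0 1"] by simp
  finally have fin: "J b < top" .
  define \<kappa> where "\<kappa> = enn2real (J b)"
  have \<kappa>: "J b = ennreal \<kappa>" "0 \<le> \<kappa>" using fin by (auto simp: \<kappa>_def)
  have J: "J u = ennreal (\<kappa> * (u \<bullet> u))" if u: "u \<in> span B" for u
  proof (cases "u = 0")
    case True then show ?thesis by (simp add: J_def)
  next
    case False
    have "J u = (\<integral>\<^sup>+z. ennreal (u \<bullet> u) * (indicator (cball 0 1) z * ennreal ((z \<bullet> (u /\<^sub>R norm u))\<^sup>2)) \<partial>M)"
      unfolding J_def
    proof (intro nn_integral_cong)
      fix z :: 'a
      have "(z \<bullet> u)\<^sup>2 = (u \<bullet> u) * (z \<bullet> (u /\<^sub>R norm u))\<^sup>2"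
        using False by (simp add: power_mult_distrib power_inverse power2_norm_eq_inner)
      then show "indicator (cball 0 1) z * ennreal ((z \<bullet> u)\<^sup>2)
          = ennreal (u \<bullet> u) * (indicator (cball 0 1) z * ennreal ((z \<bullet> (u /\<^sub>R norm u))\<^sup>2))"
        by (simp add: ennreal_mult mult_ac)
    qed
    also have "\<dots> = ennreal (u \<bullet> u) * J (u /\<^sub>R norm u)"
      unfolding J_def by (rule nn_integral_cmult) measurable
    also have "J (u /\<^sub>R norm u) = J b" using u False by (intro J_eq) (auto intro: span_scale)
    finally show ?thesis using \<kappa> by (simp add: mult.commute flip: ennreal_mult)
  qed
  have "\<kappa> \<noteq> 0"
  proof
    assume "\<kappa> = 0"
    have "AE z in M. z \<in> cball 0 1 \<longrightarrow> z \<bullet> b' = 0" if "b' \<in> B" for b'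
    proof -
      have "J b' = 0" using J[of b'] that \<open>\<kappa> = 0\<close> by (simp add: span_base)
      then have "AE z in M. indicator (cball 0 1) z * ennreal ((z \<bullet> b')\<^sup>2) = 0"
        unfolding J_def by (subst (asm) nn_integral_0_iff_AE) auto
      then show ?thesis by (auto elim!: eventually_mono simp: indicator_def)
    qed
    then have "AE z in M. \<forall>b'\<in>B. z \<in> cball 0 1 \<longrightarrow> z \<bullet> b' = 0"
      by (intro AE_finite_allI) auto
    \<comment> \<open>If \<kappa> were 0, almost every z in the unit ball would have all coordinates
      0. Radius 1/2 stands for any smaller ball: its measure is smaller by a factor
      \<open>(1 / 2) ^ card B\<close> < 1, a contradiction.\<close>
    then have "AE z in M. z \<in> cball 0 1 \<longrightarrow> z \<in> cball 0 (1 / 2)"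
      using AE_span_lborel_span
    proof eventually_elim
      case (elim z)
      show ?case
      proof
        assume "z \<in> cball 0 1"
        then have "comb (\<lambda>b. z \<bullet> b) = 0" using elim(1) by (intro sum.neutral) auto
        then show "z \<in> cball 0 (1 / 2)" using comb_inner[OF elim(2)] by simp
      qed
    qed
    then have "emeasure M (cball 0 1) \<le> emeasure M (cball 0 (1 / 2))"
      by (intro emeasure_mono_AE) auto
    then have "unit_ball_vol (card B) \<le> unit_ball_vol (card B) * (1 / 2) ^ card B"
      by (simp add: emeasure_span_lborel_cball ennreal_le_iff)
    then have "1 \<le> (1 / 2 :: real) ^ card B"
      using unit_ball_vol_pos[of "real (card B)"] by (simp del: unit_ball_vol_pos add: mult_le_cancel_left1)
    moreover have "0 < card B" using n_pos by (simp add: card_gt_0_iff)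
    then have "(1 / 2 :: real) ^ card B < 1" by (intro power_less_one_iff[THEN iffD2]) auto
    ultimately show False by simp
  qed
  then show ?thesis using J \<kappa>(2) by (intro that[of \<kappa>]) (auto simp: J_def)
qed

text \<open>The quadratic form of the section is a constant multiple of that of the ball, which is
  isotropic; polarization and testing against all vectors upgrade this to the vector
  identity.\<close>

lemma inertia_isotropic:
  "\<exists>l>0. \<forall>h\<in>span B. (\<integral>z. indicator K (m + z) *\<^sub>R ((z \<bullet> h) *\<^sub>R z) \<partial>M) = l *\<^sub>R h"
proof -
  obtain \<kappa> where \<kappa>: "0 < \<kappa>" "\<And>u. u \<in> span B \<Longrightarrow>
    (\<integral>\<^sup>+z. indicator (cball 0 1) z * ennreal ((z \<bullet> u)\<^sup>2) \<partial>M) = ennreal (\<kappa> * (u \<bullet> u))"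
    using second_moment_ball by blast
  define l where "l = c / 2 * \<kappa>"
  have "0 < l" using c_pos \<kappa>(1) by (simp add: l_def)
  have int: "integrable M (\<lambda>z. indicator K (m + z) * ((z \<bullet> h) * (z \<bullet> w)))" for h w
    using integrable_inner_left[OF integrable_section_moment[of m h], of w] by (simp add: mult.assoc)
  have sq: "(\<integral>z. indicator K (m + z) * ((z \<bullet> u) * (z \<bullet> u)) \<partial>M) = l * (u \<bullet> u)" if u: "u \<in> span B" for u
  proof -
    have "ennreal (\<integral>z. indicator K (m + z) * ((z \<bullet> u) * (z \<bullet> u)) \<partial>M)
        = (\<integral>\<^sup>+z. ennreal (indicator K (m + z) * ((z \<bullet> u) * (z \<bullet> u))) \<partial>M)"
      by (rule nn_integral_eq_integral[OF int, symmetric]) auto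
    also have "\<dots> = (\<integral>\<^sup>+z. indicator K (m + z) * ennreal ((z \<bullet> u)\<^sup>2) \<partial>M)"
      by (intro nn_integral_cong) (auto simp: indicator_def power2_eq_square)
    also have "\<dots> = ennreal (c / 2) * ennreal (\<kappa> * (u \<bullet> u))"
      unfolding second_moment_eq_ball \<kappa>(2)[OF u] ..
    also have "\<dots> = ennreal (l * (u \<bullet> u))"
      using c_pos \<kappa>(1) by (simp add: l_def mult.assoc flip: ennreal_mult)
    finally show ?thesis
      using \<open>0 < l\<close> by (subst (asm) ennreal_inj) (auto intro!: Bochner_Integration.integral_nonneg)
  qed
  have bilin: "(\<integral>z. indicator K (m + z) * ((z \<bullet> h) * (z \<bullet> v)) \<partial>M) = l * (h \<bullet> v)"
    if hv: "h \<in> span B" "v \<in> span B" for h v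
  proof -
    let ?q = "\<lambda>u z. indicator K (m + z) * ((z \<bullet> u) * (z \<bullet> u)) :: real"
    have eq: "indicator K (m + z) * ((z \<bullet> h) * (z \<bullet> v)) = (?q (h + v) z - ?q (h - v) z) / 4" for z
      by (simp add: inner_simps algebra_simps)
    have "(\<integral>z. indicator K (m + z) * ((z \<bullet> h) * (z \<bullet> v)) \<partial>M) = ((\<integral>z. ?q (h + v) z \<partial>M) - (\<integral>z. ?q (h - v) z \<partial>M)) / 4"
      unfolding eq using Bochner_Integration.integral_diff[OF int[of "h + v" "h + v"] int[of "h - v" "h - v"]]
      by (simp only: integral_divide_zero)
    also have "\<dots> = (l * ((h + v) \<bullet> (h + v)) - l * ((h - v) \<bullet> (h - v))) / 4"
      using hv by (simp add: sq span_add span_diff del: inner_add_left inner_add_right inner_diff_left inner_diff_right)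
    also have "\<dots> = l * (h \<bullet> v)" by (simp add: inner_simps inner_commute algebra_simps)
    finally show ?thesis .
  qed
  have "(\<integral>z. indicator K (m + z) *\<^sub>R ((z \<bullet> h) *\<^sub>R z) \<partial>M) = l *\<^sub>R h" if h: "h \<in> span B" for h
  proof -
    have "(\<integral>z. indicator K (m + z) *\<^sub>R ((z \<bullet> h) *\<^sub>R z) \<partial>M) \<bullet> w = (l *\<^sub>R h) \<bullet> w" for w
    proof -
      \<comment> \<open>Almost every z is orthogonal to \<xi>, so only the tangential part of w
        matters, and \<open>bilin\<close> wants both arguments in \<open>span B\<close>.\<close>
      define v where "v = w - (w \<bullet> \<xi>) *\<^sub>R \<xi>"
      have v: "v \<in> span B" by (simp add: v_def span_B inner_simps)
      have "(\<integral>z. indicator K (m + z) *\<^sub>R ((z \<bullet> h) *\<^sub>R z) \<partial>M) \<bullet> w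
          = (\<integral>z. (indicator K (m + z) *\<^sub>R ((z \<bullet> h) *\<^sub>R z)) \<bullet> w \<partial>M)"
        by (rule integral_inner_left[symmetric]) (rule integrable_section_moment)
      also have "\<dots> = (\<integral>z. indicator K (m + z) * ((z \<bullet> h) * (z \<bullet> v)) \<partial>M)"
        using AE_orthogonal_xi by (intro integral_cong_AE) (auto elim!: eventually_mono simp: v_def inner_simps)
      also have "\<dots> = l * (h \<bullet> v)" by (rule bilin[OF h v])
      also have "\<dots> = (l *\<^sub>R h) \<bullet> w" using h by (simp add: v_def inner_simps span_B)
      finally show ?thesis .
    qed
    then show ?thesis using vector_eq_rdot by blast
  qed
  then show ?thesis using \<open>0 < l\<close> by blast
qed

end

subsection \<open>First-order expansion of the moment of the submerged part\<close>

text \<open>Signed length: a difference of half-lines treats heights \<rho> of either sign at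
  once.\<close>

lemma has_bochner_integral_indicator_ray_diff:
  "has_bochner_integral lborel (\<lambda>r. indicator {..\<rho>} r - indicator {..0} r :: real) \<rho>"
proof (cases "0 \<le> \<rho>")
  case True
  then have "(\<lambda>r. indicator {..\<rho>} r - indicator {..0} r :: real) = (\<lambda>r. indicator {0<..\<rho>} r)"
    by (auto simp: fun_eq_iff indicator_def)
  then show ?thesis using True has_bochner_integral_real_indicator[of "{0<..\<rho>}" lborel] by simp
next
  case False
  then have "(\<lambda>r. indicator {..\<rho>} r - indicator {..0} r :: real) = (\<lambda>r. - indicator {\<rho><..0} r)"
    by (auto simp: fun_eq_iff indicator_def)
  then show ?thesis
    using False has_bochner_integral_minus[OF has_bochner_integral_real_indicator[of "{\<rho><..0}" lborel]] by simp
qed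

context body_section
begin

lemma frontier_K: "closed (frontier K)" "frontier K \<noteq> {}"
proof -
  have "K \<noteq> {}" "K \<noteq> UNIV"
    using p0_interior interior_subset compact_imp_bounded[OF compact_K] not_bounded_UNIV by auto
  then show "frontier K \<noteq> {}" by (rule frontier_not_empty)
qed (rule frontier_closed)

text \<open>Counts points of the whole hyperplane on both sides of the boundary. Over them,
  membership in the body may change when moving by at most \<eta> along the normal.\<close>

definition layer :: "real \<Rightarrow> real" where
  "layer \<eta> = measure M {z. infdist (m + z) (frontier K) \<le> \<eta>}"

lemma layer_set:
  shows layer_set_borel [measurable]: "{z. infdist (m + z) (frontier K) \<le> \<eta>} \<in> sets borel"
    and layer_set_finite: "emeasure M {z. infdist (m + z) (frontier K) \<le> \<eta>} < top"
proof -
  have "closed {z. infdist (m + z) (frontier K) \<le> \<eta>}"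
    by (intro closed_Collect_le continuous_intros)
  then show "{z. infdist (m + z) (frontier K) \<le> \<eta>} \<in> sets borel" by simp
  have "bounded {z. infdist (m + z) (frontier K) \<le> \<eta>}"
  proof (rule boundedI)
    fix z assume "z \<in> {z. infdist (m + z) (frontier K) \<le> \<eta>}"
    moreover obtain y where y: "y \<in> frontier K" "infdist (m + z) (frontier K) = dist (m + z) y"
      using infdist_attains_inf[OF frontier_K] by blast
    ultimately have "norm (m + z - y) \<le> \<eta>" by (simp add: dist_norm)
    moreover have "norm y \<le> radius"
      using y(1) compact_K by (intro norm_K) (auto simp: frontier_def compact_imp_closed)
    moreover have "norm z \<le> norm (m + z - y) + norm y + norm m"
      using norm_triangle_ineq[of "m + z - y" "y - m"] norm_triangle_ineq4[of y m] by simp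
    ultimately show "norm z \<le> \<eta> + radius + norm m" by simp
  qed
  then show "emeasure M {z. infdist (m + z) (frontier K) \<le> \<eta>} < top"
    by (rule emeasure_span_lborel_bounded)
qed

text \<open>Continuity from above: the layers decrease to the boundary of the section, which is
  null.\<close>

lemma layer_tendsto_0:
  assumes "0 < e"
  obtains \<eta>\<^sub>0 where "0 < \<eta>\<^sub>0" "\<And>\<eta>. \<eta> \<le> \<eta>\<^sub>0 \<Longrightarrow> layer \<eta> < e"
proof -
  define Y where "Y n = {z. infdist (m + z) (frontier K) \<le> 1 / real (Suc n)}" for n
  have "(\<lambda>n. emeasure M (Y n)) \<longlonglongrightarrow> emeasure M (\<Inter>n. Y n)"
  proof (rule Lim_emeasure_decseq)
    show "range Y \<subseteq> sets M" using layer_set_borel by (auto simp: Y_def)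
    show "decseq Y"
    proof (rule antimonoI)
      fix i j :: nat assume "i \<le> j"
      then have "1 / real (Suc j) \<le> 1 / real (Suc i)" by (intro divide_left_mono) auto
      then show "Y j \<subseteq> Y i" by (auto simp: Y_def)
    qed
    show "emeasure M (Y i) \<noteq> \<infinity>" for i using layer_set_finite by (auto simp: Y_def less_top)
  qed
  moreover have "(\<Inter>n. Y n) = {z. m + z \<in> frontier K}"
  proof (intro set_eqI iffI)
    fix z assume z: "z \<in> (\<Inter>n. Y n)"
    have "infdist (m + z) (frontier K) \<le> 0"
    proof (rule field_le_epsilon)
      fix e :: real assume "0 < e"
      then obtain n where "1 / real (Suc n) < e" using nat_approx_posE by blast
      moreover have "infdist (m + z) (frontier K) \<le> 1 / real (Suc n)" using z by (auto simp: Y_def)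
      ultimately show "infdist (m + z) (frontier K) \<le> 0 + e" by simp
    qed
    then show "z \<in> {z. m + z \<in> frontier K}"
      using in_closed_iff_infdist_zero[OF frontier_K] infdist_nonneg[of "m + z" "frontier K"] by auto
  qed (auto simp: Y_def)
  ultimately have "(\<lambda>n. emeasure M (Y n)) \<longlonglongrightarrow> 0" by (simp add: emeasure_section_frontier)
  then have "\<forall>\<^sub>F n in sequentially. emeasure M (Y n) < ennreal e"
    using assms by (intro order_tendstoD) auto
  then obtain n where n: "emeasure M (Y n) < ennreal e" by (auto simp: eventually_sequentially)
  show ?thesis
  proof
    show "0 < 1 / real (Suc n)" by simp
    fix \<eta> assume \<eta>: "\<eta> \<le> 1 / real (Suc n)"
    have "emeasure M {z. infdist (m + z) (frontier K) \<le> \<eta>} \<le> emeasure M (Y n)"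
      using \<eta> layer_set_borel by (intro emeasure_mono) (auto simp: Y_def)
    also have "\<dots> < ennreal e" by (rule n)
    finally have "ennreal (layer \<eta>) < ennreal e"
      using layer_set_finite[of \<eta>] by (simp add: layer_def emeasure_eq_ennreal_measure less_top)
    then show "layer \<eta> < e" using assms by (simp add: layer_def ennreal_less_iff)
  qed
qed

lemma infdist_frontier_le:
  assumes "(x \<in> K) \<noteq> (y \<in> K)"
  shows "infdist x (frontier K) \<le> dist x y"
proof -
  have "closed_segment x y \<inter> frontier K \<noteq> {}"
    using assms by (intro connected_Int_frontier) auto
  then obtain w where w: "w \<in> closed_segment x y" "w \<in> frontier K" by auto
  then have "infdist x (frontier K) \<le> dist x w" by (intro infdist_le)
  also have "\<dots> \<le> dist x y" using w(1) by (metis dist_in_closed_segment dist_commute)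
  finally show ?thesis .
qed

text \<open>The body between the two hyperplanes (\<open>f1\<close>) is replaced by the cylinder
  over the old section (\<open>f2\<close>), with each point replaced by its projection to the
  section. Fubini along \<xi> evaluates the integral of \<open>f2\<close> exactly, and the isotropic
  inertia turns it into -l h up to second order. The remaining bound is o(\<epsilon>) because the
  layer tends to 0.\<close>

lemma half_moment_expansion:
  assumes l: "0 < l" "\<And>h. h \<in> span B \<Longrightarrow> (\<integral>z. indicator K (m + z) *\<^sub>R ((z \<bullet> h) *\<^sub>R z) \<partial>M) = l *\<^sub>R h"
    and \<xi>': "norm \<xi>' = 1" "norm (\<xi>' - \<xi>) = \<epsilon>" "\<epsilon> \<le> 1" and t': "\<bar>t' - t\<bar> \<le> radius * \<epsilon>"
  shows "norm ((\<integral>x. indicator (K \<inter> {x. x \<bullet> \<xi>' \<le> t'}) x *\<^sub>R (x - m) \<partial>lborel)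
      - (\<integral>x. indicator (K \<inter> {x. x \<bullet> \<xi> \<le> t}) x *\<^sub>R (x - m) \<partial>lborel) + l *\<^sub>R (\<xi>' - \<xi>))
    \<le> \<epsilon> * (2 * l * \<epsilon> + 8 * radius * (2 * radius * layer (4 * radius * \<epsilon>)
        + 4 * radius * \<epsilon> * measure M (cball 0 (2 * radius))))"
proof -
  let ?R = radius
  define h where "h = \<xi>' - \<xi>"
  define a where "a = \<xi> \<bullet> \<xi>'"
  \<comment> \<open>Half-height of a slab holding both integrands: heights obey
    \<open>\<bar>r\<bar> * a \<le> 2 * radius * \<epsilon>\<close> for the cylinder, and the cosine
    \<open>a\<close> is at least 1/2 since \<epsilon> is at most 1.\<close>
  define \<eta> where "\<eta> = 4 * ?R * \<epsilon>"
  have \<epsilon>0: "0 \<le> \<epsilon>" using \<xi>'(2) norm_ge_zero by blast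
  have R: "0 < ?R" by (rule radius)
  have \<eta>0: "0 \<le> \<eta>" using \<epsilon>0 R by (simp add: \<eta>_def)
  have nh: "norm h = \<epsilon>" using \<xi>' by (simp add: h_def)
  have \<xi>'1: "\<xi>' \<bullet> \<xi>' = 1" using \<xi>'(1) by (simp add: norm_eq_1)
  have "\<epsilon>\<^sup>2 = 2 - 2 * a"
    unfolding nh[symmetric] power2_norm_eq_inner h_def a_def by (simp add: inner_simps \<xi>'1 inner_commute)
  then have a_eq: "a = 1 - \<epsilon>\<^sup>2 / 2" by linarith
  have "\<epsilon>\<^sup>2 \<le> 1" using \<epsilon>0 \<xi>'(3) by (simp add: power_le_one)
  then have a: "1 / 2 \<le> a" "a \<le> 1" using a_eq by auto
  have h\<xi>: "h \<bullet> \<xi> = a - 1" by (simp add: h_def a_def inner_simps inner_commute)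
  have \<xi>'_h: "x \<bullet> \<xi>' = x \<bullet> \<xi> + x \<bullet> h" for x by (simp add: h_def inner_simps)
  define D where "D x = (indicator {x. x \<bullet> \<xi>' \<le> t'} x - indicator {x. x \<bullet> \<xi> \<le> t} x :: real)" for x
  \<comment> \<open>Orthogonal projection onto the hyperplane of the section.\<close>
  define Q where "Q x = x - ((x - m) \<bullet> \<xi>) *\<^sub>R \<xi>" for x
  define f1 where "f1 x = (D x * indicator K x) *\<^sub>R (x - m)" for x
  define f2 where "f2 x = (D x * indicator K (Q x)) *\<^sub>R (Q x - m)" for x
  define S where "S = {x. \<bar>(x - m) \<bullet> \<xi>\<bar> \<le> \<eta>}"
  define Y where "Y = {z. infdist (m + z) (frontier K) \<le> \<eta>}"
  \<comment> \<open>The two errors: 2 R where x and its projection disagree about lying in the body,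
    which forces the projection close to the boundary; and the displacement \<eta> where both lie in
    it.\<close>
  define g where "g x = 2 * ?R * (indicator S x * indicator Y (Q x - m))
    + \<eta> * (indicator S x * indicator (cball 0 (2 * ?R)) (Q x - m))" for x
  have [measurable]: "{x. x \<bullet> \<xi>' \<le> t'} \<in> sets borel" "{x. x \<bullet> \<xi> \<le> t} \<in> sets borel"
    by (simp_all add: borel_closed closed_halfspace_le inner_commute)
  have [measurable]: "S \<in> sets borel" unfolding S_def
    by (intro borel_closed closed_Collect_le continuous_intros)
  have [measurable]: "Y \<in> sets borel" unfolding Y_def by (rule layer_set_borel)
  have [measurable]: "cball (0::'a) (2 * ?R) \<in> sets borel" by simp
  have [measurable]: "D \<in> borel_measurable borel" "Q \<in> borel_measurable borel"
    unfolding D_def Q_def by measurable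
  have [measurable]: "f1 \<in> borel_measurable borel" "f2 \<in> borel_measurable borel" "g \<in> borel_measurable borel"
    unfolding f1_def f2_def g_def by measurable
  have Q_xi: "Q x \<bullet> \<xi> = t" for x by (simp add: Q_def inner_simps m_level)
  have xQ: "x = Q x + ((x - m) \<bullet> \<xi>) *\<^sub>R \<xi>" for x by (simp add: Q_def)
  have D_cases: "D x \<noteq> 0 \<Longrightarrow> (x \<bullet> \<xi>' \<le> t' \<and> t < x \<bullet> \<xi>) \<or> (t' < x \<bullet> \<xi>' \<and> x \<bullet> \<xi> \<le> t)" "\<bar>D x\<bar> \<le> 1" for x
    by (auto simp: D_def indicator_def split: if_splits)
  have inner_h: "\<bar>x \<bullet> h\<bar> \<le> ?R * \<epsilon>" if "x \<in> K" for x
  proof -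
    have "\<bar>x \<bullet> h\<bar> \<le> norm x * norm h" by (rule Cauchy_Schwarz_ineq2)
    also have "\<dots> \<le> ?R * \<epsilon>" using norm_K[OF that] \<epsilon>0 by (simp add: nh mult_right_mono)
    finally show ?thesis .
  qed
  have S1: "x \<in> S" if "D x \<noteq> 0" "x \<in> K" for x
  proof -
    have "\<bar>x \<bullet> \<xi> - t\<bar> \<le> \<bar>x \<bullet> h\<bar> + \<bar>t' - t\<bar>"
      using D_cases(1)[OF that(1)] \<xi>'_h[of x] by auto
    also have "\<dots> \<le> \<eta>" using inner_h[OF that(2)] t' R \<epsilon>0 by (auto simp: \<eta>_def)
    finally show ?thesis by (simp add: S_def inner_simps m_level)
  qed
  \<comment> \<open>Here x itself may lie outside the body, so \<open>x \<bullet> h\<close> has no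
    direct bound. The height r is estimated instead: being between the two hyperplanes forces r and
    the affine defect at \<open>Q x\<close> to balance.\<close>
  have S2: "x \<in> S" if "D x \<noteq> 0" "Q x \<in> K" for x
  proof -
    define r where "r = (x - m) \<bullet> \<xi>"
    have r: "x \<bullet> \<xi> = t + r" by (simp add: r_def inner_simps m_level)
    have "x \<bullet> \<xi>' = Q x \<bullet> \<xi>' + r * a"
      by (subst xQ) (simp add: inner_simps r_def a_def)
    then have "x \<bullet> \<xi>' = t + Q x \<bullet> h + r * a" by (simp add: \<xi>'_h[of "Q x"] Q_xi)
    then have "\<bar>r * a\<bar> \<le> \<bar>Q x \<bullet> h\<bar> + \<bar>t' - t\<bar>"
      using D_cases(1)[OF that(1)] a r
      by (auto simp: mult_nonneg_nonneg mult_nonpos_nonneg abs_if zero_less_mult_iff mult_less_0_iff)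
    also have "\<dots> \<le> 2 * ?R * \<epsilon>" using inner_h[OF that(2)] t' by simp
    finally have "\<bar>r\<bar> * a \<le> 2 * ?R * \<epsilon>" using a by (simp add: abs_mult)
    moreover have "\<bar>r\<bar> * (1 / 2) \<le> \<bar>r\<bar> * a" using a by (intro mult_left_mono) auto
    ultimately show ?thesis by (simp add: S_def \<eta>_def r_def)
  qed
  have norm_diff: "norm (x - m) \<le> 2 * ?R" if "x \<in> K" for x
    using norm_triangle_ineq4[of x m] norm_K[OF that] norm_K[of m] m_interior interior_subset by fastforce
  have bound: "norm (f1 x - f2 x) \<le> g x" for x
  proof (cases "D x = 0")
    case True then show ?thesis using R \<eta>0 by (simp add: f1_def f2_def g_def)
  next
    case False
    consider "x \<in> K" "Q x \<in> K" | "(x \<in> K) \<noteq> (Q x \<in> K)" | "x \<notin> K" "Q x \<notin> K" by blast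
    then show ?thesis
    proof cases
      case 1
      have xS: "x \<in> S" using S1 False 1 by blast
      have "f1 x - f2 x = D x *\<^sub>R (x - Q x)" using 1 by (simp add: f1_def f2_def algebra_simps)
      also have "x - Q x = ((x - m) \<bullet> \<xi>) *\<^sub>R \<xi>" by (simp add: Q_def)
      finally have "norm (f1 x - f2 x) = \<bar>D x\<bar> * \<bar>(x - m) \<bullet> \<xi>\<bar>" using norm_xi by (simp add: abs_mult)
      also have "\<dots> \<le> 1 * \<eta>" using xS D_cases(2)[of x] by (intro mult_mono) (auto simp: S_def)
      also have "\<dots> \<le> g x" using xS norm_diff[OF 1(2)] R by (simp add: g_def)
      finally show ?thesis .
    next
      case 2
      have xS: "x \<in> S" using S1 S2 False 2 by blast
      have "infdist (Q x) (frontier K) \<le> dist (Q x) x" using 2 by (intro infdist_frontier_le) auto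
      also have "\<dots> = \<bar>(x - m) \<bullet> \<xi>\<bar>" using norm_xi by (simp add: Q_def dist_norm)
      also have "\<dots> \<le> \<eta>" using xS by (simp add: S_def)
      finally have "Q x - m \<in> Y" by (simp add: Y_def)
      then have "2 * ?R \<le> g x" using xS \<eta>0 by (simp add: g_def)
      moreover have "norm (f1 x - f2 x) \<le> 1 * (2 * ?R)"
      proof (cases "x \<in> K")
        case True
        then have "norm (f1 x - f2 x) = \<bar>D x\<bar> * norm (x - m)" using 2 by (simp add: f1_def f2_def)
        also have "\<dots> \<le> 1 * (2 * ?R)" using D_cases(2)[of x] norm_diff[OF True] by (intro mult_mono) auto
        finally show ?thesis .
      next
        case False
        then have "norm (f1 x - f2 x) = \<bar>D x\<bar> * norm (Q x - m)" using 2 by (simp add: f1_def f2_def)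
        also have "\<dots> \<le> 1 * (2 * ?R)" using D_cases(2)[of x] norm_diff[of "Q x"] False 2 by (intro mult_mono) auto
        finally show ?thesis .
      qed
      ultimately show ?thesis by simp
    next
      case 3
      then show ?thesis using R \<eta>0 by (simp add: f1_def f2_def g_def)
    qed
  qed
  have Q_pair: "Q (m + (r *\<^sub>R \<xi> + z)) = m + z" if "z \<bullet> \<xi> = 0" for r z
    using that by (simp add: Q_def inner_simps)
  have S_pair: "m + (r *\<^sub>R \<xi> + z) \<in> S \<longleftrightarrow> r \<in> {- \<eta>..\<eta>}" if "z \<bullet> \<xi> = 0" for r z
    using that by (auto simp: S_def inner_simps)
  have fin: "emeasure M (cball 0 (2 * ?R)) < top" "emeasure M Y < top"
    using emeasure_span_lborel_bounded[of "cball 0 (2 * ?R)"] layer_set_finite by (auto simp: Y_def)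
  have "(\<integral>\<^sup>+x. ennreal (g x) \<partial>lborel) = (\<integral>\<^sup>+z. (\<integral>\<^sup>+r. ennreal (g (m + (r *\<^sub>R \<xi> + z))) \<partial>lborel) \<partial>M)"
    by (rule nn_integral_lborel_pair) measurable
  also have "\<dots> = (\<integral>\<^sup>+z. ennreal (2 * \<eta>) * (ennreal (2 * ?R) * indicator Y z + ennreal \<eta> * indicator (cball 0 (2 * ?R)) z) \<partial>M)"
  proof (rule nn_integral_cong_AE)
    have "(\<integral>\<^sup>+r. ennreal (g (m + (r *\<^sub>R \<xi> + z))) \<partial>lborel)
        = ennreal (2 * \<eta>) * (ennreal (2 * ?R) * indicator Y z + ennreal \<eta> * indicator (cball 0 (2 * ?R)) z)"
      if z: "z \<bullet> \<xi> = 0" for z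
    proof -
      have g_eq: "ennreal (g (m + (r *\<^sub>R \<xi> + z)))
          = (ennreal (2 * ?R) * indicator Y z + ennreal \<eta> * indicator (cball 0 (2 * ?R)) z) * indicator {- \<eta>..\<eta>} r" for r
        using R \<eta>0 by (auto simp: g_def Q_pair[OF z] S_pair[OF z] indicator_def)
      show ?thesis
        unfolding g_eq using \<eta>0 by (subst nn_integral_cmult) (auto simp: mult.commute)
    qed
    then show "AE z in M. (\<integral>\<^sup>+r. ennreal (g (m + (r *\<^sub>R \<xi> + z))) \<partial>lborel)
        = ennreal (2 * \<eta>) * (ennreal (2 * ?R) * indicator Y z + ennreal \<eta> * indicator (cball 0 (2 * ?R)) z)"
      using AE_orthogonal_xi by (auto elim!: eventually_mono)
  qed
  also have "\<dots> = ennreal (2 * \<eta>) * (ennreal (2 * ?R) * emeasure M Y + ennreal \<eta> * emeasure M (cball 0 (2 * ?R)))"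
    by (simp add: nn_integral_cmult nn_integral_add)
  also have "\<dots> = ennreal (2 * \<eta> * (2 * ?R * layer \<eta> + \<eta> * measure M (cball 0 (2 * ?R))))"
    using fin R \<eta>0 by (simp add: emeasure_eq_ennreal_measure layer_def Y_def ennreal_mult ennreal_plus)
  finally have nn_g: "(\<integral>\<^sup>+x. ennreal (g x) \<partial>lborel) = ennreal (2 * \<eta> * (2 * ?R * layer \<eta> + \<eta> * measure M (cball 0 (2 * ?R))))" .
  have g0: "0 \<le> g x" for x using R \<eta>0 by (simp add: g_def)
  have int_g: "integrable lborel g"
    by (rule integrableI_nonneg) (auto simp: nn_g g0)
  have "0 \<le> 2 * \<eta> * (2 * ?R * layer \<eta> + \<eta> * measure M (cball 0 (2 * ?R)))"
    using R \<eta>0 by (intro mult_nonneg_nonneg add_nonneg_nonneg) (auto simp: layer_def)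
  then have integral_g: "(\<integral>x. g x \<partial>lborel) = 2 * \<eta> * (2 * ?R * layer \<eta> + \<eta> * measure M (cball 0 (2 * ?R)))"
    by (intro integral_eq_nn_integral[THEN trans]) (auto simp: nn_g g0)
  have int_half: "integrable lborel (\<lambda>x. indicator (K \<inter> {x. x \<bullet> \<zeta> \<le> s}) x *\<^sub>R (x - m))" for \<zeta> s
  proof (rule integrableI_bounded_set[of K _ _ "2 * ?R"])
    have [measurable]: "{x. x \<bullet> \<zeta> \<le> s} \<in> sets borel"
      by (simp add: borel_closed closed_halfspace_le inner_commute)
    show "(\<lambda>x. indicator (K \<inter> {x. x \<bullet> \<zeta> \<le> s}) x *\<^sub>R (x - m)) \<in> borel_measurable lborel" by measurable
    show "emeasure lborel K < \<infinity>" using emeasure_compact_finite[OF compact_K] by simp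
  qed (use norm_diff R in \<open>auto simp: indicator_def\<close>)
  have f1_eq: "f1 x = indicator (K \<inter> {x. x \<bullet> \<xi>' \<le> t'}) x *\<^sub>R (x - m) - indicator (K \<inter> {x. x \<bullet> \<xi> \<le> t}) x *\<^sub>R (x - m)" for x
    by (auto simp: f1_def D_def indicator_def)
  have int_f1: "integrable lborel f1"
    unfolding f1_eq[abs_def] by (intro Bochner_Integration.integrable_diff int_half)
  have int_diff: "integrable lborel (\<lambda>x. f1 x - f2 x)"
    by (rule Bochner_Integration.integrable_bound[OF int_g]) (auto intro!: AE_I2 order_trans[OF bound])
  \<comment> \<open>Integrability of the cylinder term is inherited from \<open>f1\<close> and the
    dominated difference.\<close>
  have int_f2: "integrable lborel f2"
    using Bochner_Integration.integrable_diff[OF int_f1 int_diff] by simp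
  have "(\<integral>x. f2 x \<partial>lborel) = (\<integral>z. (\<integral>r. f2 (m + (r *\<^sub>R \<xi> + z)) \<partial>lborel) \<partial>M)"
    by (rule integral_lborel_pair[OF int_f2])
  also have "\<dots> = (\<integral>z. ((t' - t - m \<bullet> h) / a) *\<^sub>R (indicator K (m + z) *\<^sub>R z)
      - (1 / a) *\<^sub>R (indicator K (m + z) *\<^sub>R ((z \<bullet> (h - (h \<bullet> \<xi>) *\<^sub>R \<xi>)) *\<^sub>R z)) \<partial>M)"
  proof (rule integral_cong_AE)
    show "(\<lambda>z. \<integral>r. f2 (m + (r *\<^sub>R \<xi> + z)) \<partial>lborel) \<in> borel_measurable M" by measurable
    have "(\<integral>r. f2 (m + (r *\<^sub>R \<xi> + z)) \<partial>lborel) = ((t' - t - m \<bullet> h) / a) *\<^sub>R (indicator K (m + z) *\<^sub>R z)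
      - (1 / a) *\<^sub>R (indicator K (m + z) *\<^sub>R ((z \<bullet> (h - (h \<bullet> \<xi>) *\<^sub>R \<xi>)) *\<^sub>R z))" if z: "z \<bullet> \<xi> = 0" for z
    proof -
      \<comment> \<open>On the line over z the old hyperplane sits at height 0 and the new one at
        height \<rho>, which is affine in z.\<close>
      define \<rho> where "\<rho> = (t' - t - m \<bullet> h - z \<bullet> h) / a"
      have "D (m + (r *\<^sub>R \<xi> + z)) = indicator {..\<rho>} r - indicator {..0} r" for r
      proof -
        have "(m + (r *\<^sub>R \<xi> + z)) \<bullet> \<xi>' = t + m \<bullet> h + z \<bullet> h + r * a"
          using z \<xi>'_h[of m] \<xi>'_h[of z] by (simp add: inner_add_left m_level a_def)
        then have "(m + (r *\<^sub>R \<xi> + z)) \<bullet> \<xi>' \<le> t' \<longleftrightarrow> r \<le> \<rho>"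
          using a by (auto simp: \<rho>_def field_simps)
        moreover have "(m + (r *\<^sub>R \<xi> + z)) \<bullet> \<xi> \<le> t \<longleftrightarrow> r \<le> 0"
          using z by (simp add: inner_simps m_level)
        ultimately show ?thesis by (simp add: D_def indicator_def)
      qed
      then have "f2 (m + (r *\<^sub>R \<xi> + z)) = (indicator {..\<rho>} r - indicator {..0} r) *\<^sub>R (indicator K (m + z) *\<^sub>R z)" for r
        by (simp add: f2_def Q_pair[OF z])
      then have "(\<integral>r. f2 (m + (r *\<^sub>R \<xi> + z)) \<partial>lborel) = (\<integral>r. (indicator {..\<rho>} r - indicator {..0} r) *\<^sub>R (indicator K (m + z) *\<^sub>R z) \<partial>lborel)"
        by simp
      also have "\<dots> = \<rho> *\<^sub>R (indicator K (m + z) *\<^sub>R z)"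
        by (rule has_bochner_integral_integral_eq[OF has_bochner_integral_scaleR_left[OF
              has_bochner_integral_indicator_ray_diff]])
      also have "\<dots> = ((t' - t - m \<bullet> h) / a) *\<^sub>R (indicator K (m + z) *\<^sub>R z)
          - (1 / a) *\<^sub>R (indicator K (m + z) *\<^sub>R ((z \<bullet> (h - (h \<bullet> \<xi>) *\<^sub>R \<xi>)) *\<^sub>R z))"
      proof -
        have "z \<bullet> (h - (h \<bullet> \<xi>) *\<^sub>R \<xi>) = z \<bullet> h" using z by (simp add: inner_diff_right)
        moreover have "\<rho> = (t' - t - m \<bullet> h) / a - (z \<bullet> h) / a" by (simp add: \<rho>_def diff_divide_distrib)
        ultimately show ?thesis by (simp only: scaleR_diff_left) (simp add: mult_ac)
      qed
      finally show ?thesis .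
    qed
    then show "AE z in M. (\<integral>r. f2 (m + (r *\<^sub>R \<xi> + z)) \<partial>lborel) = ((t' - t - m \<bullet> h) / a) *\<^sub>R (indicator K (m + z) *\<^sub>R z)
      - (1 / a) *\<^sub>R (indicator K (m + z) *\<^sub>R ((z \<bullet> (h - (h \<bullet> \<xi>) *\<^sub>R \<xi>)) *\<^sub>R z))"
      using AE_orthogonal_xi by (auto elim!: eventually_mono)
  qed measurable
  \<comment> \<open>The part of \<rho> independent of z, which carries the change of level, meets
    the first moment about \<open>m\<close> and drops out.\<close>
  also have "\<dots> = - (1 / a) *\<^sub>R (l *\<^sub>R (h - (h \<bullet> \<xi>) *\<^sub>R \<xi>))"
  proof -
    let ?h = "h - (h \<bullet> \<xi>) *\<^sub>R \<xi>"
    have hs: "?h \<in> span B" by (simp add: span_B inner_simps)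
    show ?thesis
      using integrable_section_id[of m] integrable_section_moment[of m ?h]
      by (subst Bochner_Integration.integral_diff) (auto simp only: integrable_scaleR_right integral_scaleR_right l(2)[OF hs] integral_section_id_m, auto)
  qed
  finally have int_f2_eq: "(\<integral>x. f2 x \<partial>lborel) = - (1 / a) *\<^sub>R (l *\<^sub>R (h - (h \<bullet> \<xi>) *\<^sub>R \<xi>))" .
  \<comment> \<open>The errors from 1 / a and from the normal component of h are of second order
    because 1 - a is half of \<epsilon> squared; they combine into a multiple of the unit vector
    \<xi>'.\<close>
  have main: "norm ((\<integral>x. f2 x \<partial>lborel) + l *\<^sub>R h) \<le> 2 * l * \<epsilon>\<^sup>2"
  proof -
    have "(\<integral>x. f2 x \<partial>lborel) + l *\<^sub>R h = (l * ((a - 1) / a)) *\<^sub>R (h + \<xi>)"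
    proof -
      have *: "- (q *\<^sub>R (h - b *\<^sub>R \<xi>)) + l *\<^sub>R h = (l - q) *\<^sub>R h + (q * b) *\<^sub>R \<xi>" for q b :: real
        by (simp add: algebra_simps)
      have "l - l / a = l * ((a - 1) / a)" "l / a * (a - 1) = l * ((a - 1) / a)"
        using a by (simp_all add: field_simps)
      then show ?thesis
        unfolding int_f2_eq h\<xi> using *[of "l / a" "a - 1"] by (simp add: scaleR_add_right)
    qed
    then have "norm ((\<integral>x. f2 x \<partial>lborel) + l *\<^sub>R h) = l * ((1 - a) / a) * norm (h + \<xi>)"
    proof -
      have "0 \<le> l * ((1 - a) / a)" using l(1) a by simp
      moreover have "l * ((a - 1) / a) = - (l * ((1 - a) / a))" using a by (simp add: field_simps)
      ultimately have "\<bar>l * ((a - 1) / a)\<bar> = l * ((1 - a) / a)" by (simp only: abs_minus_cancel abs_of_nonneg)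
      then show ?thesis
        using \<open>(\<integral>x. f2 x \<partial>lborel) + l *\<^sub>R h = (l * ((a - 1) / a)) *\<^sub>R (h + \<xi>)\<close> by (simp only: norm_scaleR)
    qed
    also have "h + \<xi> = \<xi>'" by (simp add: h_def)
    also have "l * ((1 - a) / a) * norm \<xi>' = l * ((1 - a) / a)" using \<xi>'(1) by simp
    also have "\<dots> \<le> l * ((1 - a) / (1 / 2))"
      using l(1) a by (intro mult_left_mono divide_left_mono) auto
    also have "\<dots> = l * \<epsilon>\<^sup>2" by (simp add: a_eq)
    also have "\<dots> \<le> 2 * l * \<epsilon>\<^sup>2" using l(1) by simp
    finally show ?thesis .
  qed
  have err: "norm ((\<integral>x. f1 x \<partial>lborel) - (\<integral>x. f2 x \<partial>lborel)) \<le> (\<integral>x. g x \<partial>lborel)"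
  proof -
    have "norm ((\<integral>x. f1 x \<partial>lborel) - (\<integral>x. f2 x \<partial>lborel)) = norm (\<integral>x. f1 x - f2 x \<partial>lborel)"
      using int_f1 int_f2 by simp
    also have "\<dots> \<le> (\<integral>x. norm (f1 x - f2 x) \<partial>lborel)" by (rule integral_norm_bound)
    also have "\<dots> \<le> (\<integral>x. g x \<partial>lborel)"
      using int_diff int_g bound by (intro integral_mono) auto
    finally show ?thesis .
  qed
  have f1_int: "(\<integral>x. f1 x \<partial>lborel) = (\<integral>x. indicator (K \<inter> {x. x \<bullet> \<xi>' \<le> t'}) x *\<^sub>R (x - m) \<partial>lborel)
      - (\<integral>x. indicator (K \<inter> {x. x \<bullet> \<xi> \<le> t}) x *\<^sub>R (x - m) \<partial>lborel)"
    unfolding f1_eq by (intro Bochner_Integration.integral_diff int_half)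
  have "norm ((\<integral>x. indicator (K \<inter> {x. x \<bullet> \<xi>' \<le> t'}) x *\<^sub>R (x - m) \<partial>lborel)
      - (\<integral>x. indicator (K \<inter> {x. x \<bullet> \<xi> \<le> t}) x *\<^sub>R (x - m) \<partial>lborel) + l *\<^sub>R (\<xi>' - \<xi>))
    = norm (((\<integral>x. f1 x \<partial>lborel) - (\<integral>x. f2 x \<partial>lborel)) + ((\<integral>x. f2 x \<partial>lborel) + l *\<^sub>R h))"
    unfolding f1_int[symmetric] h_def by (simp add: algebra_simps)
  also have "\<dots> \<le> (\<integral>x. g x \<partial>lborel) + 2 * l * \<epsilon>\<^sup>2"
    using norm_triangle_ineq err main by (rule order_trans[OF _ add_mono])
  also have "\<dots> = \<epsilon> * (2 * l * \<epsilon> + 8 * radius * (2 * radius * layer (4 * radius * \<epsilon>)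
        + 4 * radius * \<epsilon> * measure M (cball 0 (2 * radius))))"
    unfolding integral_g by (simp add: \<eta>_def power2_eq_square algebra_simps)
  finally show ?thesis .
qed

end

subsection \<open>Conformal maps of the sphere\<close>

lemma unit_vector_orthogonal_to_two:
  fixes a b :: "'a::euclidean_space"
  assumes "3 \<le> DIM('a)"
  obtains w where "norm w = 1" "w \<bullet> a = 0" "w \<bullet> b = 0"
proof -
  have "dim {a, b} \<le> card {a, b}" by (rule dim_le_card') simp
  also have "\<dots> \<le> 2" by (simp add: card_insert_if)
  finally have "dim {a, b} < DIM('a)" using assms by simp
  then obtain x where "x \<noteq> 0" "\<And>y. y \<in> span {a, b} \<Longrightarrow> orthogonal x y"
    using orthogonal_to_subspace_exists by blast
  then have "norm (x /\<^sub>R norm x) = 1" "(x /\<^sub>R norm x) \<bullet> a = 0" "(x /\<^sub>R norm x) \<bullet> b = 0"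
    by (auto simp: orthogonal_def span_base)
  then show ?thesis by (rule that)
qed

text \<open>A derivative within the sphere constrains tangent directions only, so it is evaluated
  solely along curves on the sphere.\<close>

locale conformal_sphere_map =
  fixes f :: "'a::euclidean_space \<Rightarrow> 'a" and L :: "'a \<Rightarrow> real"
  assumes dim: "3 \<le> DIM('a)"
    and der: "\<And>x. norm x = 1 \<Longrightarrow> (f has_derivative (\<lambda>h. L x *\<^sub>R h)) (at x within sphere 0 1)"
begin

lemma derivative_along_curve:
  assumes "\<And>s. norm (\<gamma> s) = 1" "(\<gamma> has_vector_derivative \<gamma>') (at s)"
  shows "((\<lambda>s. f (\<gamma> s) \<bullet> v) has_real_derivative L (\<gamma> s) * (\<gamma>' \<bullet> v)) (at s)"
proof -
  have "(f has_derivative (\<lambda>h. L (\<gamma> s) *\<^sub>R h)) (at (\<gamma> s) within \<gamma> ` UNIV)"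
    using assms(1) by (intro has_derivative_subset[OF der]) auto
  then have "((\<lambda>s. f (\<gamma> s)) has_derivative (\<lambda>h. L (\<gamma> s) *\<^sub>R (h *\<^sub>R \<gamma>'))) (at s)"
    using assms(2) unfolding has_vector_derivative_def by (rule has_derivative_in_compose[rotated])
  then have "((\<lambda>s. f (\<gamma> s) \<bullet> v) has_derivative (\<lambda>h. (L (\<gamma> s) *\<^sub>R (h *\<^sub>R \<gamma>')) \<bullet> v)) (at s)"
    by (rule has_derivative_inner_left)
  then show ?thesis
    unfolding has_field_derivative_def by (rule has_derivative_eq_rhs) (auto simp: mult_ac)
qed

lemma norm_circle:
  assumes "norm a = 1" "norm b = 1" "a \<bullet> b = 0"
  shows "norm (cos s *\<^sub>R a + sin s *\<^sub>R b) = 1"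
proof -
  have "b \<bullet> a = 0" "a \<bullet> a = 1" "b \<bullet> b = 1"
    using assms by (auto simp: norm_eq_1 inner_commute)
  then have "(cos s *\<^sub>R a + sin s *\<^sub>R b) \<bullet> (cos s *\<^sub>R a + sin s *\<^sub>R b) = (cos s)\<^sup>2 + (sin s)\<^sup>2"
    using assms(3) by (simp add: inner_simps power2_eq_square)
  then show ?thesis by (simp add: norm_eq_1)
qed

lemma circle_has_derivative:
  "((\<lambda>s. cos s *\<^sub>R a + sin s *\<^sub>R b) has_vector_derivative (- sin s *\<^sub>R a + cos s *\<^sub>R b)) (at s)"
  by (auto intro!: derivative_eq_intros simp: has_vector_derivative_def scaleR_add_right scaleR_diff_right)

text \<open>
  The component of \<^term>\<open>f\<close> along \<open>w\<close> is constant on each circle of latitude with axis \<open>w\<close>, so its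
  derivative in direction \<open>w\<close> agrees at any two points of the equator.
\<close>

lemma L_eq_orthonormal:
  assumes "norm a = 1" "norm b = 1" "norm w = 1" "a \<bullet> b = 0" "a \<bullet> w = 0" "b \<bullet> w = 0"
  shows "L a = L b"
proof -
  have lat: "f (cos t *\<^sub>R a + sin t *\<^sub>R w) \<bullet> w = f (cos t *\<^sub>R b + sin t *\<^sub>R w) \<bullet> w" for t
  proof -
    \<comment> \<open>The circle of latitude at height \<open>sin t\<close>; a quarter turn carries
      the meridian through a to the one through b.\<close>
    define \<gamma> where "\<gamma> s = cos t *\<^sub>R (cos s *\<^sub>R a + sin s *\<^sub>R b) + sin t *\<^sub>R w" for s
    have n: "norm (\<gamma> s) = 1" for s
      unfolding \<gamma>_def using assms
      by (intro norm_circle) (auto simp: norm_circle inner_simps)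
    have d: "(\<gamma> has_vector_derivative cos t *\<^sub>R (- sin s *\<^sub>R a + cos s *\<^sub>R b)) (at s)" for s
      unfolding \<gamma>_def
      using has_vector_derivative_add[OF has_vector_derivative_scaleR[OF DERIV_const circle_has_derivative]
          has_vector_derivative_const] by simp
    have "((\<lambda>s. f (\<gamma> s) \<bullet> w) has_real_derivative 0) (at s)" for s
      using derivative_along_curve[OF n d, of w s] assms by (simp add: inner_simps)
    then have "f (\<gamma> 0) \<bullet> w = f (\<gamma> (pi / 2)) \<bullet> w"
      by (intro DERIV_isconst_all) auto
    then show ?thesis by (simp add: \<gamma>_def)
  qed
  have "((\<lambda>t. f (cos t *\<^sub>R a + sin t *\<^sub>R w) \<bullet> w) has_real_derivative L a) (at 0)"
    using derivative_along_curve[OF norm_circle[OF assms(1,3,5)] circle_has_derivative, of w 0] assms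
    by (simp add: norm_eq_1)
  moreover have "((\<lambda>t. f (cos t *\<^sub>R b + sin t *\<^sub>R w) \<bullet> w) has_real_derivative L b) (at 0)"
    using derivative_along_curve[OF norm_circle[OF assms(2,3,6)] circle_has_derivative, of w 0] assms
    by (simp add: norm_eq_1)
  ultimately show ?thesis
    unfolding lat by (rule DERIV_unique)
qed

text \<open>The equator argument compares orthogonal points only, so x and y are linked through a w
  orthogonal to both; each comparison needs a further orthogonal axis, which requires dimension
  3.\<close>

lemma L_constant:
  assumes "norm x = 1" "norm y = 1"
  shows "L x = L y"
proof -
  obtain w where w: "norm w = 1" "w \<bullet> x = 0" "w \<bullet> y = 0"
    using unit_vector_orthogonal_to_two[OF dim] .
  obtain u where u: "norm u = 1" "u \<bullet> x = 0" "u \<bullet> w = 0"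
    using unit_vector_orthogonal_to_two[OF dim] .
  obtain v where v: "norm v = 1" "v \<bullet> y = 0" "v \<bullet> w = 0"
    using unit_vector_orthogonal_to_two[OF dim] .
  have "L x = L w" using assms w u by (intro L_eq_orthonormal[of x w u]) (auto simp: inner_commute)
  also have "\<dots> = L y" using assms w v by (intro L_eq_orthonormal[of w y v]) (auto simp: inner_commute)
  finally show ?thesis .
qed

text \<open>Once L is constant, \<open>f\<close> minus that multiple of the identity has zero
  derivative along great circles. A quarter circle joins orthogonal points, and a vector orthogonal
  to both links the general pair.\<close>

lemma homothety:
  assumes "norm x = 1" "norm y = 1"
  shows "f x - L x *\<^sub>R x = f y - L x *\<^sub>R y"
proof -
  have eq: "f a - L x *\<^sub>R a = f b - L x *\<^sub>R b" if ab: "norm a = 1" "norm b = 1" "a \<bullet> b = 0" for a b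
  proof -
    have "(f a - L x *\<^sub>R a) \<bullet> v = (f b - L x *\<^sub>R b) \<bullet> v" for v
    proof -
      define \<gamma> where "\<gamma> s = cos s *\<^sub>R a + sin s *\<^sub>R b" for s
      have n: "norm (\<gamma> s) = 1" for s unfolding \<gamma>_def using norm_circle[OF ab] .
      have d: "(\<gamma> has_vector_derivative - sin s *\<^sub>R a + cos s *\<^sub>R b) (at s)" for s
        unfolding \<gamma>_def by (rule circle_has_derivative)
      have "((\<lambda>s. f (\<gamma> s) \<bullet> v - L x * (\<gamma> s \<bullet> v)) has_real_derivative
          L (\<gamma> s) * ((- sin s *\<^sub>R a + cos s *\<^sub>R b) \<bullet> v) - L x * ((- sin s *\<^sub>R a + cos s *\<^sub>R b) \<bullet> v)) (at s)" for s
        by (intro DERIV_diff derivative_along_curve[OF n d] DERIV_cmult)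
          (auto simp: \<gamma>_def inner_simps intro!: derivative_eq_intros)
      then have "((\<lambda>s. f (\<gamma> s) \<bullet> v - L x * (\<gamma> s \<bullet> v)) has_real_derivative 0) (at s)" for s
        using L_constant[OF assms(1) n] by simp
      then have "f (\<gamma> 0) \<bullet> v - L x * (\<gamma> 0 \<bullet> v) = f (\<gamma> (pi / 2)) \<bullet> v - L x * (\<gamma> (pi / 2) \<bullet> v)"
        by (intro DERIV_isconst_all[where f = "\<lambda>s. f (\<gamma> s) \<bullet> v - L x * (\<gamma> s \<bullet> v)"]) auto
      then show ?thesis by (simp add: \<gamma>_def inner_simps)
    qed
    then show ?thesis using vector_eq_rdot by blast
  qed
  obtain w where w: "norm w = 1" "w \<bullet> x = 0" "w \<bullet> y = 0"
    using unit_vector_orthogonal_to_two[OF dim] .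
  show ?thesis
    using eq[of w x] eq[of w y] assms w by simp
qed

end

subsection \<open>Hausdorff measure of a sphere\<close>

lemma power_diff_le_mult:
  fixes a b :: real
  assumes "0 \<le> b" "b \<le> a"
  shows "a ^ Suc n - b ^ Suc n \<le> (a - b) * (real (Suc n) * a ^ n)"
proof -
  have "(\<Sum>i<Suc n. b ^ (Suc n - Suc i) * a ^ i) \<le> (\<Sum>i<Suc n. a ^ n)"
  proof (intro sum_mono)
    fix i assume i: "i \<in> {..<Suc n}"
    have "b ^ (Suc n - Suc i) * a ^ i \<le> a ^ (Suc n - Suc i) * a ^ i"
      using assms by (intro mult_right_mono power_mono) auto
    also have "\<dots> = a ^ n" using i by (simp flip: power_add)
    finally show "b ^ (Suc n - Suc i) * a ^ i \<le> a ^ n" .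
  qed
  then have "(\<Sum>i<Suc n. b ^ (Suc n - Suc i) * a ^ i) \<le> real (Suc n) * a ^ n" by simp
  then show ?thesis
    unfolding power_diff_sumr2 using assms by (intro mult_left_mono) auto
qed

text \<open>Packing: the disjoint balls of radius \<rho>/2 around the points fit into a shell of
  thickness \<rho> about the sphere, whose volume is at most linear in \<rho>.\<close>

lemma card_separated_sphere_le:
  fixes c :: "'a::euclidean_space"
  assumes D: "DIM('a) = Suc n" and \<rho>: "0 < \<rho>" "\<rho> \<le> R"
    and X: "finite X" "X \<subseteq> sphere c R" "\<And>x y. x \<in> X \<Longrightarrow> y \<in> X \<Longrightarrow> x \<noteq> y \<Longrightarrow> \<rho> \<le> dist x y"
  shows "real (card X) * \<rho> ^ n \<le> 2 ^ Suc n * real (Suc n) * (2 * R) ^ n"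
proof -
  let ?\<omega> = "unit_ball_vol (real (DIM('a)))"
  have disj: "disjoint_family_on (\<lambda>x. ball x (\<rho> / 2)) X"
    unfolding disjoint_family_on_def
  proof (intro ballI impI, rule ccontr)
    fix x y assume xy: "x \<in> X" "y \<in> X" "x \<noteq> y" and "ball x (\<rho> / 2) \<inter> ball y (\<rho> / 2) \<noteq> {}"
    then obtain z where "dist x z < \<rho> / 2" "dist y z < \<rho> / 2" by auto
    then have "dist x y < \<rho>" using dist_triangle2[of x y z] by simp
    with X(3)[OF xy] show False by simp
  qed
  have sub: "(\<Union>x\<in>X. ball x (\<rho> / 2)) \<subseteq> cball c (R + \<rho> / 2) - ball c (R - \<rho> / 2)"
  proof
    fix z assume "z \<in> (\<Union>x\<in>X. ball x (\<rho> / 2))"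
    then obtain x where "dist c x = R" "dist x z < \<rho> / 2" using X(2) by auto
    then show "z \<in> cball c (R + \<rho> / 2) - ball c (R - \<rho> / 2)"
      using dist_triangle[of c z x] dist_triangle2[of c x z] by auto
  qed
  have "real (card X) * (?\<omega> * (\<rho> / 2) ^ Suc n) = (\<Sum>x\<in>X. measure lborel (ball x (\<rho> / 2)))"
    using \<rho> by (simp add: content_ball D)
  also have "\<dots> = measure lborel (\<Union>x\<in>X. ball x (\<rho> / 2))"
    using X(1) disj by (intro measure_finite_Union[symmetric]) (auto simp: emeasure_ball[OF less_imp_le] \<rho> less_top)
  also have "\<dots> \<le> measure lborel (cball c (R + \<rho> / 2) - ball c (R - \<rho> / 2))"
    using sub X(1) by (intro measure_mono_fmeasurable) (auto intro!: fmeasurable_compact compact_diff)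
  also have "\<dots> = ?\<omega> * (R + \<rho> / 2) ^ Suc n - ?\<omega> * (R - \<rho> / 2) ^ Suc n"
  proof -
    have "ball c (R - \<rho> / 2) \<subseteq> cball c (R + \<rho> / 2)" using \<rho> by (auto)
    then have "measure lborel (cball c (R + \<rho> / 2) - ball c (R - \<rho> / 2))
        = measure lborel (cball c (R + \<rho> / 2)) - measure lborel (ball c (R - \<rho> / 2))"
      using \<rho> by (intro measure_Diff) (auto simp: emeasure_cball less_top)
    then show ?thesis using \<rho> by (simp add: content_cball content_ball D)
  qed
  also have "\<dots> = ?\<omega> * ((R + \<rho> / 2) ^ Suc n - (R - \<rho> / 2) ^ Suc n)" by (simp add: algebra_simps)
  also have "\<dots> \<le> ?\<omega> * (\<rho> * (real (Suc n) * (2 * R) ^ n))"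
  proof -
    have "(R + \<rho> / 2) ^ Suc n - (R - \<rho> / 2) ^ Suc n
        \<le> ((R + \<rho> / 2) - (R - \<rho> / 2)) * (real (Suc n) * (R + \<rho> / 2) ^ n)"
      using \<rho> by (intro power_diff_le_mult) auto
    also have "\<dots> \<le> \<rho> * (real (Suc n) * (2 * R) ^ n)"
    proof -
      have "(R + \<rho> / 2) ^ n \<le> (2 * R) ^ n" using \<rho> by (intro power_mono) auto
      then have "\<rho> * (real (Suc n) * (R + \<rho> / 2) ^ n) \<le> \<rho> * (real (Suc n) * (2 * R) ^ n)"
        using \<rho> by (intro mult_left_mono) auto
      then show ?thesis by simp
    qed
    finally show ?thesis by (intro mult_left_mono) auto
  qed
  finally have *: "real (card X) * (?\<omega> * (\<rho> / 2) ^ Suc n) \<le> ?\<omega> * (\<rho> * (real (Suc n) * (2 * R) ^ n))" .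
  have "?\<omega> * \<rho> * (real (card X) * \<rho> ^ n) = 2 ^ Suc n * (real (card X) * (?\<omega> * (\<rho> / 2) ^ Suc n))"
    by (simp add: power_divide)
  also have "\<dots> \<le> 2 ^ Suc n * (?\<omega> * (\<rho> * (real (Suc n) * (2 * R) ^ n)))"
    using * by (intro mult_left_mono) auto
  finally have "?\<omega> * \<rho> * (real (card X) * \<rho> ^ n) \<le> ?\<omega> * \<rho> * (2 ^ Suc n * real (Suc n) * (2 * R) ^ n)"
    by (simp only: mult_ac)
  then show ?thesis
    using \<rho> unit_ball_vol_pos[of "real DIM('a)"] by (simp del: unit_ball_vol_pos)
qed

lemma hausdorff_outer_sphere_finite:
  fixes c :: "'a::euclidean_space"
  assumes R: "0 < R" and D: "DIM('a) = Suc n"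
  shows "hausdorff_outer n (sphere c R) < top"
proof -
  define C where "C = 2 ^ Suc n * real (Suc n) * (2 * R) ^ n"
  have "hausdorff_content n \<epsilon> (sphere c R) \<le> ennreal (unit_ball_vol (real n) * C)" if \<epsilon>: "0 < \<epsilon>" for \<epsilon>
  proof -
    \<comment> \<open>Balls of radius \<rho> then have diameter at most \<epsilon>, and \<rho> \<le>
      R is required by the packing bound.\<close>
    define \<rho> where "\<rho> = min (\<epsilon> / 2) R"
    have \<rho>: "0 < \<rho>" "\<rho> \<le> R" "2 * \<rho> \<le> \<epsilon>" using \<epsilon> R by (auto simp: \<rho>_def)
    define P where "P k \<longleftrightarrow> (\<exists>X. finite X \<and> card X = k \<and> X \<subseteq> sphere c R \<and>
      (\<forall>x\<in>X. \<forall>y\<in>X. x \<noteq> y \<longrightarrow> \<rho> \<le> dist x y))" for k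
    have bound: "real k * \<rho> ^ n \<le> C" if "P k" for k
      using that card_separated_sphere_le[OF D \<rho>(1,2)] unfolding P_def C_def by blast
    have "k \<le> nat \<lceil>C / \<rho> ^ n\<rceil>" if "P k" for k
    proof -
      have "real k \<le> C / \<rho> ^ n" using bound[OF that] \<rho> by (simp add: field_simps)
      then show ?thesis by linarith
    qed
    moreover have "P 0" by (auto simp: P_def)
    \<comment> \<open>A separated set of maximal size is automatically a \<rho>-net. The packing
      bound makes the cost of the resulting cover independent of \<epsilon>.\<close>
    ultimately obtain k where k: "P k" "\<And>j. P j \<Longrightarrow> j \<le> k"
      using Greatest_le_nat[of P] GreatestI_nat[of P] by metis
    then obtain X where X: "finite X" "card X = k" "X \<subseteq> sphere c R"
        "\<And>x y. x \<in> X \<Longrightarrow> y \<in> X \<Longrightarrow> x \<noteq> y \<Longrightarrow> \<rho> \<le> dist x y"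
      unfolding P_def by blast
    have near: "\<exists>x\<in>X. dist x y < \<rho>" if y: "y \<in> sphere c R" for y
    proof (rule ccontr)
      assume "\<not> ?thesis"
      then have far: "\<And>x. x \<in> X \<Longrightarrow> \<rho> \<le> dist x y" by (auto simp: not_less)
      then have "y \<notin> X" using \<rho> by force
      then have "P (Suc k)"
        unfolding P_def using X y far
        by (intro exI[of _ "insert y X"]) (auto simp: dist_commute)
      then show False using k(2) by force
    qed
    obtain h where h: "bij_betw h {..<k} X"
      using ex_bij_betw_nat_finite[OF X(1)] X(2) by (auto simp: atLeast0LessThan)
    define U where "U i = (if i < k then cball (h i) \<rho> else {})" for i
    have "sphere c R \<subseteq> (\<Union>i. U i)"
    proof
      fix y assume "y \<in> sphere c R"
      then obtain x where "x \<in> X" "dist x y < \<rho>" using near by blast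
      moreover obtain i where "i < k" "h i = x" using h \<open>x \<in> X\<close> by (auto simp: bij_betw_def)
      ultimately show "y \<in> (\<Union>i. U i)" by (auto simp: U_def intro!: exI[of _ i])
    qed
    moreover have "bounded (U i) \<and> diameter (U i) \<le> \<epsilon>" for i
      using \<rho> \<epsilon> by (auto simp: U_def diameter_cball)
    ultimately have "hausdorff_content n \<epsilon> (sphere c R) \<le> (\<Sum>i. hausdorff_weight n (U i))"
      unfolding hausdorff_content_def by (intro INF_lower) auto
    also have "\<dots> = (\<Sum>i<k. hausdorff_weight n (U i))"
      by (rule suminf_finite) (auto simp: U_def)
    also have "\<dots> = (\<Sum>i<k. ennreal (unit_ball_vol (real n) * \<rho> ^ n))"
      using \<rho> by (intro sum.cong) (auto simp: U_def hausdorff_weight_def diameter_cball)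
    also have "\<dots> = ennreal (unit_ball_vol (real n) * (real k * \<rho> ^ n))"
      using \<rho> by (subst sum_ennreal) (auto simp: mult_ac)
    also have "\<dots> \<le> ennreal (unit_ball_vol (real n) * C)"
      using bound[OF k(1)] by (intro ennreal_leI mult_left_mono) auto
    finally show ?thesis .
  qed
  then have "hausdorff_outer n (sphere c R) \<le> ennreal (unit_ball_vol (real n) * C)"
    unfolding hausdorff_outer_def by (intro SUP_least) auto
  also have "\<dots> < top" by simp
  finally show ?thesis .
qed

text \<open>A thin cone is covered by about R / r balls of radius 2 r strung along one of its radii,
  each of volume of order r^(n+1); the total is of order r^n, the scale of the Hausdorff
  weight.\<close>

lemma cone_over_small_set:
  fixes c :: "'a::euclidean_space"
  assumes D: "DIM('a) = Suc n" and r: "0 < r" "r \<le> R"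
    and C: "C \<subseteq> sphere c R" "\<And>x y. x \<in> C \<Longrightarrow> y \<in> C \<Longrightarrow> dist x y \<le> r"
  shows "\<exists>T\<in>sets borel. (\<forall>x\<in>C. \<forall>s\<in>{0..1}. c + s *\<^sub>R (x - c) \<in> T) \<and>
    emeasure lborel T \<le> ennreal (3 * R * 2 ^ Suc n * unit_ball_vol (real DIM('a)) * r ^ n)"
proof (cases "C = {}")
  case True
  then show ?thesis by (intro bexI[of _ "{}"]) auto
next
  case False
  then obtain x0 where x0: "x0 \<in> C" by blast
  define N where "N = nat \<lceil>R / r\<rceil>"
  have N: "R / r \<le> real N" "real N \<le> R / r + 1" "1 \<le> R / r" using r by (auto simp: N_def)
  then have N_pos: "0 < real N" by linarith
  have RN: "R / real N \<le> r" using N N_pos r by (simp add: field_simps)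
  let ?p = "\<lambda>j::nat. c + (real j / real N) *\<^sub>R (x0 - c)"
  define T where "T = (\<Union>j\<le>N. cball (?p j) (2 * r))"
  have "c + s *\<^sub>R (x - c) \<in> T" if x: "x \<in> C" and s: "s \<in> {0..1}" for x s
  proof -
    define j where "j = nat \<lfloor>s * real N\<rfloor>"
    have j: "real j \<le> s * real N" "s * real N \<le> real j + 1"
      using s N_pos by (auto simp: j_def)
    have "s * real N \<le> real N" using s by (intro mult_left_le_one_le) auto
    then have "j \<le> N" using j by linarith
    have "\<bar>s - real j / real N\<bar> \<le> 1 / real N"
    proof -
      have "s - real j / real N = (s * real N - real j) / real N" using N_pos by (simp add: field_simps)
      then show ?thesis using j N_pos by (simp add: abs_le_iff divide_right_mono)
    qed
    then have "\<bar>s - real j / real N\<bar> * R \<le> 1 / real N * R"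
      using r by (intro mult_right_mono) auto
    then have A: "\<bar>s - real j / real N\<bar> * R \<le> r" using RN by simp
    have "s * dist x x0 \<le> 1 * r" using s C(2)[OF x x0] by (intro mult_mono) auto
    then have B: "\<bar>s\<bar> * norm (x - x0) \<le> r" using s by (simp add: dist_norm)
    have nx: "norm (x0 - c) = R" using C(1) x0 by (auto simp: dist_norm norm_minus_commute)
    have "(c + s *\<^sub>R (x - c)) - ?p j = s *\<^sub>R (x - x0) + (s - real j / real N) *\<^sub>R (x0 - c)"
      by (simp add: algebra_simps)
    also have "norm \<dots> \<le> \<bar>s\<bar> * norm (x - x0) + \<bar>s - real j / real N\<bar> * R"
      using norm_triangle_ineq[of "s *\<^sub>R (x - x0)" "(s - real j / real N) *\<^sub>R (x0 - c)"] by (simp add: nx)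
    also have "\<dots> \<le> 2 * r" using A B by simp
    finally have "c + s *\<^sub>R (x - c) \<in> cball (?p j) (2 * r)"
      by (simp add: dist_norm norm_minus_commute)
    then show ?thesis unfolding T_def using \<open>j \<le> N\<close> by blast
  qed
  moreover have "emeasure lborel T \<le> ennreal (3 * R * 2 ^ Suc n * unit_ball_vol (real DIM('a)) * r ^ n)"
  proof -
    have "emeasure lborel T \<le> (\<Sum>j\<le>N. emeasure lborel (cball (?p j) (2 * r)))"
      unfolding T_def by (intro emeasure_subadditive_finite) auto
    also have "\<dots> = ennreal (real (Suc N) * (unit_ball_vol (real DIM('a)) * (2 * r) ^ Suc n))"
    proof -
      have "(\<Sum>j\<le>N. emeasure lborel (cball (?p j) (2 * r)))
          = (\<Sum>j\<le>N. ennreal (unit_ball_vol (real DIM('a)) * (2 * r) ^ Suc n))"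
        using r by (intro sum.cong) (auto simp: emeasure_cball D)
      also have "\<dots> = ennreal (\<Sum>j\<le>N. unit_ball_vol (real DIM('a)) * (2 * r) ^ Suc n)"
        using r by (intro sum_ennreal) auto
      finally show ?thesis by simp
    qed
    \<comment> \<open>\<open>Suc N\<close> is at most R / r + 2, hence at most 3 R / r because R / r
      is at least 1.\<close>
    also have "\<dots> \<le> ennreal ((3 * R / r) * (unit_ball_vol (real DIM('a)) * (2 * r) ^ Suc n))"
      using N r by (intro ennreal_leI mult_right_mono) (auto simp: field_simps)
    also have "(3 * R / r) * (unit_ball_vol (real DIM('a)) * (2 * r) ^ Suc n)
        = 3 * R * 2 ^ Suc n * unit_ball_vol (real DIM('a)) * r ^ n"
      using r by (simp add: power_mult_distrib)
    finally show ?thesis .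
  qed
  ultimately show ?thesis by (intro bexI[of _ T]) (auto simp: T_def)
qed

text \<open>A cheap cover of the sphere would give, by coning each piece to the center, a cover of
  the solid ball of total volume below that of the ball.\<close>

lemma hausdorff_outer_sphere_pos:
  fixes c :: "'a::euclidean_space"
  assumes R: "0 < R" and D: "DIM('a) = Suc n" "0 < n"
  shows "0 < hausdorff_outer n (sphere c R)"
proof (rule ccontr)
  assume "\<not> ?thesis"
  then have "hausdorff_content n R (sphere c R) = 0"
    using hausdorff_content_le_outer[OF R, of n "sphere c R"] by (simp add: not_gr_zero)
  define A where "A = 3 * R * 2 ^ Suc n * unit_ball_vol (real DIM('a))"
  define K where "K = A * 2 ^ n / unit_ball_vol (real n)"
  define v where "v = unit_ball_vol (real DIM('a)) * R ^ DIM('a)"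
  have pos: "0 < A" "0 < K" "0 < v" using R by (auto simp: A_def K_def v_def)
  \<comment> \<open>\<open>K\<close> converts Hausdorff weight into cone volume, so this budget
    costs at most v / 4.\<close>
  have "0 < v / (4 * K)" using pos by simp
  then have "hausdorff_content n R (sphere c R) < ennreal (v / (4 * K))"
    using \<open>hausdorff_content n R (sphere c R) = 0\<close> by simp
  then obtain C where C: "sphere c R \<subseteq> (\<Union>i::nat. C i)" "\<And>i. bounded (C i)" "\<And>i. diameter (C i) \<le> R"
      "(\<Sum>i. hausdorff_weight n (C i)) < ennreal (v / (4 * K))"
    unfolding hausdorff_content_def INF_less_iff by blast
  \<comment> \<open>A covering set can have diameter 0 while the cone bound needs r > 0, so
    diameters are raised to at least \<eta>. The geometric decay keeps the extra volume below v / 2,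
    and \<eta> \<le> 1 gives \<eta>^n \<le> \<eta>.\<close>
  define \<eta> where "\<eta> i = min (min 1 R) (v / (2 * A)) * (1 / 2) ^ Suc i" for i
  have \<eta>: "0 < \<eta> i" "\<eta> i \<le> R" "\<eta> i \<le> 1" "\<eta> i \<le> v / (2 * A) * (1 / 2) ^ Suc i" for i
  proof -
    have *: "(1 / 2 :: real) ^ Suc i \<le> 1" "0 < (1 / 2 :: real) ^ Suc i"
      by (rule power_le_one) simp_all
    have **: "0 < min (min 1 R) (v / (2 * A))" using pos R by simp
    show "0 < \<eta> i" unfolding \<eta>_def using * ** by simp
    have "\<eta> i \<le> min (min 1 R) (v / (2 * A)) * 1" unfolding \<eta>_def using * ** by (intro mult_left_mono) auto
    then show "\<eta> i \<le> R" "\<eta> i \<le> 1" by auto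
    show "\<eta> i \<le> v / (2 * A) * (1 / 2) ^ Suc i" unfolding \<eta>_def using * by (intro mult_right_mono) auto
  qed
  have "\<exists>T\<in>sets borel. (\<forall>x\<in>C i \<inter> sphere c R. \<forall>s\<in>{0..1}. c + s *\<^sub>R (x - c) \<in> T) \<and>
    emeasure lborel T \<le> ennreal K * hausdorff_weight n (C i) + ennreal (A * \<eta> i)" for i
  proof (cases "C i = {}")
    case True
    then show ?thesis by (intro bexI[of _ "{}"]) auto
  next
    case False
    define r where "r = max (diameter (C i)) (\<eta> i)"
    have d: "0 \<le> diameter (C i)" by (rule diameter_ge_0[OF C(2)])
    have r: "0 < r" "r \<le> R" using \<eta>[of i] C(3)[of i] by (auto simp: r_def)
    have "dist x y \<le> r" if "x \<in> C i" "y \<in> C i" for x y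
      using diameter_bounded_bound[OF C(2) that] by (simp add: r_def)
    then obtain T where T: "T \<in> sets borel" "\<forall>x\<in>C i \<inter> sphere c R. \<forall>s\<in>{0..1}. c + s *\<^sub>R (x - c) \<in> T"
        "emeasure lborel T \<le> ennreal (A * r ^ n)"
      using cone_over_small_set[OF D(1) r, of "C i \<inter> sphere c R" c] unfolding A_def by (auto simp: mult_ac)
    have "\<eta> i ^ n \<le> \<eta> i ^ 1" using \<eta>[of i] D(2) by (intro power_decreasing) auto
    then have "r ^ n \<le> diameter (C i) ^ n + \<eta> i"
      using d \<eta>[of i] by (auto simp: r_def max_def intro: add_increasing2 add_increasing)
    then have "A * r ^ n \<le> A * (diameter (C i) ^ n + \<eta> i)"
      using pos by (intro mult_left_mono) auto
    also have "\<dots> = K * (unit_ball_vol (real n) * (diameter (C i) / 2) ^ n) + A * \<eta> i"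
      using unit_ball_vol_pos[of "real n"] by (simp add: K_def power_divide distrib_left del: unit_ball_vol_pos)
    finally have "ennreal (A * r ^ n) \<le> ennreal (K * (unit_ball_vol (real n) * (diameter (C i) / 2) ^ n) + A * \<eta> i)"
      by (rule ennreal_leI)
    also have "\<dots> = ennreal K * hausdorff_weight n (C i) + ennreal (A * \<eta> i)"
      using d pos \<eta>[of i] False by (simp add: hausdorff_weight_def ennreal_plus ennreal_mult)
    finally show ?thesis using T by (intro bexI[of _ T]) (auto intro: order_trans)
  qed
  then obtain T where T: "\<And>i. T i \<in> sets borel"
      "\<And>i x s. x \<in> C i \<inter> sphere c R \<Longrightarrow> s \<in> {0..1} \<Longrightarrow> c + s *\<^sub>R (x - c) \<in> T i"
      "\<And>i. emeasure lborel (T i) \<le> ennreal K * hausdorff_weight n (C i) + ennreal (A * \<eta> i)"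
    by metis
  have "cball c R \<subseteq> (\<Union>i. T i)"
  proof
    fix y assume y: "y \<in> cball c R"
    obtain x where x: "x \<in> sphere c R" "y = c + (norm (y - c) / R) *\<^sub>R (x - c)"
    proof (cases "y = c")
      case True
      have "c + R *\<^sub>R (SOME b. b \<in> Basis) \<in> sphere c R"
        using R by (simp add: dist_norm some_in_eq norm_Basis)
      then show ?thesis using that True by force
    next
      case False
      then show ?thesis
        using R by (intro that[of "c + (R / norm (y - c)) *\<^sub>R (y - c)"]) (auto simp: dist_norm)
    qed
    then obtain i where "x \<in> C i" using C(1) by blast
    moreover have "norm (y - c) / R \<in> {0..1}" using y R by (auto simp: dist_norm norm_minus_commute)
    ultimately have "y \<in> T i" using T(2)[of x i "norm (y - c) / R"] x by simp
    then show "y \<in> (\<Union>i. T i)" by blast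
  qed
  then have "emeasure lborel (cball c R) \<le> emeasure lborel (\<Union>i. T i)"
    using T(1) by (intro emeasure_mono) auto
  also have "\<dots> \<le> (\<Sum>i. emeasure lborel (T i))"
    using T(1) by (intro emeasure_subadditive_countably) auto
  also have "\<dots> \<le> (\<Sum>i. ennreal K * hausdorff_weight n (C i) + ennreal (A * \<eta> i))"
    by (intro suminf_le T(3)) auto
  also have "\<dots> = ennreal K * (\<Sum>i. hausdorff_weight n (C i)) + (\<Sum>i. ennreal (A * \<eta> i))"
    by (simp flip: suminf_add)
  also have "(\<Sum>i. ennreal (A * \<eta> i)) \<le> (\<Sum>i. ennreal (v / 2 * (1 / 2) ^ Suc i))"
    using \<eta>(4) pos by (intro suminf_le ennreal_leI) (auto simp: field_simps)
  also have "(\<Sum>i. ennreal (v / 2 * (1 / 2) ^ Suc i)) = ennreal (v / 2)"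
  proof -
    have "(\<lambda>i. v / 2 * (1/2)^Suc i) sums (v / 2 * 1)"
      by (intro sums_mult power_half_series)
    then show ?thesis using pos by (subst suminf_ennreal_eq[of _ "v / 2 * 1"]) auto
  qed
  also have "ennreal K * (\<Sum>i. hausdorff_weight n (C i)) \<le> ennreal K * ennreal (v / (4 * K))"
    using C(4) by (intro mult_left_mono) (auto intro: less_imp_le)
  finally have "ennreal v \<le> ennreal K * ennreal (v / (4 * K)) + ennreal (v / 2)"
    using R by (simp add: emeasure_cball v_def add_left_mono add_right_mono)
  also have "\<dots> = ennreal (v / 4 + v / 2)"
    using pos by (simp flip: ennreal_mult ennreal_plus)
  finally show False using pos by (simp add: ennreal_le_iff2)
qed

section \<open>Point symmetry and the centroid of a sphere\<close>

lemma hausdorff_outer_isometry_le: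
  fixes f :: "'a::metric_space \<Rightarrow> 'a"
  assumes f: "\<And>x y. dist (f x) (f y) = dist x y"
  shows "hausdorff_outer s (f ` A) \<le> hausdorff_outer s A"
proof -
  have diam: "diameter (f ` X) = diameter X" for X
  proof -
    have "(SUP (x, y)\<in>f ` X \<times> f ` X. dist x y) = (SUP z\<in>map_prod f f ` (X \<times> X). case z of (x, y) \<Rightarrow> dist x y)"
      by (simp add: map_prod_surj_on)
    also have "\<dots> = (SUP (x, y)\<in>X \<times> X. dist x y)"
      by (simp add: image_image case_prod_beta f)
    finally show ?thesis by (simp add: diameter_def)
  qed
  have bdd: "bounded (f ` X) \<longleftrightarrow> bounded X" for X
  proof -
    have "bounded (f ` X) \<longleftrightarrow> (\<exists>e. \<forall>x\<in>X. \<forall>y\<in>X. dist (f x) (f y) \<le> e)"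
      by (simp add: bounded_two_points)
    then show ?thesis by (simp add: f bounded_two_points)
  qed
  have "hausdorff_content s \<epsilon> (f ` A) \<le> hausdorff_content s \<epsilon> A" for \<epsilon>
    unfolding hausdorff_content_def[of s \<epsilon> A]
  proof (rule INF_greatest, clarify)
    fix C :: "nat \<Rightarrow> 'a set" assume C: "A \<subseteq> (\<Union>i. C i)" "\<forall>i. bounded (C i) \<and> diameter (C i) \<le> \<epsilon>"
    have "f ` A \<subseteq> (\<Union>i. f ` C i)" using C(1) by blast
    then have "hausdorff_content s \<epsilon> (f ` A) \<le> (\<Sum>i. hausdorff_weight s (f ` C i))"
      unfolding hausdorff_content_def using C(2) by (intro INF_lower) (auto simp: diam bdd)
    also have "\<dots> = (\<Sum>i. hausdorff_weight s (C i))"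
      by (intro arg_cong[where f = suminf]) (auto simp: hausdorff_weight_def diam)
    finally show "hausdorff_content s \<epsilon> (f ` A) \<le> (\<Sum>i. hausdorff_weight s (C i))" .
  qed
  then show ?thesis unfolding hausdorff_outer_def by (intro SUP_mono) auto
qed

text \<open>Reflection in c preserves both the measure and the sphere, so the integral I satisfies I
  = 2 m c - I with m the total mass. Positivity and finiteness of m make the division in
  \<open>centroid\<close> meaningful.\<close>

lemma centroid_hausdorff_sphere:
  fixes c :: "'a::euclidean_space"
  assumes R: "0 < R" and D: "2 \<le> DIM('a)"
  shows "centroid (hausdorff_measure (DIM('a) - 1)) (sphere c R) = c"
proof -
  define n where "n = DIM('a) - 1"
  have n: "DIM('a) = Suc n" "0 < n" using D by (auto simp: n_def)
  let ?H = "hausdorff_measure n :: 'a measure"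
  let ?S = "sphere c R"
  let ?f = "\<lambda>x. 2 *\<^sub>R c - x"
  have S: "emeasure ?H ?S < top" "0 < emeasure ?H ?S"
    using hausdorff_outer_sphere_finite[OF R n(1), of c] hausdorff_outer_sphere_pos[OF R n, of c]
    by (simp_all add: emeasure_hausdorff_measure)
  then have m: "0 < measure ?H ?S"
    by (simp add: measure_def enn2real_positive_iff)
  have g: "(\<lambda>x. indicator ?S x *\<^sub>R x) \<in> borel_measurable borel"
    by (intro borel_measurable_scaleR borel_measurable_indicator measurable_ident_sets) auto
  have int: "integrable ?H (\<lambda>x. indicator ?S x *\<^sub>R x)"
  proof (rule integrableI_bounded_set[of ?S _ _ "norm c + R"])
    show "AE x in ?H. x \<in> ?S \<longrightarrow> norm (indicator ?S x *\<^sub>R x) \<le> norm c + R"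
    proof (intro AE_I2 impI)
      fix x assume "x \<in> ?S"
      then show "norm (indicator ?S x *\<^sub>R x) \<le> norm c + R"
        using norm_triangle_ineq2[of x c] by (auto simp: dist_norm norm_minus_commute)
    qed
    show "(\<lambda>x. indicator ?S x *\<^sub>R x) \<in> borel_measurable ?H" using g by (simp cong: measurable_cong_sets)
  qed (use S in auto)
  have "distr ?H borel ?f = ?H"
  proof (rule measure_eqI)
    fix A assume "A \<in> sets (distr ?H borel ?f)"
    then have [measurable]: "A \<in> sets borel" by simp
    have im: "?f -` A = ?f ` A" 
    proof (intro set_eqI iffI)
      fix x assume "x \<in> ?f -` A"
      then show "x \<in> ?f ` A" by (intro image_eqI[of _ _ "?f x"]) auto
    qed auto
    have iso: "dist (?f x) (?f y) = dist x y" for x y by (simp add: dist_norm norm_minus_commute)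
    have "?f -` A \<in> sets borel" using measurable_sets_borel[of ?f borel A] by simp
    then have "emeasure (distr ?H borel ?f) A = hausdorff_outer n (?f ` A)"
      by (simp add: emeasure_distr emeasure_hausdorff_measure im)
    also have "\<dots> = hausdorff_outer n A"
    proof (rule antisym[OF hausdorff_outer_isometry_le[OF iso]])
      have "?f ` ?f ` A = A" by (auto simp: image_image)
      then show "hausdorff_outer n A \<le> hausdorff_outer n (?f ` A)"
        using hausdorff_outer_isometry_le[OF iso, of n "?f ` A"] by simp
    qed
    finally show "emeasure (distr ?H borel ?f) A = emeasure ?H A"
      by (simp add: emeasure_hausdorff_measure)
  qed simp
  then have "(\<integral>x. indicator ?S x *\<^sub>R x \<partial>?H) = (\<integral>x. indicator ?S x *\<^sub>R x \<partial>distr ?H borel ?f)" by simp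
  also have "\<dots> = (\<integral>x. indicator ?S (?f x) *\<^sub>R ?f x \<partial>?H)"
    using g by (intro integral_distr) (auto cong: measurable_cong_sets)
  also have "\<dots> = (\<integral>x. indicator ?S x *\<^sub>R (2 *\<^sub>R c) - indicator ?S x *\<^sub>R x \<partial>?H)"
  proof (rule Bochner_Integration.integral_cong[OF refl])
    fix x
    have "dist c (?f x) = norm (x - c)" by (simp add: dist_norm scaleR_2)
    then have "?f x \<in> ?S \<longleftrightarrow> x \<in> ?S" by (simp add: dist_norm norm_minus_commute)
    then show "indicator ?S (?f x) *\<^sub>R ?f x = indicator ?S x *\<^sub>R (2 *\<^sub>R c) - indicator ?S x *\<^sub>R x"
      by (simp add: indicator_def)
  qed
  also have "\<dots> = measure ?H ?S *\<^sub>R (2 *\<^sub>R c) - (\<integral>x. indicator ?S x *\<^sub>R x \<partial>?H)"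
    using S by (subst Bochner_Integration.integral_diff[OF _ int]) auto
  finally have "2 *\<^sub>R (\<integral>x. indicator ?S x *\<^sub>R x \<partial>?H) = 2 *\<^sub>R (measure ?H ?S *\<^sub>R c)"
    by (simp only: scaleR_2 scaleR_add_right eq_diff_eq)
  then have "(\<integral>x. indicator ?S x *\<^sub>R x \<partial>?H) = measure ?H ?S *\<^sub>R c" by (simp only: scaleR_cancel_left) simp
  then show ?thesis
    using m unfolding n_def[symmetric] centroid_def set_lebesgue_integral_def by simp
qed

subsection \<open>Floating bodies\<close>

lemma slab_borel [measurable]:
  "{x::'a::euclidean_space. s < x \<bullet> \<xi> \<and> x \<bullet> \<xi> \<le> s' \<and> norm x \<le> R} \<in> sets borel"
proof -
  have "{x \<in> space borel. s < x \<bullet> \<xi> \<and> x \<bullet> \<xi> \<le> s' \<and> norm x \<le> R} \<in> sets (borel :: 'a measure)" by measurable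
  then show ?thesis by simp
qed

context hyperplane
begin

text \<open>Each line in direction \<xi> meets the slab in length at most s' - s, and only lines
  over the ball of radius R meet it. This yields the Lipschitz bound for the submerged
  volume.\<close>

lemma emeasure_slab_le:
  assumes "s \<le> s'"
  shows "emeasure lborel {x. s < x \<bullet> \<xi> \<and> x \<bullet> \<xi> \<le> s' \<and> norm x \<le> R} \<le> ennreal (measure M (cball 0 R) * (s' - s))"
proof -
  let ?A = "{x. s < x \<bullet> \<xi> \<and> x \<bullet> \<xi> \<le> s' \<and> norm x \<le> R}"
  have [measurable]: "cball (0::'a) R \<in> sets borel" by simp
  have "emeasure lborel ?A = (\<integral>\<^sup>+x. indicator ?A x \<partial>lborel)" by simp
  also have "\<dots> = (\<integral>\<^sup>+z. (\<integral>\<^sup>+r. indicator ?A (0 + (r *\<^sub>R \<xi> + z)) \<partial>lborel) \<partial>M)"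
    by (rule nn_integral_lborel_pair) measurable
  also have "\<dots> \<le> (\<integral>\<^sup>+z. ennreal (s' - s) * indicator (cball 0 R) z \<partial>M)"
  proof (rule nn_integral_mono_AE)
    have "(\<integral>\<^sup>+r. indicator ?A (0 + (r *\<^sub>R \<xi> + z)) \<partial>lborel) \<le> ennreal (s' - s) * indicator (cball 0 R) z"
      if z: "z \<bullet> \<xi> = 0" for z
    proof -
      have "norm z \<le> norm (r *\<^sub>R \<xi> + z)" for r
      proof -
        have "(norm z)\<^sup>2 \<le> (norm (r *\<^sub>R \<xi> + z))\<^sup>2"
          using z by (simp add: power2_norm_eq_inner inner_simps inner_commute)
        then show ?thesis by (rule power2_le_imp_le) simp
      qed
      then have "norm z \<le> R" if "norm (r *\<^sub>R \<xi> + z) \<le> R" for r using that order_trans by blast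
      then have "(indicator ?A (0 + (r *\<^sub>R \<xi> + z)) :: ennreal) \<le> indicator (cball 0 R) z * indicator {s<..s'} r" for r
        using z by (auto simp: indicator_def inner_simps)
      then have "(\<integral>\<^sup>+r. indicator ?A (0 + (r *\<^sub>R \<xi> + z)) \<partial>lborel)
          \<le> (\<integral>\<^sup>+r. indicator (cball 0 R) z * indicator {s<..s'} r \<partial>lborel)"
        by (intro nn_integral_mono)
      also have "\<dots> = ennreal (s' - s) * indicator (cball 0 R) z"
        using assms by (subst nn_integral_cmult) (auto simp: mult.commute)
      finally show ?thesis .
    qed
    then show "AE z in M. (\<integral>\<^sup>+r. indicator ?A (0 + (r *\<^sub>R \<xi> + z)) \<partial>lborel) \<le> ennreal (s' - s) * indicator (cball 0 R) z"
      using AE_orthogonal_xi by (auto elim!: eventually_mono)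
  qed
  also have "\<dots> = ennreal (s' - s) * emeasure M (cball 0 R)"
    by (simp add: nn_integral_cmult)
  also have "\<dots> = ennreal (measure M (cball 0 R) * (s' - s))"
    using assms emeasure_span_lborel_bounded[of "cball 0 R"]
    by (simp add: emeasure_eq_ennreal_measure less_top ennreal_mult mult.commute)
  finally show ?thesis .
qed

end

section \<open>Submerged volume and the cut level\<close>

locale floating_body =
  fixes K :: "'a::euclidean_space set" and \<delta> :: real
  assumes body: "convex_body K" and \<delta>_pos: "0 < \<delta>" and \<delta>_less: "\<delta> < measure lborel K"
begin

lemma compact_K: "compact K" and convex_K: "convex K" and interior_K: "interior K \<noteq> {}"
  using body by (auto simp: convex_body_def)

lemma K_borel [measurable]: "K \<in> sets borel"
  using compact_K by (simp add: borel_compact)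

definition vol :: "'a \<Rightarrow> real \<Rightarrow> real" where
  "vol \<xi> s = measure lborel (K \<inter> {p. p \<bullet> \<xi> \<le> s})"

definition R :: real where "R = (SOME R. 0 < R \<and> K \<subseteq> cball 0 R)"

lemma R: "0 < R" "K \<subseteq> cball 0 R"
proof -
  have "\<exists>R. 0 < R \<and> K \<subseteq> cball 0 R"
    using bounded_subset_ballD[OF compact_imp_bounded[OF compact_K], of 0] ball_subset_cball by blast
  from someI_ex[OF this] show "0 < R" "K \<subseteq> cball 0 R" unfolding R_def by auto
qed

lemma half_borel [measurable]: "{p::'a. p \<bullet> \<xi> \<le> s} \<in> sets borel"
  by (simp add: borel_closed closed_halfspace_le inner_commute)

lemma fmeasurable_sub: "A \<subseteq> K \<Longrightarrow> A \<in> sets borel \<Longrightarrow> A \<in> fmeasurable lborel"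
  using fmeasurable_compact[OF compact_K] by (auto intro: fmeasurableI2)

lemma vol_mono: "s \<le> s' \<Longrightarrow> vol \<xi> s \<le> vol \<xi> s'"
  unfolding vol_def by (intro measure_mono_fmeasurable fmeasurable_sub) auto

lemma closed_halfspaces: "closed {p. s \<le> p \<bullet> \<xi>}" "closed {p::'a. p \<bullet> \<xi> \<le> s}"
  using closed_halfspace_ge[of s \<xi>] closed_halfspace_le[of \<xi> s] by (simp_all add: inner_commute)

lemma half_closed_interior:
  assumes "closed C" "interior K \<subseteq> C" shows "K \<subseteq> C"
  using convex_closure_interior[OF convex_K interior_K] closure_minimal[OF assms(2,1)] closure_subset by blast

text \<open>Otherwise the part of the body below the level would lie in a single hyperplane and have
  volume 0.\<close>

lemma interior_below:
  assumes \<xi>: "norm \<xi> = 1" and "0 < vol \<xi> s"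
  obtains q where "q \<in> interior K" "q \<bullet> \<xi> < s"
proof (rule ccontr)
  assume "\<not> thesis"
  then have "s \<le> q \<bullet> \<xi>" if "q \<in> interior K" for q
    using \<open>\<And>q. q \<in> interior K \<Longrightarrow> q \<bullet> \<xi> < s \<Longrightarrow> thesis\<close> that by (meson not_less)
  then have "interior K \<subseteq> {p. s \<le> p \<bullet> \<xi>}" by auto
  then have "K \<subseteq> {p. s \<le> p \<bullet> \<xi>}"
    by (rule half_closed_interior[OF closed_halfspaces(1)])
  then have sub: "K \<inter> {p. p \<bullet> \<xi> \<le> s} \<subseteq> {p. \<xi> \<bullet> p = s}" by (auto simp: inner_commute)
  have "\<xi> \<noteq> 0" using \<xi> by auto
  then have "{p. \<xi> \<bullet> p = s} \<in> null_sets lebesgue"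
    using negligible_hyperplane[of \<xi> s] by (simp add: negligible_iff_null_sets)
  then have "K \<inter> {p. p \<bullet> \<xi> \<le> s} \<in> null_sets lebesgue"
    by (rule null_sets_subset[OF _ _ sub]) simp
  then have "vol \<xi> s = 0" by (simp add: vol_def null_sets_completion_iff measure_eq_0_null_sets)
  then show False using assms by simp
qed

lemma interior_above:
  assumes "vol \<xi> s < measure lborel K"
  obtains q where "q \<in> interior K" "s < q \<bullet> \<xi>"
proof (rule ccontr)
  assume "\<not> thesis"
  then have "q \<bullet> \<xi> \<le> s" if "q \<in> interior K" for q
    using \<open>\<And>q. q \<in> interior K \<Longrightarrow> s < q \<bullet> \<xi> \<Longrightarrow> thesis\<close> that by (meson not_less)
  then have "interior K \<subseteq> {p. p \<bullet> \<xi> \<le> s}" by auto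
  then have "K \<subseteq> {p. p \<bullet> \<xi> \<le> s}"
    by (rule half_closed_interior[OF closed_halfspaces(2)])
  then have "K \<inter> {p. p \<bullet> \<xi> \<le> s} = K" by auto
  then show False using assms by (simp add: vol_def)
qed

lemma interior_at:
  assumes \<xi>: "norm \<xi> = 1" and "0 < vol \<xi> s" "vol \<xi> s' < measure lborel K" "s \<le> w" "w \<le> s'"
  obtains q where "q \<in> interior K" "q \<bullet> \<xi> = w"
proof -
  obtain a where a: "a \<in> interior K" "a \<bullet> \<xi> < s" using interior_below[OF assms(1,2)] .
  obtain b where b: "b \<in> interior K" "s' < b \<bullet> \<xi>" using interior_above[OF assms(3)] .
  define u where "u = (w - a \<bullet> \<xi>) / (b \<bullet> \<xi> - a \<bullet> \<xi>)"
  have ab: "0 < b \<bullet> \<xi> - a \<bullet> \<xi>" using a b assms by linarith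
  have u: "0 \<le> u" "u \<le> 1" using a b assms ab by (auto simp: u_def divide_simps)
  have "(1 - u) *\<^sub>R a + u *\<^sub>R b \<in> interior K"
    using convex_interior[OF convex_K] a(1) b(1) u by (intro convexD) auto
  moreover have "((1 - u) *\<^sub>R a + u *\<^sub>R b) \<bullet> \<xi> = a \<bullet> \<xi> + u * (b \<bullet> \<xi> - a \<bullet> \<xi>)"
    by (simp add: inner_simps algebra_simps)
  then have "((1 - u) *\<^sub>R a + u *\<^sub>R b) \<bullet> \<xi> = w" using ab by (simp add: u_def)
  ultimately show ?thesis by (rule that)
qed

text \<open>The volume is strictly monotone only while it is neither 0 nor full; then some interior
  point lies halfway between the levels, with a ball around it that is gained.\<close>

lemma vol_strict:
  assumes \<xi>: "norm \<xi> = 1" and "s < s'" "0 < vol \<xi> s" "vol \<xi> s' < measure lborel K"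
  shows "vol \<xi> s < vol \<xi> s'"
proof -
  obtain q where q: "q \<in> interior K" "q \<bullet> \<xi> = (s + s') / 2"
    using interior_at[OF \<xi> assms(3,4), of "(s + s') / 2"] assms(2) by auto
  let ?S = "interior K \<inter> ({p. s < p \<bullet> \<xi>} \<inter> {p. p \<bullet> \<xi> < s'})"
  have "open ?S" by (intro open_Int open_Collect_less continuous_intros) auto
  moreover have "q \<in> ?S" using q assms(2) by auto
  ultimately obtain r where r: "0 < r" "ball q r \<subseteq> ?S" using open_contains_ball by blast
  have "vol \<xi> s + measure lborel (ball q r) = measure lborel ((K \<inter> {p. p \<bullet> \<xi> \<le> s}) \<union> ball q r)"
    unfolding vol_def using r(2) interior_subset[of K]
    by (intro measure_Un_AE[symmetric] AE_I2 fmeasurable_sub) auto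
  also have "\<dots> \<le> vol \<xi> s'"
    unfolding vol_def using r(2) interior_subset[of K] assms(2)
    by (intro measure_mono_fmeasurable fmeasurable_sub) (auto simp: subset_iff)
  finally show ?thesis using r(1) content_ball_pos[OF r(1), of q] less_le_trans[OF less_add_same_cancel1[THEN iffD2]] by blast
qed

lemma vol_continuous:
  assumes \<xi>: "norm \<xi> = 1"
  shows "continuous_on UNIV (vol \<xi>)"
proof -
  interpret hyperplane "orthonormal_basis_of {x. x \<bullet> \<xi> = 0}" \<xi>
    by (rule hyperplane_orthonormal_basis_of[OF \<xi>])
  let ?C = "measure M (cball 0 R)"
  have step: "\<bar>vol \<xi> s' - vol \<xi> s\<bar> \<le> ?C * (s' - s)" if "s \<le> s'" for s s'
  proof -
    let ?A = "{x. s < x \<bullet> \<xi> \<and> x \<bullet> \<xi> \<le> s' \<and> norm x \<le> R}"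
    have "vol \<xi> s' - vol \<xi> s = measure lborel ((K \<inter> {p. p \<bullet> \<xi> \<le> s'}) - (K \<inter> {p. p \<bullet> \<xi> \<le> s}))"
      unfolding vol_def using that
      by (intro measurable_measure_Diff[symmetric] fmeasurable_sub) auto
    moreover have "emeasure lborel ((K \<inter> {p. p \<bullet> \<xi> \<le> s'}) - (K \<inter> {p. p \<bullet> \<xi> \<le> s})) \<le> emeasure lborel ?A"
    proof (rule emeasure_mono)
      show "(K \<inter> {p. p \<bullet> \<xi> \<le> s'}) - (K \<inter> {p. p \<bullet> \<xi> \<le> s}) \<subseteq> ?A" using R(2) by auto
      show "?A \<in> sets lborel" using slab_borel by simp
    qed
    then have "emeasure lborel ((K \<inter> {p. p \<bullet> \<xi> \<le> s'}) - (K \<inter> {p. p \<bullet> \<xi> \<le> s})) \<le> ennreal (?C * (s' - s))"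
      using emeasure_slab_le[OF that, of R] order_trans by blast
    then have "measure lborel ((K \<inter> {p. p \<bullet> \<xi> \<le> s'}) - (K \<inter> {p. p \<bullet> \<xi> \<le> s})) \<le> ?C * (s' - s)"
      unfolding measure_def using that by (intro enn2real_leI) auto
    ultimately show ?thesis using vol_mono[OF that, of \<xi>] by simp
  qed
  have "?C-lipschitz_on UNIV (vol \<xi>)"
  proof (rule lipschitz_onI)
    fix s s' :: real
    show "dist (vol \<xi> s) (vol \<xi> s') \<le> ?C * dist s s'"
      using step[of s s'] step[of s' s] by (cases "s \<le> s'") (auto simp: dist_real_def abs_minus_commute)
  qed simp
  then show ?thesis by (rule lipschitz_on_continuous_on)
qed

lemma cut_level_unique:
  assumes \<xi>: "norm \<xi> = 1"
  shows "\<exists>!s. vol \<xi> s = \<delta>"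
proof (rule ex_ex1I)
  have "\<bar>p \<bullet> \<xi>\<bar> \<le> R" if "p \<in> K" for p
    using Cauchy_Schwarz_ineq2[of p \<xi>] \<xi> R(2) that by force
  \<comment> \<open>The half-space at level -R can still touch the body; one unit lower it misses
    it.\<close>
  then have "K \<inter> {p. p \<bullet> \<xi> \<le> - R - 1} = {}" "K \<inter> {p. p \<bullet> \<xi> \<le> R} = K" by force+
  then have "vol \<xi> (- R - 1) = 0" "vol \<xi> R = measure lborel K" by (simp_all add: vol_def)
  then show "\<exists>s. vol \<xi> s = \<delta>"
    using IVT'[of "vol \<xi>" "- R - 1" \<delta> R] \<delta>_pos \<delta>_less R(1)
      continuous_on_subset[OF vol_continuous[OF \<xi>]] by auto
  fix s s' assume "vol \<xi> s = \<delta>" "vol \<xi> s' = \<delta>"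
  then show "s = s'"
    using vol_strict[OF \<xi>, of s s'] vol_strict[OF \<xi>, of s' s] \<delta>_pos \<delta>_less by (cases s s' rule: linorder_cases) auto
qed

lemma vol_cut_level: "norm \<xi> = 1 \<Longrightarrow> vol \<xi> (cut_level K \<delta> \<xi>) = \<delta>"
  using theI'[OF cut_level_unique] by (simp add: cut_level_def vol_def)

text \<open>Turning \<xi> changes the height of a point of the body by at most r times the change of
  direction, so shifting the level by that amount nests the half-spaces. The radius is left free
  because the expansion uses the one of \<open>body_section\<close>.\<close>

lemma cut_level_le:
  assumes \<xi>: "norm \<xi> = 1" "norm \<xi>' = 1" and r: "K \<subseteq> cball 0 r"
  shows "cut_level K \<delta> \<xi>' \<le> cut_level K \<delta> \<xi> + r * norm (\<xi>' - \<xi>)"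
proof (rule ccontr)
  let ?t = "cut_level K \<delta> \<xi>" and ?t' = "cut_level K \<delta> \<xi>'" and ?e = "r * norm (\<xi>' - \<xi>)"
  assume "\<not> ?thesis"
  then have less: "?t < ?t' - ?e" by simp
  have "K \<inter> {p. p \<bullet> \<xi> \<le> ?t' - ?e} \<subseteq> K \<inter> {p. p \<bullet> \<xi>' \<le> ?t'}"
  proof safe
    fix p assume p: "p \<in> K" "p \<bullet> \<xi> \<le> ?t' - ?e"
    have "p \<bullet> (\<xi>' - \<xi>) \<le> norm p * norm (\<xi>' - \<xi>)" by (rule norm_cauchy_schwarz)
    also have "\<dots> \<le> ?e" using p(1) r by (intro mult_right_mono) auto
    finally show "p \<bullet> \<xi>' \<le> ?t'" using p(2) by (simp add: inner_simps)
  qed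
  then have "vol \<xi> (?t' - ?e) \<le> vol \<xi>' ?t'"
    unfolding vol_def by (intro measure_mono_fmeasurable fmeasurable_sub) auto
  then have "vol \<xi> (?t' - ?e) \<le> \<delta>" using vol_cut_level[OF \<xi>(2)] by simp
  moreover have "\<delta> < vol \<xi> (?t' - ?e)"
    using vol_strict[OF \<xi>(1) less] vol_cut_level[OF \<xi>(1)] \<delta>_pos \<delta>_less \<open>vol \<xi> (?t' - ?e) \<le> \<delta>\<close> by simp
  ultimately show False by simp
qed

section \<open>Derivative of the center of mass of the submerged part\<close>

lemma submerged_center_moment:
  assumes \<xi>: "norm \<xi> = 1"
  shows "(\<integral>x. indicator (K \<inter> {x. x \<bullet> \<xi> \<le> cut_level K \<delta> \<xi>}) x *\<^sub>R (x - m) \<partial>lborel)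
    = \<delta> *\<^sub>R (submerged_center K \<delta> \<xi> - m)"
proof -
  let ?S = "K \<inter> {x. x \<bullet> \<xi> \<le> cut_level K \<delta> \<xi>}"
  have \<delta>: "measure lborel ?S = \<delta>" using vol_cut_level[OF \<xi>] by (simp add: vol_def)
  have fm: "?S \<in> fmeasurable lborel" by (rule fmeasurable_sub) auto
  have int: "integrable lborel (\<lambda>x. indicator ?S x *\<^sub>R x)"
  proof (rule integrableI_bounded_set[of K _ _ R])
    show "emeasure lborel K < \<infinity>" using emeasure_compact_finite[OF compact_K] by simp
    show "AE x in lborel. x \<in> K \<longrightarrow> norm (indicator ?S x *\<^sub>R x) \<le> R"
      using R by (intro AE_I2) (auto simp: indicator_def)
  qed (auto simp: indicator_def)
  have "(\<integral>x. indicator ?S x *\<^sub>R (x - m) \<partial>lborel) = (\<integral>x. indicator ?S x *\<^sub>R x - indicator ?S x *\<^sub>R m \<partial>lborel)"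
    by (simp add: scaleR_diff_right)
  also have "\<dots> = (\<integral>x. indicator ?S x *\<^sub>R x \<partial>lborel) - \<delta> *\<^sub>R m"
    using fm \<delta> by (subst Bochner_Integration.integral_diff[OF int]) (auto simp: fmeasurable_def)
  also have "(\<integral>x. indicator ?S x *\<^sub>R x \<partial>lborel) = \<delta> *\<^sub>R submerged_center K \<delta> \<xi>"
    using \<delta>_pos \<delta> by (simp add: submerged_center_def centroid_def cutting_halfspace_def set_lebesgue_integral_def)
  finally show ?thesis by (simp add: scaleR_diff_right)
qed

lemma submerged_center_derivative:
  assumes \<xi>: "norm \<xi> = 1" and dim: "2 \<le> DIM('a)" and eq: "equichordal_section (DIM('a) + 1) K \<delta> \<xi>"
  shows "\<exists>L<0. (submerged_center K \<delta> has_derivative (\<lambda>h. L *\<^sub>R h)) (at \<xi> within sphere 0 1)"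
proof -
  let ?B = "orthonormal_basis_of {x. x \<bullet> \<xi> = 0}" and ?t = "cut_level K \<delta> \<xi>"
  let ?F = "submerged_center K \<delta>"
  interpret hyperplane ?B \<xi> by (rule hyperplane_orthonormal_basis_of[OF \<xi>])
  obtain p0 where p0: "p0 \<in> interior K" "p0 \<bullet> \<xi> = ?t"
    using interior_at[OF \<xi>, of ?t ?t ?t] vol_cut_level[OF \<xi>] \<delta>_pos \<delta>_less by auto
  interpret body_section ?B \<xi> K p0
    using compact_K convex_K p0(1) by unfold_locales
  have t: "t = ?t" using p0(2) by (simp add: t_def)
  have "hyperplane_lborel \<xi> ?t = distr M borel ((+) (?t *\<^sub>R \<xi>))"
    unfolding hyperplane_lborel_def span_lborel_def Let_def
    by (subst distr_distr) (auto simp: comp_def)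
  then have m: "section_center K \<delta> \<xi> = m"
    by (simp add: section_center_def m_def t cutting_hyperplane_def)
  obtain c where c: "\<And>l z\<^sub>1 z\<^sub>2. affine l \<and> aff_dim l = 1 \<and> l \<subseteq> cutting_hyperplane K \<delta> \<xi> \<and> m \<in> l \<and>
        z\<^sub>1 \<noteq> z\<^sub>2 \<and> l \<inter> frontier K = {z\<^sub>1, z\<^sub>2} \<Longrightarrow>
        dist m z\<^sub>1 ^ (DIM('a) + 1) + dist m z\<^sub>2 ^ (DIM('a) + 1) = c"
    using eq unfolding equichordal_section_def Let_def m by blast
  have card: "card ?B + 2 = DIM('a) + 1" using card_B by simp
  interpret equichordal_body_section ?B \<xi> K p0 c
  proof
    show "?B \<noteq> {}" using card_B dim by auto
    show "dist m z\<^sub>1 ^ (card ?B + 2) + dist m z\<^sub>2 ^ (card ?B + 2) = c"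
      if "affine l" "aff_dim l = 1" "l \<subseteq> {p. p \<bullet> \<xi> = t}" "m \<in> l" "z\<^sub>1 \<noteq> z\<^sub>2" "l \<inter> frontier K = {z\<^sub>1, z\<^sub>2}" for l z\<^sub>1 z\<^sub>2
      unfolding card using that by (intro c[of l]) (auto simp: cutting_hyperplane_def t)
  qed
  obtain l where l: "0 < l" "\<forall>h\<in>span ?B. (\<integral>z. indicator K (m + z) *\<^sub>R ((z \<bullet> h) *\<^sub>R z) \<partial>M) = l *\<^sub>R h"
    using inertia_isotropic by blast
  define V where "V = measure M (cball 0 (2 * radius))"
  have "(?F has_derivative (\<lambda>h. (- (l / \<delta>)) *\<^sub>R h)) (at \<xi> within sphere 0 1)"
    unfolding has_derivative_within_alt
  proof (intro conjI allI impI)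
    show "bounded_linear ((*\<^sub>R) (- (l / \<delta>)) :: 'a \<Rightarrow> 'a)" by (rule bounded_linear_scaleR_right)
    fix e :: real assume e: "0 < e"
    have R0: "0 < radius" by (rule radius)
    \<comment> \<open>The threshold makes the layer term
      \<open>16 * radius * radius * layer (4 * radius * \<epsilon>)\<close> at most half of e
      \<delta>.\<close>
    obtain \<eta> where \<eta>: "0 < \<eta>" "\<And>x. x \<le> \<eta> \<Longrightarrow> layer x < e * \<delta> / (32 * radius * radius)"
      using layer_tendsto_0[of "e * \<delta> / (32 * radius * radius)"] e \<delta>_pos R0 by auto
    define W where "W = 2 * l + 32 * radius * radius * V"
    have W: "0 < W" using l(1) R0 by (auto simp: W_def V_def intro!: add_pos_nonneg)
    \<comment> \<open>The three bounds serve, in order, the hypothesis \<epsilon> \<le> 1 of the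
      expansion, the layer estimate, and the other half of e \<delta> for the term linear in
      \<open>W\<close>.\<close>
    define d where "d = min 1 (min (\<eta> / (4 * radius)) (e * \<delta> / (2 * W)))"
    show "\<exists>d>0. \<forall>y\<in>sphere 0 1. norm (y - \<xi>) < d \<longrightarrow>
        norm (?F y - ?F \<xi> - (- (l / \<delta>)) *\<^sub>R (y - \<xi>)) \<le> e * norm (y - \<xi>)"
    proof (intro exI[of _ d] conjI ballI impI)
      show "0 < d" using \<eta>(1) R0 e \<delta>_pos W by (simp add: d_def)
      fix y :: 'a assume y: "y \<in> sphere 0 1" and "norm (y - \<xi>) < d"
      define \<epsilon> where "\<epsilon> = norm (y - \<xi>)"
      have \<epsilon>: "0 \<le> \<epsilon>" "\<epsilon> \<le> 1" "\<epsilon> \<le> \<eta> / (4 * radius)" "\<epsilon> \<le> e * \<delta> / (2 * W)"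
        using \<open>norm (y - \<xi>) < d\<close> by (auto simp: \<epsilon>_def d_def)
      have ny: "norm y = 1" using y by simp
      have "\<bar>cut_level K \<delta> y - t\<bar> \<le> radius * \<epsilon>"
        using cut_level_le[OF \<xi> ny radius(2)] cut_level_le[OF ny \<xi> radius(2)]
        by (simp add: t \<epsilon>_def norm_minus_commute abs_le_iff)
      from half_moment_expansion[OF l(1) l(2)[rule_format] ny \<epsilon>_def[symmetric] \<epsilon>(2) this]
      have "norm (\<delta> *\<^sub>R (?F y - m) - \<delta> *\<^sub>R (?F \<xi> - m) + l *\<^sub>R (y - \<xi>))
          \<le> \<epsilon> * (2 * l * \<epsilon> + 8 * radius * (2 * radius * layer (4 * radius * \<epsilon>) + 4 * radius * \<epsilon> * V))"
        unfolding t submerged_center_moment[OF \<xi>] submerged_center_moment[OF ny] V_def .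
      also have "\<dots> = \<epsilon> * (W * \<epsilon> + 16 * radius * radius * layer (4 * radius * \<epsilon>))"
        by (simp add: W_def algebra_simps)
      also have "\<dots> \<le> \<epsilon> * (e * \<delta>)"
      proof (rule mult_left_mono[OF _ \<epsilon>(1)])
        have "W * \<epsilon> \<le> e * \<delta> / 2" using \<epsilon>(4) W by (simp add: field_simps)
        moreover have "layer (4 * radius * \<epsilon>) \<le> e * \<delta> / (32 * radius * radius)"
          proof -
          have "4 * radius * \<epsilon> \<le> \<eta>" using \<epsilon>(3) R0 by (simp add: pos_le_divide_eq mult.commute)
          then show ?thesis by (rule less_imp_le[OF \<eta>(2)])
        qed
        then have "16 * radius * radius * layer (4 * radius * \<epsilon>) \<le> 16 * radius * radius * (e * \<delta> / (32 * radius * radius))"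
          using R0 by (intro mult_left_mono) auto
        moreover have "16 * radius * radius * (e * \<delta> / (32 * radius * radius)) = e * \<delta> / 2"
          using R0 by simp
        ultimately show "W * \<epsilon> + 16 * radius * radius * layer (4 * radius * \<epsilon>) \<le> e * \<delta>" by linarith
      qed
      finally have "norm (\<delta> *\<^sub>R (?F y - m) - \<delta> *\<^sub>R (?F \<xi> - m) + l *\<^sub>R (y - \<xi>)) \<le> \<epsilon> * (e * \<delta>)" .
      \<comment> \<open>Both moments are taken about the centroid of the section at \<xi>, so it
        cancels; dividing by \<delta> gives the scalar -l/\<delta>.\<close>
      moreover have "\<delta> *\<^sub>R (?F y - m) - \<delta> *\<^sub>R (?F \<xi> - m) + l *\<^sub>R (y - \<xi>)
          = \<delta> *\<^sub>R (?F y - ?F \<xi> - (- (l / \<delta>)) *\<^sub>R (y - \<xi>))"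
        using \<delta>_pos by (simp add: scaleR_diff_right scaleR_add_right)
      ultimately have "\<delta> * norm (?F y - ?F \<xi> - (- (l / \<delta>)) *\<^sub>R (y - \<xi>)) \<le> \<delta> * (e * \<epsilon>)"
        using \<delta>_pos by (simp add: mult_ac)
      then show "norm (?F y - ?F \<xi> - (- (l / \<delta>)) *\<^sub>R (y - \<xi>)) \<le> e * norm (y - \<xi>)"
        using \<delta>_pos by (simp add: \<epsilon>_def del: mult_minus_left scaleR_minus_left)
    qed
  qed
  moreover have "- (l / \<delta>) < 0" using l(1) \<delta>_pos by simp
  ultimately show ?thesis by blast
qed

end

lemma homothety_image_sphere:
  fixes c :: "'a::real_normed_vector"
  assumes "r < 0"
  shows "(\<lambda>x. c + r *\<^sub>R x) ` sphere 0 1 = sphere c (- r)"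
proof (intro set_eqI iffI)
  fix y assume "y \<in> sphere c (- r)"
  then have "norm ((y - c) /\<^sub>R r) = 1" "y = c + r *\<^sub>R ((y - c) /\<^sub>R r)"
    using assms by (auto simp: dist_norm norm_minus_commute)
  then show "y \<in> (\<lambda>x. c + r *\<^sub>R x) ` sphere 0 1" by (intro image_eqI[of _ _ "(y - c) /\<^sub>R r"]) (simp_all only: mem_sphere_0)
qed (use assms in \<open>auto simp: dist_norm\<close>)

lemma affine_parallel_line:
  fixes c \<xi> :: "'a::real_vector"
  assumes "r \<noteq> 0"
  shows "affine_parallel (affine hull {c, c + r *\<^sub>R \<xi>}) (span {\<xi>})"
proof -
  have "span {\<xi>} = (\<lambda>x. - c + x) ` (affine hull {c, c + r *\<^sub>R \<xi>})"
  proof (intro set_eqI iffI)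
    fix x assume "x \<in> span {\<xi>}"
    then obtain k where k: "x = k *\<^sub>R \<xi>" by (auto simp: span_singleton)
    have "c + x = (1 - k / r) *\<^sub>R c + (k / r) *\<^sub>R (c + r *\<^sub>R \<xi>)"
      using assms by (simp add: k algebra_simps)
    moreover have "(1 - k / r) + k / r = 1" by simp
    ultimately have "c + x \<in> affine hull {c, c + r *\<^sub>R \<xi>}" unfolding affine_hull_2 by blast
    then show "x \<in> (\<lambda>x. - c + x) ` (affine hull {c, c + r *\<^sub>R \<xi>})"
      by (intro image_eqI[of _ _ "c + x"]) auto
  next
    fix x assume "x \<in> (\<lambda>x. - c + x) ` (affine hull {c, c + r *\<^sub>R \<xi>})"
    then obtain u v where uv: "u + v = 1" "x = - c + (u *\<^sub>R c + v *\<^sub>R (c + r *\<^sub>R \<xi>))"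
      by (auto simp: affine_hull_2)
    have "x = (u + v - 1) *\<^sub>R c + (v * r) *\<^sub>R \<xi>" unfolding uv(2) by (simp add: algebra_simps)
    then have "x = (v * r) *\<^sub>R \<xi>" using uv(1) by simp
    then show "x \<in> span {\<xi>}" by (simp add: span_scale span_base)
  qed
  then show ?thesis unfolding affine_parallel_def by blast
qed

theorem corollary1:
  fixes K :: "'a::euclidean_space set" and \<delta> :: real
  assumes "DIM('a) \<ge> 3"
    and "convex_body K"
    and "C1_boundary K"
    and "0 < \<delta>" and "\<delta> < measure lborel K"
    and "centroid lborel K = centroid (hausdorff_measure (DIM('a) - 1)) (surface_of_centers K \<delta>)"
    and "\<forall>\<xi>\<in>sphere 0 1. equichordal_section (DIM('a) + 1) K \<delta> \<xi>"
  shows "\<forall>\<xi>\<in>sphere 0 1. floats_in_equilibrium K \<delta> \<xi>"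
proof
  fix \<xi> :: 'a assume \<xi>: "\<xi> \<in> sphere 0 1"
  interpret floating_body K \<delta> using assms by unfold_locales
  let ?F = "submerged_center K \<delta>"
  have "\<forall>x\<in>sphere 0 1. \<exists>L<0. (?F has_derivative (\<lambda>h. L *\<^sub>R h)) (at x within sphere 0 1)"
    using assms(1,7) by (intro ballI submerged_center_derivative) auto
  then obtain L where L: "\<And>x. x \<in> sphere 0 1 \<Longrightarrow> L x < 0"
      "\<And>x. x \<in> sphere 0 1 \<Longrightarrow> (?F has_derivative (\<lambda>h. L x *\<^sub>R h)) (at x within sphere 0 1)"
    by metis
  interpret conformal_sphere_map ?F L
    using assms(1) L(2) by unfold_locales auto
  define c where "c = ?F \<xi> - L \<xi> *\<^sub>R \<xi>"
  have F: "?F x = c + L \<xi> *\<^sub>R x" if "x \<in> sphere 0 1" for x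
    using homothety[of \<xi> x] \<xi> that by (simp add: c_def algebra_simps)
  have "surface_of_centers K \<delta> = (\<lambda>x. c + L \<xi> *\<^sub>R x) ` sphere 0 1"
    unfolding surface_of_centers_def using F by (intro image_cong) auto
  also have "\<dots> = sphere c (- L \<xi>)"
    by (rule homothety_image_sphere[OF L(1)[OF \<xi>]])
  \<comment> \<open>The radius is -L(\<xi>), positive as L(\<xi>) is negative.\<close>
  finally have "centroid lborel K = c"
    using assms(1,6) L(1)[OF \<xi>] centroid_hausdorff_sphere[of "- L \<xi>" c] by simp
  then show "floats_in_equilibrium K \<delta> \<xi>"
    using affine_parallel_line[of "L \<xi>" c \<xi>] L(1)[OF \<xi>] F[OF \<xi>]
    by (simp add: floats_in_equilibrium_def)
qed

end
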